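(* Let $T$ be a centered, isotropic Gaussian random field on $\mathbb S^2$ with angular power spectrum $(A_\ell,\ell\in\mathbb N_0)$. If $\sum_{\ell=0}^\infty A_\ell\,\ell^{1+\beta}<+\infty$ for some $\beta>0$, then there exists a $C^\gamma(\mathbb S^2)$-valued modification of $T$ for all $\gamma<\beta/2$; that is, the modification is $k$-times continuously differentiable with $k=\lceil\beta/2\rceil-1$, and the $k$th derivatives are Hölder continuous with exponent $\gamma-k$ (for $k<\gamma<\beta/2$).
   Context: $\mathbb S^2$ is the unit sphere in $\mathbb R^3$. A centered isotropic Gaussian random field on $\mathbb S^2$ is a jointly measurable map $T:\Omega\times\mathbb S^2\to\mathbb R$ that is Gaussian (all finite-dimensional distributions are multivariate Gaussian), with mean zero and covariance invariant under rotations in $\mathrm{SO}(3)$. Its angular power spectrum is the sequence of nonnegative reals $(A_\ell,\ell\in\mathbb N_0)$ with $\mathbb E(T(x)T(y))=\sum_{\ell=0}^\infty A_\ell\frac{2\ell+1}{4\pi}P_\ell(\langle x,y\rangle_{\mathbb R^3})$, where $P_\ell$ is the $\ell$-th Legendre polynomial. A modification of $T$ is a random field $\tilde T$ with $\mathbb P(\tilde T(x)=T(x))=1$ for every $x\in\mathbb S^2$; regularity refers to its sample paths. $C^\gamma(\mathbb S^2)$ denotes the Hölder space of order $\gamma$. *)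

theory Defs
  imports "HOL-Probability.Probability" "HOL-Computational_Algebra.Polynomial"
begin

section \<open>Gaussian random fields on the unit sphere\<close>

abbreviation S2 :: "(real ^ 3) set"
  where "S2 \<equiv> sphere 0 1"

text \<open>Rodrigues' formula.\<close>

definition legendre_poly :: "nat \<Rightarrow> real poly"
  where "legendre_poly l = smult (1 / (2 ^ l * fact l)) ((pderiv ^^ l) ([:-1, 0, 1:] ^ l))"

text \<open>Normal distributions include the degenerate ones, i.e. the point masses.\<close>

definition gaussian_rv :: "'a measure \<Rightarrow> ('a \<Rightarrow> real) \<Rightarrow> bool"
  where "gaussian_rv M X \<longleftrightarrow>
    X \<in> borel_measurable M \<and>
    (\<exists>\<mu> \<sigma>. 0 \<le> \<sigma> \<and>
      distr M borel X =
        (if \<sigma> = 0 then return borel \<mu> else density lborel (\<lambda>x. ennreal (normal_density \<mu> \<sigma> x))))"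

text \<open>A finite family is multivariate Gaussian iff all its linear combinations are normal; this
  allows singular covariance matrices.\<close>

definition multivariate_gaussian :: "'a measure \<Rightarrow> nat \<Rightarrow> (nat \<Rightarrow> 'a \<Rightarrow> real) \<Rightarrow> bool"
  where "multivariate_gaussian M n X \<longleftrightarrow>
    (\<forall>a :: nat \<Rightarrow> real. gaussian_rv M (\<lambda>\<omega>. \<Sum>i<n. a i * X i \<omega>))"

text \<open>Fields are total functions on the ambient space; only their values on the sphere matter.\<close>

definition random_field :: "'a measure \<Rightarrow> ('a \<Rightarrow> real ^ 3 \<Rightarrow> real) \<Rightarrow> bool"
  where "random_field M T \<longleftrightarrow>
    (\<lambda>(\<omega>, x). T \<omega> x) \<in> borel_measurable (M \<Otimes>\<^sub>M restrict_space borel S2)"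

definition gaussian_field :: "'a measure \<Rightarrow> ('a \<Rightarrow> real ^ 3 \<Rightarrow> real) \<Rightarrow> bool"
  where "gaussian_field M T \<longleftrightarrow>
    random_field M T \<and>
    (\<forall>n (x :: nat \<Rightarrow> real ^ 3). (\<forall>i<n. x i \<in> S2) \<longrightarrow> multivariate_gaussian M n (\<lambda>i \<omega>. T \<omega> (x i)))"

definition centered_isotropic_gaussian_field :: "'a measure \<Rightarrow> ('a \<Rightarrow> real ^ 3 \<Rightarrow> real) \<Rightarrow> bool"
  where "centered_isotropic_gaussian_field M T \<longleftrightarrow>
    gaussian_field M T \<and>
    (\<forall>x\<in>S2. (LINT \<omega>|M. T \<omega> x) = 0) \<and>
    (\<forall>R :: real ^ 3 ^ 3. rotation_matrix R \<longrightarrow>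
      (\<forall>x\<in>S2. \<forall>y\<in>S2.
        (LINT \<omega>|M. T \<omega> (R *v x) * T \<omega> (R *v y)) = (LINT \<omega>|M. T \<omega> x * T \<omega> y)))"

definition angular_power_spectrum ::
    "'a measure \<Rightarrow> ('a \<Rightarrow> real ^ 3 \<Rightarrow> real) \<Rightarrow> (nat \<Rightarrow> real) \<Rightarrow> bool"
  where "angular_power_spectrum M T A \<longleftrightarrow>
    (\<forall>l. 0 \<le> A l) \<and>
    (\<forall>x\<in>S2. \<forall>y\<in>S2.
      (\<lambda>l. A l * ((2 * real l + 1) / (4 * pi)) * poly (legendre_poly l) (x \<bullet> y))
        sums (LINT \<omega>|M. T \<omega> x * T \<omega> y))"

definition modification ::
    "'a measure \<Rightarrow> ('a \<Rightarrow> real ^ 3 \<Rightarrow> real) \<Rightarrow> ('a \<Rightarrow> real ^ 3 \<Rightarrow> real) \<Rightarrow> bool"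
  where "modification M T T' \<longleftrightarrow>
    random_field M T' \<and> (\<forall>x\<in>S2. \<P>(\<omega> in M. T' \<omega> x = T \<omega> x) = 1)"


section \<open>Differentiability and Hoelder spaces\<close>

definition partial_deriv :: "'n::finite \<Rightarrow> (real ^ 'n \<Rightarrow> real) \<Rightarrow> real ^ 'n \<Rightarrow> real"
  where "partial_deriv i g u = frechet_derivative g (at u) (axis i 1)"

definition iter_partial_deriv :: "'n::finite list \<Rightarrow> (real ^ 'n \<Rightarrow> real) \<Rightarrow> real ^ 'n \<Rightarrow> real"
  where "iter_partial_deriv js g = foldr partial_deriv js g"

text \<open>Differentiability of the derivatives of order less than \<open>k\<close> is demanded explicitly because
  \<^const>\<open>frechet_derivative\<close> is an arbitrary value at points of non-differentiability.\<close>

definition k_times_cont_diff :: "nat \<Rightarrow> (real ^ 'n::finite \<Rightarrow> real) \<Rightarrow> bool"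
  where "k_times_cont_diff k g \<longleftrightarrow>
    (\<forall>js. length js < k \<longrightarrow> (\<forall>u. iter_partial_deriv js g differentiable (at u))) \<and>
    (\<forall>js. length js \<le> k \<longrightarrow> continuous_on UNIV (iter_partial_deriv js g))"

definition locally_hoelder :: "real \<Rightarrow> (real ^ 'n::finite \<Rightarrow> real) \<Rightarrow> bool"
  where "locally_hoelder \<alpha> g \<longleftrightarrow>
    (\<forall>K. compact K \<longrightarrow> (\<exists>C. \<forall>u\<in>K. \<forall>v\<in>K. \<bar>g u - g v\<bar> \<le> C * dist u v powr \<alpha>))"

text \<open>The smooth structure of the sphere is given by the two stereographic charts.  The inverse of
  the projection from the pole \<open>(0, 0, s)\<close>, with \<open>s = 1\<close> or \<open>s = -1\<close>, is
  \<open>u \<mapsto> (2 u\<^sub>1, 2 u\<^sub>2, s (|u|\<^sup>2 - 1)) / (|u|\<^sup>2 + 1)\<close>.\<close>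

definition stereo_inv :: "real \<Rightarrow> real ^ 2 \<Rightarrow> real ^ 3"
  where "stereo_inv s u =
    (1 / ((norm u)\<^sup>2 + 1)) *\<^sub>R vector [2 * u $ 1, 2 * u $ 2, s * ((norm u)\<^sup>2 - 1)]"

definition k_times_cont_diff_S2 :: "nat \<Rightarrow> (real ^ 3 \<Rightarrow> real) \<Rightarrow> bool"
  where "k_times_cont_diff_S2 k f \<longleftrightarrow> (\<forall>s\<in>{1, -1}. k_times_cont_diff k (f \<circ> stereo_inv s))"

text \<open>Hoelder continuity in charts is required on compact sets of the chart domain.  As the sphere is
  compact and the change of charts is smooth, this yields the usual Hoelder spaces, independently
  of the atlas.\<close>

definition derivs_hoelder_S2 :: "nat \<Rightarrow> real \<Rightarrow> (real ^ 3 \<Rightarrow> real) \<Rightarrow> bool"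
  where "derivs_hoelder_S2 k \<alpha> f \<longleftrightarrow>
    (\<forall>s\<in>{1, -1}. \<forall>js. length js = k \<longrightarrow>
      locally_hoelder \<alpha> (iter_partial_deriv js (f \<circ> stereo_inv s)))"

text \<open>\<open>C\<^sup>\<gamma>\<close> for \<open>\<gamma> \<ge> 0\<close> is \<open>C\<^bsup>k,\<gamma>-k\<^esup>\<close> with \<open>k = \<lfloor>\<gamma>\<rfloor>\<close>.  If \<open>\<gamma>\<close> is an integer this is the classical
  space \<open>C\<^sup>k\<close>, since the Hoelder condition with exponent \<open>0\<close> only asserts local boundedness.\<close>

definition C_gamma_S2 :: "real \<Rightarrow> (real ^ 3 \<Rightarrow> real) set"
  where "C_gamma_S2 \<gamma> =
    {f. k_times_cont_diff_S2 (nat \<lfloor>\<gamma>\<rfloor>) f \<and>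
        derivs_hoelder_S2 (nat \<lfloor>\<gamma>\<rfloor>) (\<gamma> - of_int \<lfloor>\<gamma>\<rfloor>) f}"

end

theory Submission
  imports Defs
begin

text \<open>Let \<open>g = T \<circ> stereo_inv s\<close> be the field read in a stereographic chart. Everything follows from the size of
  its finite differences \<open>\<Sum>r\<le>D. (-1)^(D-r) (D choose r) g (u + r h e)\<close> in coordinate directions \<open>e\<close>, for a large
  fixed order \<open>D\<close>. By the spectral representation of the covariance, the variance of such a difference is
  \<open>\<Sum>l. A l (2l+1)/(4\<pi>) V\<^sub>l\<close>, where \<open>V\<^sub>l\<close> is the double difference of the kernel \<open>P\<^sub>l(\<langle>x, y\<rangle>)\<close>.

  In the chart \<open>\<langle>x, y\<rangle> = 1 - 2t\<close> with \<open>t = |u - v|\<^sup>2 w(u) w(v)\<close> and \<open>w = 1 / (1 + |u|\<^sup>2)\<close>, and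
  \<open>P\<^sub>l(1 - 2t) = \<Sum>k. (-1)^k (l choose k) (l+k choose k) t^k\<close>, where the \<open>k\<close>-th coefficient is at most
  \<open>(2 l\<^sup>2)^k / k!\<close>. For \<open>l h \<le> 1\<close> the powers \<open>k \<ge> m\<close> contribute at most a multiple of \<open>(l h)^(2m)\<close>, because
  \<open>t\<close> is of order \<open>h\<^sup>2\<close>; the powers \<open>k < m\<close> do so because, along a line, \<open>w^k\<close> is a polynomial up to an
  error \<open>h^(2m)\<close> and differences of order \<open>D\<close> annihilate polynomials of degree less than \<open>D\<close>. For \<open>l h > 1\<close> the
  bound \<open>\<bar>P\<^sub>l\<bar> \<le> 1\<close> suffices. With \<open>2m \<ge> \<beta>\<close> both cases give \<open>\<bar>V\<^sub>l\<bar> \<le> C (l h) powr \<beta>\<close>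
  (\<open>legendre_double_difference_bound\<close>), so by the summability of \<open>A l * l powr (1 + \<beta>)\<close> the
  differences have variance at most \<open>V h powr \<beta>\<close> (\<open>chart_diff_variance\<close>).

  A centered Gaussian variable has moments of all orders controlled by its variance. Hence, almost surely, for
  every \<open>\<gamma> < \<beta>/2\<close> all differences with mesh \<open>2^(-n)\<close> at the dyadic points of a bounded region are at most
  \<open>2^(-n \<gamma>)\<close> once \<open>n\<close> is large (\<open>chart_diff_small_on_grid\<close>, by Borel--Cantelli).

  The regularity of the limit is then deterministic. Let \<open>\<eta>\<close> be a compactly supported function of class \<open>C^(k+1)\<close> whose integer translates
  reproduce polynomials of degree less than \<open>D\<close>. The functions \<open>g\<^sub>n\<close> that spread the samples of \<open>g\<close> on the
  grid of mesh \<open>2^(-n)\<close> by translates of the rescaled \<open>\<eta> \<otimes> \<eta>\<close> are as smooth as \<open>\<eta>\<close>, and \<open>g\<^sub>n\<^sub>+\<^sub>1 - g\<^sub>n\<close> is a local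
  combination of samples that vanishes on polynomials. It is therefore bounded by the differences of order \<open>D\<close>,
  and its derivatives of order \<open>j \<le> k + 1\<close> are of size \<open>2^(n (j - \<gamma>))\<close> (\<open>grid_sum_increment\<close>). Summing over \<open>n\<close>,
  the limit is \<open>C^k\<close> with the required Hoelder continuous derivatives (\<open>smooth_limit\<close>); the Hoelder bound
  interpolates between the estimates for the orders \<open>j\<close> and \<open>j + 1\<close>.

  Finally \<open>g\<^sub>n(u)\<close> converges to \<open>g(u)\<close> in mean, so the limit is almost surely equal to \<open>g(u)\<close> at each point. The
  limits in the two charts agree almost surely on a countable dense set, hence everywhere by continuity, and define
  one function on the sphere; outside this event it is replaced by \<open>0\<close>.\<close>

section \<open>Legendre polynomials\<close>

lemma pderiv_funpow_pcompose_affine: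
  fixes p :: "'a::{comm_ring_1, idom} poly"
  shows "(pderiv ^^ n) (pcompose p [:a, b:]) = smult (b ^ n) (pcompose ((pderiv ^^ n) p) [:a, b:])"
proof (induction n)
  case (Suc n)
  then show ?case
    by (simp add: pderiv_smult pderiv_pcompose pderiv_pCons mult.commute)
qed simp

lemma coeff_pderiv_funpow:
  fixes p :: "real poly"
  shows "coeff ((pderiv ^^ n) p) k = fact (n + k) / fact k * coeff p (n + k)"
proof (induction n arbitrary: k)
  case (Suc n)
  have "coeff ((pderiv ^^ Suc n) p) k = (real k + 1) * (fact (n + Suc k) / fact (Suc k) * coeff p (n + Suc k))"
    by (simp add: coeff_pderiv Suc add.commute)
  also have "(real k + 1) * (fact (n + Suc k) / fact (Suc k) * coeff p (n + Suc k))
      = ((real k + 1) / fact (Suc k)) * fact (Suc n + k) * coeff p (Suc n + k)"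
    by simp
  also have "(real k + 1) / fact (Suc k) = 1 / fact k"
    by (simp add: nonzero_divide_eq_eq nonzero_eq_divide_eq)
  finally show ?case by simp
qed simp

definition shifted_legendre_coeff :: "nat \<Rightarrow> nat \<Rightarrow> real"
  where "shifted_legendre_coeff l k = (-1) ^ k * real (l choose k) * real ((l + k) choose k)"

lemma pcompose_power: "pcompose (p ^ n) q = pcompose p q ^ n" for p q :: "'a::comm_ring_1 poly"
  by (induction n) (simp_all add: pcompose_mult pcompose_1)

text \<open>Substituting \<open>t = 1 - 2x\<close> into Rodrigues' formula turns \<open>(t\<^sup>2 - 1)^l\<close> into a multiple of
  \<open>(x - x\<^sup>2)^l\<close>; the factor \<open>x^l\<close> makes its \<open>l\<close>-th derivative easy to read off.\<close>

lemma coeff_monom_times_one_minus_power: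
  "coeff ([:0, 1, -1:] ^ l :: real poly) (l + k) = (-1) ^ k * real (l choose k)"
proof -
  have "[:0, 1, -1:] = [:0, 1:] * [:1, -1 :: real:]" by simp
  then have "[:0, 1, -1:] ^ l = monom 1 l * [:1, -1 :: real:] ^ l"
    by (simp only: power_mult_distrib) (simp add: monom_altdef)
  moreover have "coeff ([:1, -1 :: real:] ^ l) k = (-1) ^ k * real (l choose k)"
    using coeff_linear_poly_power[of k l 1 "-1 :: real"]
    by (cases "k \<le> l") (simp_all add: mult.commute coeff_eq_0 degree_linear_power)
  ultimately show ?thesis by (simp add: coeff_monom_mult)
qed

lemma legendre_poly_shifted:
  "coeff (pcompose (legendre_poly l) [:1, -2:]) k = shifted_legendre_coeff l k"
proof -
  have sq: "pcompose ([:-1, 0, 1:] ^ l) [:1, -2 :: real:] = smult ((-4) ^ l) ([:0, 1, -1:] ^ l)"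
  proof -
    have "pcompose [:-1, 0, 1:] [:1, -2 :: real:] = smult (-4) [:0, 1, -1:]"
      by (simp add: pcompose_pCons)
    then show ?thesis by (simp only: pcompose_power smult_power)
  qed
  have "smult ((-2) ^ l) (pcompose ((pderiv ^^ l) ([:-1, 0, 1:] ^ l)) [:1, -2 :: real:])
      = smult ((-4) ^ l) ((pderiv ^^ l) ([:0, 1, -1:] ^ l))"
    using pderiv_funpow_pcompose_affine[of l "[:-1, 0, 1 :: real:] ^ l" 1 "-2"]
    by (simp add: sq higher_pderiv_smult)
  then have "(-2) ^ l * coeff (pcompose ((pderiv ^^ l) ([:-1, 0, 1:] ^ l)) [:1, -2 :: real:]) k
      = (-4) ^ l * (fact (l + k) / fact k * ((-1) ^ k * real (l choose k)))"
    by (metis coeff_smult coeff_pderiv_funpow coeff_monom_times_one_minus_power)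
  then have c: "coeff (pcompose ((pderiv ^^ l) ([:-1, 0, 1:] ^ l)) [:1, -2 :: real:]) k
      = 2 ^ l * (fact (l + k) / fact k * ((-1) ^ k * real (l choose k)))"
  proof -
    have "(-4 :: real) ^ l = (-2) ^ l * 2 ^ l" by (simp flip: power_mult_distrib)
    moreover have "(-2 :: real) ^ l \<noteq> 0" by simp
    ultimately show ?thesis
      using \<open>(-2) ^ l * _ = (-4) ^ l * _\<close> by (metis (no_types, lifting) mult.assoc mult_left_cancel)
  qed
  have b: "real ((l + k) choose k) = fact (l + k) / (fact k * fact l)"
    by (simp add: binomial_fact)
  show ?thesis
    unfolding legendre_poly_def shifted_legendre_coeff_def
    by (simp add: pcompose_smult c b mult_ac)
qed

lemma legendre_poly_expansion:
  "poly (legendre_poly l) (1 - 2 * s) = (\<Sum>k\<le>l. shifted_legendre_coeff l k * s ^ k)"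
proof -
  let ?q = "pcompose (legendre_poly l) [:1, -2:]"
  have "degree ?q \<le> l"
    by (rule degree_le) (simp add: legendre_poly_shifted shifted_legendre_coeff_def)
  have "poly (legendre_poly l) (1 - 2 * s) = poly ?q s"
    by (simp add: poly_pcompose algebra_simps)
  also have "\<dots> = (\<Sum>k\<le>l. coeff ?q k * s ^ k)"
    unfolding poly_altdef
    by (rule sum.mono_neutral_left) (use \<open>degree ?q \<le> l\<close> in \<open>auto simp: coeff_eq_0\<close>)
  finally show ?thesis by (simp add: legendre_poly_shifted)
qed

lemma legendre_poly_at_1: "poly (legendre_poly l) 1 = 1"
proof -
  have "poly (legendre_poly l) 1 = (\<Sum>k\<le>l. shifted_legendre_coeff l k * 0 ^ k)"
    using legendre_poly_expansion[of l 0] by simp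
  also have "\<dots> = shifted_legendre_coeff l 0"
    by (subst sum.atMost_shift) simp
  finally show ?thesis by (simp add: shifted_legendre_coeff_def)
qed

lemma legendre_poly_minus: "poly (legendre_poly l) (- t) = (-1) ^ l * poly (legendre_poly l) t"
proof -
  have "pcompose ([:-1, 0, 1:] ^ l) [:0, -1 :: real:] = [:-1, 0, 1:] ^ l"
    by (simp add: pcompose_power pcompose_pCons)
  then have "(pderiv ^^ l) ([:-1, 0, 1:] ^ l)
      = smult ((-1) ^ l) (pcompose ((pderiv ^^ l) ([:-1, 0, 1 :: real:] ^ l)) [:0, -1:])"
    using pderiv_funpow_pcompose_affine[of l "[:-1, 0, 1 :: real:] ^ l" 0 "-1"] by simp
  then have "poly ((pderiv ^^ l) ([:-1, 0, 1:] ^ l)) t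
      = (-1) ^ l * poly ((pderiv ^^ l) ([:-1, 0, 1 :: real:] ^ l)) (- t)"
    by (metis (no_types, opaque_lifting) poly_smult poly_pcompose mult_minus1_right add_0 poly_pCons poly_0 mult_zero_right add.right_neutral)
  then show ?thesis
    unfolding legendre_poly_def by simp
qed

text \<open>Legendre's differential equation in the variable \<open>(1 - t) / 2\<close>. Comparing coefficients, it is the recursion
  \<open>(k + 1)\<^sup>2 a\<^sub>k\<^sub>+\<^sub>1 = -(l - k)(l + k + 1) a\<^sub>k\<close>.\<close>

lemma legendre_ode_shifted:
  fixes l :: nat
  defines "q \<equiv> pcompose (legendre_poly l) [:1, -2:]"
  shows "[:0, 1, -1:] * pderiv (pderiv q) + [:1, -2:] * pderiv q + smult (real l * (real l + 1)) q = 0"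
proof (rule poly_eqI)
  fix k
  have rec: "(real k + 1)\<^sup>2 * coeff q (Suc k) = - ((real l - real k) * (real l + real k + 1)) * coeff q k"
  proof (cases "k \<le> l")
    case True
    have 1: "real (Suc k) * real (l choose Suc k) = (real l - real k) * real (l choose k)"
      using binomial_absorb_comp[of l k] True
      by (metis binomial_absorption of_nat_diff of_nat_mult)
    have 2: "real (Suc k) * real ((l + Suc k) choose Suc k) = (real l + real k + 1) * real ((l + k) choose k)"
      using Suc_times_binomial[of k "l + k"] by (metis (no_types, lifting) add_Suc_right of_nat_Suc of_nat_add of_nat_mult add.assoc add.commute)
    have "(real k + 1)\<^sup>2 * coeff q (Suc k)
        = - ((-1) ^ k) * (real (Suc k) * real (l choose Suc k)) * (real (Suc k) * real ((l + Suc k) choose Suc k))"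
      unfolding q_def legendre_poly_shifted shifted_legendre_coeff_def power2_eq_square by (simp add: algebra_simps)
    also have "\<dots> = - ((real l - real k) * (real l + real k + 1)) * coeff q k"
      unfolding 1 2 unfolding q_def legendre_poly_shifted shifted_legendre_coeff_def by (simp add: algebra_simps)
    finally show ?thesis .
  next
    case False
    then have "l < k" by simp
    then show ?thesis by (simp add: q_def legendre_poly_shifted shifted_legendre_coeff_def binomial_eq_0 del: binomial_Suc_Suc)
  qed
  \<comment> \<open>Multiplication by the coefficients of the equation shifts indices, which this makes visible.\<close>
  have sp: "[:0, 1, -1 :: real:] * p = monom 1 1 * p - monom 1 2 * p" for p
    by (simp add: monom_altdef algebra_simps power2_eq_square)
  have sp1: "[:1, -2 :: real:] * p = p - smult 2 (monom 1 1 * p)" for p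
    by (simp add: monom_altdef algebra_simps)
  show "coeff ([:0, 1, -1:] * pderiv (pderiv q) + [:1, -2:] * pderiv q + smult (real l * (real l + 1)) q) k = coeff 0 k"
    using rec
    by (cases k; cases "k - 1") (auto simp: sp sp1 coeff_monom_mult coeff_pderiv algebra_simps power2_eq_square)
qed

text \<open>The function \<open>P\<^sup>2 + (1 - t\<^sup>2) P'\<^sup>2 / (l (l + 1))\<close> (written in the variable \<open>s = (1 - t) / 2\<close>)
  dominates \<open>P\<^sup>2\<close>; by the differential equation its derivative has the sign of \<open>t\<close>, so on
  \<open>[0, 1]\<close> it is largest at \<open>t = 1\<close>, where it equals \<open>1\<close>. Negative arguments follow by parity.\<close>

lemma abs_legendre_poly_le_1:
  assumes "\<bar>t\<bar> \<le> 1"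
  shows "\<bar>poly (legendre_poly l) t\<bar> \<le> 1"
proof -
  have main: "\<bar>poly (legendre_poly l) t\<bar> \<le> 1" if t: "0 \<le> t" "t \<le> 1" for t
  proof (cases "l = 0")
    case True
    then show ?thesis by (simp add: legendre_poly_def)
  next
    case False
    define q where "q = pcompose (legendre_poly l) [:1, -2:]"
    define c where "c = real l * (real l + 1)"
    have "c > 0" using False by (simp add: c_def)
    define f where "f s = (poly q s)\<^sup>2 + s * (1 - s) * (poly (pderiv q) s)\<^sup>2 / c" for s
    define s where "s = (1 - t) / 2"
    have s: "0 \<le> s" "s \<le> 1 / 2" using t by (auto simp: s_def)
    have df: "(f has_real_derivative (- (1 - 2 * x) * (poly (pderiv q) x)\<^sup>2 / c)) (at x)" for x
    proof -
      have "poly ([:0, 1, -1:] * pderiv (pderiv q) + [:1, -2:] * pderiv q + smult c q) x = 0"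
        using legendre_ode_shifted[of l] unfolding q_def c_def by simp
      then have ode: "x * (1 - x) * poly (pderiv (pderiv q)) x = - (1 - 2 * x) * poly (pderiv q) x - c * poly q x"
        by (simp add: algebra_simps)
      have "(f has_real_derivative (2 * poly q x * poly (pderiv q) x
          + ((1 - 2 * x) * (poly (pderiv q) x)\<^sup>2
            + 2 * poly (pderiv q) x * (x * (1 - x) * poly (pderiv (pderiv q)) x)) / c)) (at x)"
        unfolding f_def using \<open>c > 0\<close>
        by (auto intro!: derivative_eq_intros poly_DERIV simp: field_simps power2_eq_square)
      then show ?thesis
        unfolding ode by (rule DERIV_cong) (use \<open>c > 0\<close> in \<open>simp add: field_simps power2_eq_square\<close>)
    qed
    have "f s \<le> f 0"
    proof (rule DERIV_nonpos_imp_nonincreasing[OF s(1)])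
      fix x assume "0 \<le> x" "x \<le> s"
      then have "- (1 - 2 * x) * (poly (pderiv q) x)\<^sup>2 / c \<le> 0"
        using s \<open>c > 0\<close> by (intro divide_nonpos_pos mult_nonpos_nonneg) auto
      then show "\<exists>y. DERIV f x :> y \<and> y \<le> 0" using df by blast
    qed
    moreover have "f 0 = 1" by (simp add: f_def q_def poly_pcompose legendre_poly_at_1)
    moreover have "(poly q s)\<^sup>2 \<le> f s" using s \<open>c > 0\<close> by (simp add: f_def)
    ultimately have "(poly q s)\<^sup>2 \<le> 1" by simp
    then have "\<bar>poly q s\<bar> \<le> 1" by (simp add: abs_square_le_1)
    moreover have "poly q s = poly (legendre_poly l) t"
      unfolding q_def poly_pcompose s_def by (simp add: field_simps)
    ultimately show ?thesis by simp
  qed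
  show ?thesis
    using main[of t] main[of "- t"] assms legendre_poly_minus[of l t] by (cases "t \<ge> 0") (auto simp: abs_mult)
qed

lemma abs_shifted_legendre_coeff_le:
  assumes "l \<ge> 1"
  shows "\<bar>shifted_legendre_coeff l k\<bar> \<le> (2 * (real l)\<^sup>2) ^ k / fact k"
proof (cases "k \<le> l")
  case True
  have "real (l choose k) * real ((l + k) choose k) \<le> (2 * (real l)\<^sup>2) ^ k / fact k"
  proof -
    have 1: "real (l choose k) \<le> real l ^ k"
      using binomial_le_pow[OF True] by (metis of_nat_le_iff of_nat_power)
    have 2: "real ((l + k) choose k) \<le> (2 * real l) ^ k / fact k"
    proof -
      have "((l + k) choose k) * fact k \<le> (l + k) ^ k" by (rule binomial_fact_pow)
      also have "\<dots> \<le> (2 * l) ^ k" using True by (intro power_mono) auto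
      finally have "real (((l + k) choose k) * fact k) \<le> real ((2 * l) ^ k)" by (simp only: of_nat_le_iff)
      then show ?thesis by (simp add: pos_le_divide_eq)
    qed
    have "real (l choose k) * real ((l + k) choose k) \<le> real l ^ k * ((2 * real l) ^ k / fact k)"
      by (intro mult_mono 1 2) auto
    then show ?thesis by (simp add: power_mult_distrib power2_eq_square mult_ac)
  qed
  then show ?thesis by (simp add: shifted_legendre_coeff_def abs_mult)
next
  case False
  then show ?thesis by (simp add: shifted_legendre_coeff_def binomial_eq_0)
qed

section \<open>Differences of the covariance kernel along coordinate lines\<close>

text \<open>The iterated forward difference of order \<open>D\<close> at \<open>0\<close>, written as an explicit linear combination so that it
  applies to random samples.\<close>

definition binom_diff :: "nat \<Rightarrow> (nat \<Rightarrow> real) \<Rightarrow> real"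
  where "binom_diff D f = (\<Sum>r\<le>D. (-1) ^ (D - r) * real (D choose r) * f r)"

lemma binom_diff_0 [simp]: "binom_diff 0 f = f 0"
  by (simp add: binom_diff_def)

lemma binom_diff_Suc: "binom_diff (Suc D) f = binom_diff D (\<lambda>r. f (Suc r) - f r)"
proof -
  let ?a = "\<lambda>D r. (-1) ^ (D - r) * real (D choose r) :: real"
  have "binom_diff (Suc D) f = ?a (Suc D) 0 * f 0 + (\<Sum>r\<le>D. ?a (Suc D) (Suc r) * f (Suc r))"
    unfolding binom_diff_def by (rule sum.atMost_Suc_shift)
  also have "(\<Sum>r\<le>D. ?a (Suc D) (Suc r) * f (Suc r))
      = (\<Sum>r\<le>D. ?a D r * f (Suc r)) + (\<Sum>r\<le>D. (-1) ^ (D - r) * real (D choose Suc r) * f (Suc r))"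
    by (simp add: sum.distrib[symmetric] algebra_simps)
  also have "(\<Sum>r\<le>D. (-1) ^ (D - r) * real (D choose Suc r) * f (Suc r))
      = (\<Sum>r<D. (-1) ^ (D - r) * real (D choose Suc r) * f (Suc r))"
    by (rule sum.mono_neutral_right) (auto simp: not_less binomial_eq_0)
  also have "\<dots> = (\<Sum>r<D. - ?a D (Suc r) * f (Suc r))"
  proof (rule sum.cong[OF refl])
    fix r assume "r \<in> {..<D}"
    then have "D - r = Suc (D - Suc r)" by auto
    then show "(-1) ^ (D - r) * real (D choose Suc r) * f (Suc r) = - ?a D (Suc r) * f (Suc r)"
      by simp
  qed
  also have "?a (Suc D) 0 * f 0 + ((\<Sum>r\<le>D. ?a D r * f (Suc r)) + (\<Sum>r<D. - ?a D (Suc r) * f (Suc r)))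
     = (\<Sum>r\<le>D. ?a D r * f (Suc r)) - (?a D 0 * f 0 + (\<Sum>r<D. ?a D (Suc r) * f (Suc r)))"
    by (simp add: sum_negf)
  also have "?a D 0 * f 0 + (\<Sum>r<D. ?a D (Suc r) * f (Suc r)) = (\<Sum>r\<le>D. ?a D r * f r)"
    by (rule sum.atMost_shift[symmetric])
  finally show ?thesis
    by (simp add: binom_diff_def sum_subtractf[symmetric] right_diff_distrib)
qed

lemma binom_diff_add: "binom_diff D (\<lambda>r. f r + g r) = binom_diff D f + binom_diff D g"
  by (simp add: binom_diff_def distrib_left sum.distrib)

lemma binom_diff_diff: "binom_diff D (\<lambda>r. f r - g r) = binom_diff D f - binom_diff D g"
  by (simp add: binom_diff_def right_diff_distrib sum_subtractf)

lemma binom_diff_cmult: "binom_diff D (\<lambda>r. c * f r) = c * binom_diff D f"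
  by (simp add: binom_diff_def sum_distrib_left mult_ac)

lemma binom_diff_sum: "binom_diff D (\<lambda>r. \<Sum>k\<in>I. f k r) = (\<Sum>k\<in>I. binom_diff D (f k))"
  by (induction I rule: infinite_finite_induct) (simp_all add: binom_diff_add, simp_all add: binom_diff_def)

lemma abs_binom_diff_le:
  assumes "\<And>r. r \<le> D \<Longrightarrow> \<bar>f r\<bar> \<le> B"
  shows "\<bar>binom_diff D f\<bar> \<le> 2 ^ D * B"
proof -
  have "\<bar>binom_diff D f\<bar> \<le> (\<Sum>r\<le>D. real (D choose r) * \<bar>f r\<bar>)"
    unfolding binom_diff_def by (rule order_trans[OF sum_abs]) (simp add: abs_mult)
  also have "\<dots> \<le> (\<Sum>r\<le>D. real (D choose r) * B)"
    using assms by (intro sum_mono mult_left_mono) auto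
  also have "\<dots> = 2 ^ D * B"
    unfolding sum_distrib_right[symmetric] using choose_row_sum[of D]
    by (metis of_nat_sum of_nat_power of_nat_numeral)
  finally show ?thesis .
qed

lemma degree_forward_difference_less:
  fixes p :: "real poly"
  assumes "degree p > 0"
  shows "degree (pcompose p [:1, 1:] - p) < degree p"
proof (rule degree_lessI)
  show "pcompose p [:1, 1:] - p \<noteq> 0 \<or> 0 < degree p" using assms by simp
  show "\<forall>k\<ge>degree p. coeff (pcompose p [:1, 1:] - p) k = 0"
  proof (intro allI impI)
    fix k assume k: "k \<ge> degree p"
    have d: "degree (pcompose p [:1, 1:]) = degree p" by (simp add: degree_pcompose)
    have l: "lead_coeff (pcompose p [:1, 1:]) = lead_coeff p"
      by (subst lead_coeff_comp) auto
    show "coeff (pcompose p [:1, 1:] - p) k = 0"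
      using k l d by (cases "k = degree p") (auto simp: coeff_eq_0)
  qed
qed

lemma binom_diff_poly_eq_0:
  assumes "degree p < D"
  shows "binom_diff D (\<lambda>r. poly p (real r)) = 0"
  using assms
proof (induction D arbitrary: p)
  case (Suc D)
  let ?q = "pcompose p [:1, 1:] - p"
  have *: "binom_diff (Suc D) (\<lambda>r. poly p (real r)) = binom_diff D (\<lambda>r. poly ?q (real r))"
    by (simp add: binom_diff_Suc poly_pcompose algebra_simps)
  show ?case
  proof (cases "degree p = 0")
    case True
    then obtain a where "p = [:a:]" by (rule degree_eq_zeroE)
    then show ?thesis unfolding * by (simp add: binom_diff_def)
  next
    case False
    then have "degree ?q < D"
      using degree_forward_difference_less[of p] Suc.prems by linarith
    then show ?thesis unfolding * by (rule Suc.IH)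
  qed
qed simp

lemma binom_diff_poly_scaled_eq_0:
  assumes "degree p < D"
  shows "binom_diff D (\<lambda>r. poly p (h * real r)) = 0"
proof -
  have "degree (pcompose p [:0, h:]) \<le> degree p * 1"
    by (rule order_trans[OF degree_pcompose_le]) auto
  then have "binom_diff D (\<lambda>r. poly (pcompose p [:0, h:]) (real r)) = 0"
    using assms by (intro binom_diff_poly_eq_0) simp
  then show ?thesis by (simp add: poly_pcompose mult.commute)
qed

abbreviation quad :: "real \<Rightarrow> real \<Rightarrow> real \<Rightarrow> real"
  where "quad a b \<tau> \<equiv> a + 2 * b * \<tau> + \<tau>\<^sup>2"

text \<open>Along a line, \<open>1 + |u|\<^sup>2\<close> is a quadratic \<open>a + e(\<tau>)\<close> with \<open>a\<close> its value at the base point and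
  \<open>e(\<tau>) = O(\<tau>)\<close>. Cutting off the geometric series of \<open>1 / (a + e)\<close> after \<open>M\<close> terms gives a polynomial with
  error \<open>O(\<tau>^M)\<close>. The constant must not depend on the base point or on the mesh \<open>h\<close>.\<close>

lemma inverse_quadratic_poly_approx:
  fixes R :: real and N M k :: nat
  assumes "R \<ge> 0"
  shows "\<exists>C\<ge>0. \<forall>a b h. 1 \<le> a \<longrightarrow> \<bar>b\<bar> \<le> R \<longrightarrow> 0 \<le> h \<longrightarrow> h \<le> 1 \<longrightarrow> (\<forall>\<tau>. 1 \<le> quad a b \<tau>) \<longrightarrow>
    (\<exists>p. degree p \<le> 2 * M * k \<and>
      (\<forall>r\<le>N. \<bar>1 / quad a b (h * real r) ^ k - poly p (h * real r)\<bar> \<le> C * h ^ M))"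
proof -
  define E where "E = 2 * R * real N + (real N)\<^sup>2"
  have "E \<ge> 0" using assms by (simp add: E_def)
  \<comment> \<open>\<open>E h\<close> bounds \<open>\<bar>e(h r)\<bar>\<close> for \<open>r \<le> N\<close>, and \<open>B\<close> bounds the inverse quadratic and its approximation.\<close>
  define B where "B = 1 + E ^ M"
  have "B \<ge> 1" using \<open>E \<ge> 0\<close> by (simp add: B_def)
  define C where "C = real k * B ^ (k - 1) * E ^ M"
  have "C \<ge> 0" using \<open>B \<ge> 1\<close> \<open>E \<ge> 0\<close> by (simp add: C_def)
  show ?thesis
  proof (intro exI[of _ C] conjI allI impI \<open>C \<ge> 0\<close>)
    fix a b h :: real
    assume a: "1 \<le> a" and b: "\<bar>b\<bar> \<le> R" and h: "0 \<le> h" "h \<le> 1"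
      and q: "\<forall>\<tau>. 1 \<le> quad a b \<tau>"
    define e where "e = [:0, 2 * b, 1:]"
    have pe: "poly e \<tau> = 2 * b * \<tau> + \<tau>\<^sup>2" for \<tau> by (simp add: e_def power2_eq_square algebra_simps)
    define p where "p = (\<Sum>i<M. smult ((-1) ^ i / a ^ Suc i) (e ^ i))"
    have dp: "degree p \<le> 2 * M"
      unfolding p_def
    proof (rule degree_sum_le)
      fix i assume "i \<in> {..<M}"
      then have "degree (e ^ i) \<le> 2 * M"
        using degree_power_le[of e i] by (auto simp: e_def)
      then show "degree (smult ((-1) ^ i / a ^ Suc i) (e ^ i)) \<le> 2 * M"
        using degree_smult_le order_trans by blast
    qed simp
    have "degree (p ^ k) \<le> 2 * M * k"
      using degree_power_le[of p k] dp by (meson mult_le_mono1 order_trans)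
    moreover have "\<bar>1 / quad a b (h * real r) ^ k - poly (p ^ k) (h * real r)\<bar> \<le> C * h ^ M"
      if "r \<le> N" for r
    proof -
      define \<tau> where "\<tau> = h * real r"
      define x where "x = poly e \<tau>"
      have ax: "1 \<le> a + x" using q by (simp add: x_def pe add.assoc)
      have x_le: "\<bar>x\<bar> \<le> E * h"
      proof -
        have t: "0 \<le> \<tau>" "\<tau> \<le> h * real N" using h that by (auto simp: \<tau>_def intro: mult_left_mono)
        have "\<bar>x\<bar> \<le> 2 * \<bar>b\<bar> * \<tau> + \<tau>\<^sup>2"
          unfolding x_def pe using t by (simp add: abs_mult order_trans[OF abs_triangle_ineq])
        also have "\<dots> \<le> 2 * R * (h * real N) + (h * real N)\<^sup>2"
          using t b by (intro add_mono mult_mono power_mono) auto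
        also have "(h * real N)\<^sup>2 \<le> h * (real N)\<^sup>2"
        proof -
          have "h\<^sup>2 \<le> h" using h by (simp add: power2_eq_square mult_left_le)
          then show ?thesis by (simp add: power_mult_distrib mult_right_mono)
        qed
        finally show ?thesis by (simp add: E_def algebra_simps)
      qed
      have pp: "poly p \<tau> = (1 / a) * (\<Sum>i<M. (- x / a) ^ i)"
      proof -
        have "(-1) ^ i / a ^ Suc i * x ^ i = (1 / a) * (- x / a) ^ i" for i
          unfolding power_divide power_minus[of x] by simp
        then show ?thesis
          by (simp add: p_def poly_sum sum_distrib_left flip: x_def del: power_Suc)
      qed
      have geo: "1 / (a + x) - poly p \<tau> = (- x / a) ^ M / (a + x)"
      proof -
        have "- x / a \<noteq> 1" using ax a by (auto simp: field_simps)
        then have "(\<Sum>i<M. (- x / a) ^ i) = (1 - (- x / a) ^ M) / (1 - (- x / a))"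
          by (subst sum_gp_strict) auto
        moreover have "a * (1 - (- x / a)) = a + x" using a by (simp add: field_simps)
        moreover have "(1 / a) * (y / z) = y / (a * z)" for y z :: real by simp
        ultimately have "poly p \<tau> = (1 - (- x / a) ^ M) / (a + x)"
          unfolding pp by simp
        then show ?thesis by (simp add: diff_divide_distrib)
      qed
      have d1: "\<bar>1 / (a + x) - poly p \<tau>\<bar> \<le> (E * h) ^ M"
      proof -
        have "\<bar>1 / (a + x) - poly p \<tau>\<bar> = (\<bar>x\<bar> / a) ^ M / (a + x)"
          unfolding geo using ax a by (simp add: power_abs abs_divide)
        also have "\<dots> \<le> (\<bar>x\<bar> / a) ^ M / 1"
          using ax a by (intro divide_left_mono) auto
        also have "(\<bar>x\<bar> / a) ^ M / 1 \<le> (E * h) ^ M"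
        proof -
          have "\<bar>x\<bar> / a \<le> \<bar>x\<bar> / 1" using a by (intro divide_left_mono) auto
          then show ?thesis using x_le a by (simp add: power_mono)
        qed
        finally show ?thesis .
      qed
      have w1: "\<bar>1 / (a + x)\<bar> \<le> B" 
      proof -
        have "0 \<le> 1 / (a + x)" "1 / (a + x) \<le> 1" using ax by auto
        then show ?thesis using \<open>B \<ge> 1\<close> by linarith
      qed
      have w2: "\<bar>poly p \<tau>\<bar> \<le> B"
      proof -
        have "(E * h) ^ M \<le> E ^ M" using h \<open>E \<ge> 0\<close> by (intro power_mono mult_left_le) auto
        moreover have "0 \<le> 1 / (a + x)" "1 / (a + x) \<le> 1" using ax by auto
        ultimately show ?thesis using d1 unfolding B_def by linarith
      qed
      have "\<bar>(1 / (a + x)) ^ k - poly p \<tau> ^ k\<bar> \<le> real k * B ^ (k - 1) * (E * h) ^ M"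
      proof -
        have "(1 / (a + x)) ^ k - poly p \<tau> ^ k
           = (1 / (a + x) - poly p \<tau>) * (\<Sum>i<k. poly p \<tau> ^ (k - Suc i) * (1 / (a + x)) ^ i)"
          by (rule power_diff_sumr2)
        moreover have "\<bar>\<Sum>i<k. poly p \<tau> ^ (k - Suc i) * (1 / (a + x)) ^ i\<bar> \<le> (\<Sum>i<k. B ^ (k - 1))"
        proof (rule order_trans[OF sum_abs sum_mono])
          fix i assume i: "i \<in> {..<k}"
          have "\<bar>poly p \<tau> ^ (k - Suc i) * (1 / (a + x)) ^ i\<bar> \<le> B ^ (k - Suc i) * B ^ i"
            unfolding abs_mult power_abs using w1 w2 \<open>B \<ge> 1\<close> by (intro mult_mono power_mono) auto
          also have "\<dots> = B ^ (k - 1)" using i by (simp flip: power_add)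
          finally show "\<bar>poly p \<tau> ^ (k - Suc i) * (1 / (a + x)) ^ i\<bar> \<le> B ^ (k - 1)" .
        qed
        ultimately have "\<bar>(1 / (a + x)) ^ k - poly p \<tau> ^ k\<bar> \<le> (E * h) ^ M * (\<Sum>i<k. B ^ (k - 1))"
          by (simp only: abs_mult) (intro mult_mono d1, use \<open>E \<ge> 0\<close> h in auto)
        then show ?thesis by (simp add: mult_ac)
      qed
      then show ?thesis
        unfolding x_def pe unfolding \<tau>_def by (simp add: C_def power_mult_distrib power_one_over add.assoc mult.assoc poly_power)
    qed
    ultimately show "\<exists>p. degree p \<le> 2 * M * k \<and>
      (\<forall>r\<le>N. \<bar>1 / quad a b (h * real r) ^ k - poly p (h * real r)\<bar> \<le> C * h ^ M)"
      by blast
  qed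
qed

definition kernel_power_bound :: "nat \<Rightarrow> real \<Rightarrow> nat \<Rightarrow> nat \<Rightarrow> real \<Rightarrow> bool"
  where "kernel_power_bound D R M k C \<longleftrightarrow> C \<ge> 0 \<and>
    (\<forall>a b h. 1 \<le> a \<longrightarrow> \<bar>b\<bar> \<le> R \<longrightarrow> 0 \<le> h \<longrightarrow> h \<le> 1 \<longrightarrow> (\<forall>\<tau>. 1 \<le> quad a b \<tau>) \<longrightarrow>
      (\<forall>j\<le>D. \<bar>binom_diff D (\<lambda>r. (h * real r - h * real j) ^ (2 * k) / quad a b (h * real r) ^ k)\<bar> \<le> C * h ^ M))"

text \<open>The factor \<open>(\<tau>\<^sub>r - \<tau>\<^sub>j)^(2k)\<close> is itself a polynomial in \<open>\<tau>\<^sub>r\<close>, so only the error of the polynomial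
  approximation of the denominator survives the difference.\<close>

lemma binom_diff_kernel_power_bound:
  fixes R :: real and D M k :: nat
  assumes "R \<ge> 0" and D: "2 * k + 2 * M * k < D"
  shows "\<exists>C. kernel_power_bound D R M k C"
proof -
  obtain C where C: "C \<ge> 0" and ap: "\<And>a b h. \<lbrakk>1 \<le> a; \<bar>b\<bar> \<le> R; 0 \<le> h; h \<le> 1; \<forall>\<tau>. 1 \<le> quad a b \<tau>\<rbrakk> \<Longrightarrow>
    \<exists>p. degree p \<le> 2 * M * k \<and>
      (\<forall>r\<le>D. \<bar>1 / quad a b (h * real r) ^ k - poly p (h * real r)\<bar> \<le> C * h ^ M)"
    using inverse_quadratic_poly_approx[OF assms(1), of M k D] by metis
  define C' where "C' = 2 ^ D * (real D ^ (2 * k) * C)"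
  show ?thesis
    unfolding kernel_power_bound_def
  proof (intro exI[of _ C'] conjI allI impI)
    show "C' \<ge> 0" using C by (simp add: C'_def)
    fix a b h j assume A: "1 \<le> a" "\<bar>b\<bar> \<le> R" and h: "0 \<le> h" "h \<le> (1::real)"
      and q: "\<forall>\<tau>. 1 \<le> quad a b \<tau>" and j: "j \<le> D"
    let ?w = "\<lambda>r. 1 / quad a b (h * real r) ^ k"
    obtain p where p: "degree p \<le> 2 * M * k" "\<And>r. r \<le> D \<Longrightarrow> \<bar>?w r - poly p (h * real r)\<bar> \<le> C * h ^ M"
      using ap[OF A h q] by blast
    let ?g = "[:- (h * real j), 1:] ^ (2 * k) * p"
    have "degree ?g \<le> 2 * k + 2 * M * k"
      using degree_mult_le[of "[:- (h * real j), 1:] ^ (2 * k)" p] p(1) by (simp add: degree_linear_power)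
    then have "binom_diff D (\<lambda>r. poly ?g (h * real r)) = 0"
      using D by (intro binom_diff_poly_scaled_eq_0) simp
    then have "binom_diff D (\<lambda>r. (h * real r - h * real j) ^ (2 * k) * ?w r)
        = binom_diff D (\<lambda>r. (h * real r - h * real j) ^ (2 * k) * (?w r - poly p (h * real r)))"
      by (simp add: right_diff_distrib binom_diff_diff)
    also have "\<bar>\<dots>\<bar> \<le> 2 ^ D * (real D ^ (2 * k) * (C * h ^ M))"
    proof (rule abs_binom_diff_le)
      fix r assume r: "r \<le> D"
      have "\<bar>h * real r - h * real j\<bar> \<le> real D"
      proof -
        have "\<bar>h * real r - h * real j\<bar> = h * \<bar>real r - real j\<bar>"
          using h by (simp add: abs_mult flip: right_diff_distrib)
        also have "\<dots> \<le> 1 * real D" using h r j by (intro mult_mono) auto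
        finally show ?thesis by simp
      qed
      then show "\<bar>(h * real r - h * real j) ^ (2 * k) * (?w r - poly p (h * real r))\<bar> \<le> real D ^ (2 * k) * (C * h ^ M)"
        unfolding abs_mult power_abs using p(2)[OF r] by (intro mult_mono power_mono) auto
    qed
    finally show "\<bar>binom_diff D (\<lambda>r. (h * real r - h * real j) ^ (2 * k)
        / quad a b (h * real r) ^ k)\<bar> \<le> C' * h ^ M"
      by (simp add: C'_def mult_ac)
  qed
qed

lemma summable_power_over_fact: "summable (\<lambda>k. x ^ k / fact k)" for x :: real
  using summable_exp[of x] by (simp add: field_simps)

abbreviation legendre_diff2 :: "nat \<Rightarrow> nat \<Rightarrow> real \<Rightarrow> real \<Rightarrow> real \<Rightarrow> real"
  where "legendre_diff2 D l a b h \<equiv> binom_diff D (\<lambda>j. binom_diff D (\<lambda>r. poly (legendre_poly l)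
    (1 - 2 * ((h * real r - h * real j)\<^sup>2 / (quad a b (h * real r) * quad a b (h * real j))))))"

text \<open>For \<open>l h \<le> 1\<close>, low powers of the kernel variable are nearly polynomials and so nearly annihilated by the
  difference, and high powers are small by themselves; for \<open>l h > 1\<close>, boundedness of the kernel is enough.\<close>

lemma legendre_double_difference_bound:
  fixes R \<beta> :: real and D m :: nat
  assumes "R \<ge> 0" "\<beta> > 0" and m: "\<beta> \<le> 2 * real m" and D: "2 * m + 4 * m * m < D"
  shows "\<exists>C\<ge>0. \<forall>a b h l. 1 \<le> a \<longrightarrow> \<bar>b\<bar> \<le> R \<longrightarrow> 0 < h \<longrightarrow> h \<le> 1 \<longrightarrow>
    (\<forall>\<tau>. 1 \<le> quad a b \<tau>) \<longrightarrow>
    (\<forall>\<tau> \<sigma>. (\<tau> - \<sigma>)\<^sup>2 \<le> quad a b \<tau> * quad a b \<sigma>) \<longrightarrow>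
    \<bar>legendre_diff2 D l a b h\<bar>
    \<le> C * (real l powr \<beta> * h powr \<beta>)"
proof -
  have "\<exists>C. kernel_power_bound D R (2 * m) k C" if "k < m" for k
  proof -
    have "2 * (2 * m) * k \<le> 4 * m * m" using that by simp
    then have "2 * k + 2 * (2 * m) * k < D" using D that by linarith
    from binom_diff_kernel_power_bound[OF assms(1) this] show ?thesis .
  qed
  then obtain Ck where Ck': "\<And>k. k < m \<Longrightarrow> kernel_power_bound D R (2 * m) k (Ck k)"
    by metis
  have Ck: "Ck k \<ge> 0" if "k < m" for k
    using Ck'[OF that] by (simp add: kernel_power_bound_def)
  have low: "\<bar>binom_diff D (\<lambda>r. (h * real r - h * real j) ^ (2 * k)
        / quad a b (h * real r) ^ k)\<bar> \<le> Ck k * h ^ (2 * m)"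
    if "k < m" "1 \<le> a" "\<bar>b\<bar> \<le> R" "0 \<le> h" "h \<le> 1" "\<forall>\<tau>. 1 \<le> quad a b \<tau>" "j \<le> D" for k a b h j
    using Ck'[OF that(1)] that(2-) unfolding kernel_power_bound_def by blast
  \<comment> \<open>bounds the contribution of the power \<open>k\<close>, divided by \<open>(l h)^(2m)\<close>; the coefficients of high powers form an exponential series\<close>
  define e where "e k = 4 ^ D * ((2 * (real D)\<^sup>2) ^ k / fact k) + (if k < m then 2 ^ D * Ck k * 2 ^ k else 0)" for k
  have e_nn: "e k \<ge> 0" for k using Ck by (simp add: e_def)
  have sum_e: "summable e"
    unfolding e_def
    by (intro summable_add summable_mult summable_power_over_fact summable_finite[of "{..<m}"]) auto
  define C where "C = 4 ^ D + suminf e"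
  have "suminf e \<ge> 0" using sum_e e_nn by (rule suminf_nonneg)
  then have C: "C \<ge> 4 ^ D" "C \<ge> suminf e" "C \<ge> 0" by (auto simp: C_def)
  show ?thesis
  proof (intro exI[of _ C] conjI allI impI C(3))
    fix a b h :: real and l :: nat
    assume a: "1 \<le> a" and b: "\<bar>b\<bar> \<le> R" and h: "0 < h" "h \<le> 1"
      and q1: "\<forall>\<tau>. 1 \<le> quad a b \<tau>"
      and q2: "\<forall>\<tau> \<sigma>. (\<tau> - \<sigma>)\<^sup>2 \<le> quad a b \<tau> * quad a b \<sigma>"
    define q where "q r = quad a b (h * real r)" for r
    have q: "1 \<le> q r" for r using q1 by (simp add: q_def)
    define t where "t r j = (h * real r - h * real j)\<^sup>2 / (q r * q j)" for r j
    have t01: "0 \<le> t r j" "t r j \<le> 1" for r j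
    proof -
      have "0 < q r * q j" using q[of r] q[of j] by simp
      moreover have "(h * real r - h * real j)\<^sup>2 \<le> q r * q j" using q2 by (simp add: q_def)
      ultimately show "0 \<le> t r j" "t r j \<le> 1" by (auto simp: t_def)
    qed
    let ?V = "binom_diff D (\<lambda>j. binom_diff D (\<lambda>r. poly (legendre_poly l) (1 - 2 * t r j)))"
    have "\<bar>?V\<bar> \<le> C * (real l powr \<beta> * h powr \<beta>)"
    proof (cases "l = 0")
      case True
      have "D > 0" using D by simp
      then have "binom_diff D (\<lambda>r. poly [:1:] (real r)) = 0" by (intro binom_diff_poly_eq_0) simp
      then show ?thesis using True by (simp add: legendre_poly_def) (simp add: binom_diff_def)
    next
      case False
      then have l: "l \<ge> 1" by simp
      show ?thesis
      proof (cases "real l * h \<ge> 1")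
        case True
        have "\<bar>?V\<bar> \<le> 2 ^ D * (2 ^ D * 1)"
          using t01 by (intro abs_binom_diff_le abs_legendre_poly_le_1) (simp add: abs_le_iff)
        also have "\<dots> = 4 ^ D * 1" by (simp flip: power_mult_distrib)
        also have "\<dots> \<le> C * (real l * h) powr \<beta>"
          using True C \<open>\<beta> > 0\<close> by (intro mult_mono ge_one_powr_ge_zero) auto
        finally show ?thesis using h by (simp add: powr_mult)
      next
        case False
        have lh: "0 < real l * h" "real l * h \<le> 1" using False l h by auto
        define V where "V k = binom_diff D (\<lambda>j. binom_diff D (\<lambda>r. t r j ^ k))" for k
        have V_low: "\<bar>V k\<bar> \<le> 2 ^ D * (Ck k * h ^ (2 * m))" if k: "k < m" for k
          unfolding V_def
        proof (rule abs_binom_diff_le)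
          fix j assume j: "j \<le> D"
          let ?I = "binom_diff D (\<lambda>r. (h * real r - h * real j) ^ (2 * k) / q r ^ k)"
          have "binom_diff D (\<lambda>r. t r j ^ k) = binom_diff D (\<lambda>r. (1 / q j ^ k) * ((h * real r - h * real j) ^ (2 * k) / q r ^ k))"
            unfolding t_def power_divide power_mult_distrib power_mult by (simp add: mult.commute)
          also have "\<dots> = (1 / q j ^ k) * ?I" by (rule binom_diff_cmult)
          finally have "\<bar>binom_diff D (\<lambda>r. t r j ^ k)\<bar> = (1 / q j ^ k) * \<bar>?I\<bar>"
            using q[of j] by (simp add: abs_mult power_abs)
          also have "\<dots> \<le> 1 * (Ck k * h ^ (2 * m))"
          proof (intro mult_mono)
            show "1 / q j ^ k \<le> 1" using q[of j] by (simp add: one_le_power divide_le_eq_1)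
            show "\<bar>?I\<bar> \<le> Ck k * h ^ (2 * m)"
              using low[OF k a b _ h(2) q1 j] h by (simp add: q_def)
          qed auto
          finally show "\<bar>binom_diff D (\<lambda>r. t r j ^ k)\<bar> \<le> Ck k * h ^ (2 * m)" by simp
        qed
        have V_high: "\<bar>V k\<bar> \<le> 4 ^ D * ((real D)\<^sup>2 * h\<^sup>2) ^ k" for k
        proof -
          have "\<bar>V k\<bar> \<le> 2 ^ D * (2 ^ D * ((real D)\<^sup>2 * h\<^sup>2) ^ k)"
            unfolding V_def
          proof (intro abs_binom_diff_le)
            fix j r assume jr: "j \<le> D" "r \<le> D"
            have "t r j \<le> (h * real r - h * real j)\<^sup>2 / 1"
              unfolding t_def using q[of r] q[of j] by (intro divide_left_mono) (auto simp: mult_ge1_I)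
            also have "\<dots> = h\<^sup>2 * \<bar>real r - real j\<bar>\<^sup>2"
              by (simp add: power_mult_distrib flip: right_diff_distrib)
            also have "\<dots> \<le> h\<^sup>2 * (real D)\<^sup>2"
              using jr by (intro mult_left_mono power_mono) auto
            finally show "\<bar>t r j ^ k\<bar> \<le> ((real D)\<^sup>2 * h\<^sup>2) ^ k"
              using t01[of r j] by (simp add: power_abs mult.commute power_mono)
          qed
          moreover have "2 ^ D * (2 ^ D * x) = 4 ^ D * x" for x :: real
            by (simp add: mult.assoc[symmetric] flip: power_mult_distrib)
          ultimately show ?thesis by simp
        qed
        have "?V = (\<Sum>k\<le>l. shifted_legendre_coeff l k * V k)"
          by (simp add: legendre_poly_expansion binom_diff_sum binom_diff_cmult V_def)
        also have "\<bar>\<dots>\<bar> \<le> (\<Sum>k\<le>l. (real l * h) ^ (2 * m) * e k)"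
        proof (rule order_trans[OF sum_abs sum_mono])
          fix k
          have "\<bar>shifted_legendre_coeff l k * V k\<bar> \<le> (2 * (real l)\<^sup>2) ^ k / fact k * \<bar>V k\<bar>"
            unfolding abs_mult by (intro mult_right_mono abs_shifted_legendre_coeff_le l) auto
          also have "\<dots> \<le> (real l * h) ^ (2 * m) * e k"
          proof (cases "k < m")
            case True
            have "(2 * (real l)\<^sup>2) ^ k / fact k * \<bar>V k\<bar> \<le> (2 ^ k * real l ^ (2 * m)) * (2 ^ D * (Ck k * h ^ (2 * m)))"
            proof (intro mult_mono V_low True)
              have "(2 * (real l)\<^sup>2) ^ k / fact k \<le> (2 * (real l)\<^sup>2) ^ k / 1"
                by (intro divide_left_mono) (auto simp: fact_ge_1)
              also have "\<dots> = 2 ^ k * real l ^ (2 * k)" by (simp add: power_mult_distrib power_mult)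
              also have "\<dots> \<le> 2 ^ k * real l ^ (2 * m)"
                using True l by (intro mult_left_mono power_increasing) auto
              finally show "(2 * (real l)\<^sup>2) ^ k / fact k \<le> 2 ^ k * real l ^ (2 * m)" .
            qed auto
            also have "\<dots> = (real l * h) ^ (2 * m) * (2 ^ D * Ck k * 2 ^ k)"
              by (simp add: power_mult_distrib mult_ac)
            also have "\<dots> \<le> (real l * h) ^ (2 * m) * e k"
              using True lh by (intro mult_left_mono) (auto simp: e_def)
            finally show ?thesis .
          next
            case False
            have "(2 * (real l)\<^sup>2) ^ k / fact k * \<bar>V k\<bar> \<le> (2 * (real l)\<^sup>2) ^ k / fact k * (4 ^ D * ((real D)\<^sup>2 * h\<^sup>2) ^ k)"
              by (intro mult_left_mono V_high) auto
            also have "\<dots> = (real l * h) ^ (2 * k) * e k"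
            proof -
              have "(real l * h) ^ (2 * k) = ((real l)\<^sup>2) ^ k * (h\<^sup>2) ^ k"
                unfolding power_mult by (simp only: power_mult_distrib)
              then show ?thesis
                using False by (simp only: e_def power_mult_distrib) simp
            qed
            also have "\<dots> \<le> (real l * h) ^ (2 * m) * e k"
              using False lh e_nn by (intro mult_right_mono power_decreasing) auto
            finally show ?thesis .
          qed
          finally show "\<bar>shifted_legendre_coeff l k * V k\<bar> \<le> (real l * h) ^ (2 * m) * e k" .
        qed
        also have "\<dots> \<le> (real l * h) ^ (2 * m) * C"
          unfolding sum_distrib_left[symmetric]
          using sum_le_suminf[OF sum_e, of "{..l}"] e_nn C lh by (intro mult_left_mono) auto
        also have "\<dots> \<le> (real l * h) powr \<beta> * C"
        proof (intro mult_right_mono C(3))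
          have "(real l * h) ^ (2 * m) = (real l * h) powr (2 * real m)"
            using lh powr_realpow[of "real l * h" "2 * m"] by simp
          also have "\<dots> \<le> (real l * h) powr \<beta>"
            using lh m by (intro powr_mono') auto
          finally show "(real l * h) ^ (2 * m) \<le> (real l * h) powr \<beta>" .
        qed
        finally show ?thesis using h by (simp add: powr_mult mult_ac)
      qed
    qed
    then show "\<bar>legendre_diff2 D l a b h\<bar>
    \<le> C * (real l powr \<beta> * h powr \<beta>)"
      by (simp add: t_def q_def)
  qed
qed

lemma norm_plane: "(norm (u :: real ^ 2))\<^sup>2 = (u $ 1)\<^sup>2 + (u $ 2)\<^sup>2"
  unfolding power2_norm_eq_inner inner_vec_def sum_2 by (simp add: power2_eq_square)

text \<open>The chordal distance in stereographic coordinates.\<close>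

lemma inner_stereo_inv:
  assumes "s\<^sup>2 = 1"
  shows "stereo_inv s u \<bullet> stereo_inv s v
    = 1 - 2 * ((norm (u - v))\<^sup>2 / (((norm u)\<^sup>2 + 1) * ((norm v)\<^sup>2 + 1)))"
proof -
  define a where "a = (norm u)\<^sup>2 + 1"
  define b where "b = (norm v)\<^sup>2 + 1"
  have pos: "a > 0" "b > 0" by (auto simp: a_def b_def intro: add_nonneg_pos)
  have "stereo_inv s u = (1 / a) *\<^sub>R vector [2 * u $ 1, 2 * u $ 2, s * (a - 2)]"
    "stereo_inv s v = (1 / b) *\<^sub>R vector [2 * v $ 1, 2 * v $ 2, s * (b - 2)]"
    by (simp_all add: stereo_inv_def a_def b_def)
  then have "stereo_inv s u \<bullet> stereo_inv s v
    = (4 * (u $ 1 * v $ 1 + u $ 2 * v $ 2) + s\<^sup>2 * ((a - 2) * (b - 2))) / (a * b)"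
    by (simp add: inner_vec_def sum_3 power2_eq_square algebra_simps add_divide_distrib diff_divide_distrib)
  also have "4 * (u $ 1 * v $ 1 + u $ 2 * v $ 2) + s\<^sup>2 * ((a - 2) * (b - 2)) = a * b - 2 * (norm (u - v))\<^sup>2"
    unfolding assms a_def b_def norm_plane by (simp add: power2_eq_square algebra_simps)
  also have "(a * b - 2 * (norm (u - v))\<^sup>2) / (a * b) = 1 - 2 * ((norm (u - v))\<^sup>2 / (a * b))"
    using pos by (simp add: diff_divide_distrib)
  finally show ?thesis by (simp add: a_def b_def)
qed

lemma stereo_inv_in_S2:
  assumes "s\<^sup>2 = 1"
  shows "stereo_inv s u \<in> S2"
  using inner_stereo_inv[OF assms, of u u] by (simp add: norm_eq_1)

abbreviation legendre_chart_diff2 :: "nat \<Rightarrow> nat \<Rightarrow> real \<Rightarrow> real ^ 2 \<Rightarrow> real \<Rightarrow> 2 \<Rightarrow> real"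
  where "legendre_chart_diff2 D l s u h e \<equiv> binom_diff D (\<lambda>j. binom_diff D (\<lambda>r. poly (legendre_poly l)
    (stereo_inv s (u + (h * real r) *\<^sub>R axis e 1) \<bullet> stereo_inv s (u + (h * real j) *\<^sub>R axis e 1))))"

lemma legendre_stereo_difference_bound:
  fixes R \<beta> :: real and D m :: nat
  assumes "R \<ge> 0" "\<beta> > 0" and m: "\<beta> \<le> 2 * real m" and D: "2 * m + 4 * m * m < D"
  shows "\<exists>C\<ge>0. \<forall>s u h l e. s\<^sup>2 = 1 \<longrightarrow> norm (u :: real ^ 2) \<le> R \<longrightarrow> 0 < h \<longrightarrow> h \<le> 1 \<longrightarrow>
    \<bar>legendre_chart_diff2 D l s u h e\<bar>
    \<le> C * (real l powr \<beta> * h powr \<beta>)"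
proof -
  obtain C where C: "C \<ge> 0" and bound: "\<forall>a b h l. 1 \<le> a \<longrightarrow> \<bar>b\<bar> \<le> R \<longrightarrow> 0 < h \<longrightarrow> h \<le> 1 \<longrightarrow>
    (\<forall>\<tau>. 1 \<le> quad a b \<tau>) \<longrightarrow>
    (\<forall>\<tau> \<sigma>. (\<tau> - \<sigma>)\<^sup>2 \<le> quad a b \<tau> * quad a b \<sigma>) \<longrightarrow>
    \<bar>legendre_diff2 D l a b h\<bar>
    \<le> C * (real l powr \<beta> * h powr \<beta>)"
    using legendre_double_difference_bound[OF assms] by (elim exE conjE) (rule that)
  show ?thesis
  proof (intro exI[of _ C] conjI allI impI C)
    fix s h l e and u :: "real ^ 2"
    assume s: "s\<^sup>2 = (1::real)" and u: "norm u \<le> R" and h: "0 < h" "h \<le> (1::real)"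
    define a b where "a = (norm u)\<^sup>2 + 1" and "b = u $ e"
    define x where "x \<tau> = u + \<tau> *\<^sub>R axis e (1::real)" for \<tau>
    have nx: "(norm (x \<tau>))\<^sup>2 + 1 = quad a b \<tau>" for \<tau>
    proof -
      have "x \<tau> \<bullet> x \<tau> = u \<bullet> u + 2 * (\<tau> * b) + \<tau> * \<tau>"
        by (simp add: x_def b_def inner_add_left inner_add_right inner_axis inner_axis' inner_commute inner_axis_axis)
      then show ?thesis unfolding a_def power2_norm_eq_inner by (simp only: power2_eq_square) simp
    qed
    have dx: "(norm (x \<tau> - x \<sigma>))\<^sup>2 = (\<tau> - \<sigma>)\<^sup>2" for \<tau> \<sigma>
    proof -
      have "x \<tau> - x \<sigma> = (\<tau> - \<sigma>) *\<^sub>R axis e 1" by (simp add: x_def algebra_simps)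
      then show ?thesis by (simp add: power_mult_distrib norm_axis_1)
    qed
    have inner: "stereo_inv s (x \<tau>) \<bullet> stereo_inv s (x \<sigma>)
      = 1 - 2 * ((\<tau> - \<sigma>)\<^sup>2 / (quad a b \<tau> * quad a b \<sigma>))" for \<tau> \<sigma>
      using inner_stereo_inv[OF s, of "x \<tau>" "x \<sigma>"] by (simp only: nx dx)
    have q1: "\<forall>\<tau>. 1 \<le> quad a b \<tau>" by (simp flip: nx)
    have q2: "\<forall>\<tau> \<sigma>. (\<tau> - \<sigma>)\<^sup>2 \<le> quad a b \<tau> * quad a b \<sigma>"
    proof (intro allI)
      fix \<tau> \<sigma>
      have "norm (stereo_inv s (x \<tau>)) = 1" "norm (stereo_inv s (x \<sigma>)) = 1"
        using stereo_inv_in_S2[OF s] by auto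
      then have "- 1 \<le> stereo_inv s (x \<tau>) \<bullet> stereo_inv s (x \<sigma>)"
        using Cauchy_Schwarz_ineq2[of "stereo_inv s (x \<tau>)" "stereo_inv s (x \<sigma>)"] by simp
      moreover have "0 < quad a b \<tau> * quad a b \<sigma>"
        using q1[rule_format, of \<tau>] q1[rule_format, of \<sigma>] by (intro mult_pos_pos) linarith+
      ultimately show "(\<tau> - \<sigma>)\<^sup>2 \<le> quad a b \<tau> * quad a b \<sigma>"
        unfolding inner by (simp add: pos_divide_le_eq del: zero_less_mult_iff mult_less_0_iff)
    qed
    have "1 \<le> a" "\<bar>b\<bar> \<le> R"
      using component_le_norm_cart[of u e] u by (auto simp: a_def b_def)
    from bound[rule_format, OF this h q1[rule_format] q2[rule_format], of l]
    show "\<bar>legendre_chart_diff2 D l s u h e\<bar>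
      \<le> C * (real l powr \<beta> * h powr \<beta>)"
      unfolding inner[symmetric] unfolding x_def .
  qed
qed

section \<open>A smooth compactly supported kernel that reproduces polynomials\<close>

primrec smooth_upto :: "nat \<Rightarrow> (real \<Rightarrow> real) \<Rightarrow> bool"
  where "smooth_upto 0 f \<longleftrightarrow> continuous_on UNIV f"
  | "smooth_upto (Suc K) f \<longleftrightarrow> (\<exists>f'. (\<forall>x. (f has_real_derivative f' x) (at x)) \<and> smooth_upto K f')"

lemma continuous_on_if_DERIV:
  "(\<And>x. (f has_real_derivative f' x) (at x)) \<Longrightarrow> continuous_on UNIV f"
  by (rule DERIV_continuous_on[of UNIV f f']) simp

lemma smooth_upto_Suc_imp: "smooth_upto (Suc K) f \<Longrightarrow> smooth_upto K f"
proof (induction K arbitrary: f)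
  case 0
  then show ?case using continuous_on_if_DERIV[of f] by auto
next
  case (Suc K)
  then obtain f' where "\<forall>x. (f has_real_derivative f' x) (at x)" "smooth_upto (Suc K) f'"
    unfolding smooth_upto.simps(2)[of "Suc K" f] by blast
  then show ?case using Suc.IH[of f'] unfolding smooth_upto.simps(2)[of K f] by blast
qed

lemma smooth_upto_SucI:
  "(\<And>x. (f has_real_derivative f' x) (at x)) \<Longrightarrow> smooth_upto K f' \<Longrightarrow> smooth_upto (Suc K) f"
  by auto

lemma smooth_upto_add: "smooth_upto K f \<Longrightarrow> smooth_upto K g \<Longrightarrow> smooth_upto K (\<lambda>x. f x + g x)"
proof (induction K arbitrary: f g)
  case (Suc K)
  then obtain f' g' where d: "\<forall>x. (f has_real_derivative f' x) (at x)" "smooth_upto K f'"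
    "\<forall>x. (g has_real_derivative g' x) (at x)" "smooth_upto K g'" by auto
  have "((\<lambda>x. f x + g x) has_real_derivative f' x + g' x) (at x)" for x
    using DERIV_add[of f "f' x" x UNIV g "g' x"] d by simp
  then show ?case using Suc.IH[OF d(2,4)] by (rule smooth_upto_SucI)
qed (auto intro: continuous_intros)

lemma smooth_upto_mult: "smooth_upto K f \<Longrightarrow> smooth_upto K g \<Longrightarrow> smooth_upto K (\<lambda>x. f x * g x)"
proof (induction K arbitrary: f g)
  case (Suc K)
  then obtain f' g' where d: "\<forall>x. (f has_real_derivative f' x) (at x)" "smooth_upto K f'"
    "\<forall>x. (g has_real_derivative g' x) (at x)" "smooth_upto K g'" by auto
  have "smooth_upto K (\<lambda>x. f' x * g x + f x * g' x)"
    by (intro smooth_upto_add Suc.IH d Suc.prems[THEN smooth_upto_Suc_imp])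
  moreover have "((\<lambda>x. f x * g x) has_real_derivative f' x * g x + f x * g' x) (at x)" for x
    using DERIV_mult'[of f "f' x" x UNIV g "g' x"] d by (simp add: add.commute)
  ultimately show ?case by (intro smooth_upto_SucI)
qed (auto intro: continuous_intros)

lemma smooth_upto_const: "smooth_upto K (\<lambda>x. c)"
proof (induction K arbitrary: c)
  case (Suc K)
  then show ?case by (intro smooth_upto_SucI[where f' = "\<lambda>x. 0"]) auto
qed auto

lemma smooth_upto_sum:
  "(\<And>i. i \<in> I \<Longrightarrow> smooth_upto K (f i)) \<Longrightarrow> smooth_upto K (\<lambda>x. \<Sum>i\<in>I. f i x)"
  by (induction I rule: infinite_finite_induct) (auto intro: smooth_upto_const smooth_upto_add)

lemma smooth_upto_poly: "smooth_upto K (poly p)"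
proof (induction K arbitrary: p)
  case (Suc K)
  then show ?case by (intro smooth_upto_SucI[OF poly_DERIV])
qed (auto intro: continuous_intros)

lemma smooth_upto_shift: "smooth_upto K f \<Longrightarrow> smooth_upto K (\<lambda>x. f (x + c))"
proof (induction K arbitrary: f)
  case 0
  then show ?case
    using continuous_on_compose2[of UNIV f UNIV "\<lambda>x. x + c"] by (simp add: continuous_on_add)
next
  case (Suc K)
  then obtain f' where f': "\<forall>x. (f has_real_derivative f' x) (at x)" "smooth_upto K f'" by auto
  then have "((\<lambda>x. f (x + c)) has_real_derivative f' (x + c)) (at x)" for x
    by (simp flip: DERIV_shift)
  then show ?case using Suc.IH[OF f'(2)] by (rule smooth_upto_SucI)
qed

lemma smooth_upto_higher_deriv:
  assumes "smooth_upto K f"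
  shows "p < K \<Longrightarrow> ((deriv ^^ p) f has_real_derivative (deriv ^^ Suc p) f x) (at x)"
    and "p \<le> K \<Longrightarrow> continuous_on UNIV ((deriv ^^ p) f)"
proof -
  have "(p < K \<longrightarrow> (\<forall>x. ((deriv ^^ p) f has_real_derivative (deriv ^^ Suc p) f x) (at x)))
    \<and> (p \<le> K \<longrightarrow> continuous_on UNIV ((deriv ^^ p) f))"
    using assms
  proof (induction K arbitrary: f p)
    case (Suc K)
    then obtain f' where f': "\<forall>x. (f has_real_derivative f' x) (at x)" "smooth_upto K f'" by auto
    then have "deriv f = f'" by (auto simp: DERIV_imp_deriv)
    show ?case
    proof (cases p)
      case 0
      then show ?thesis using f' \<open>deriv f = f'\<close> continuous_on_if_DERIV[of f f'] by simp
    next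
      case (Suc p')
      have sw: "(deriv ^^ Suc n) f = (deriv ^^ n) f'" for n
        by (simp only: funpow_Suc_right o_apply \<open>deriv f = f'\<close>)
      show ?thesis using Suc.IH[OF f'(2), of p'] unfolding Suc sw by simp
    qed
  qed auto
  then show "p < K \<Longrightarrow> ((deriv ^^ p) f has_real_derivative (deriv ^^ Suc p) f x) (at x)"
    and "p \<le> K \<Longrightarrow> continuous_on UNIV ((deriv ^^ p) f)" by auto
qed

text \<open>If \<open>S\<close> is a step from \<open>0\<close> to \<open>1\<close>, then so is its moving average \<open>x \<mapsto> \<integral>\<^sub>x\<^sub>-\<^sub>1\<^sup>x S\<close>, and it has
  one more continuous derivative, namely \<open>S x - S (x - 1)\<close>.\<close>

lemma exists_smooth_step:
  "\<exists>S W. W > 0 \<and> smooth_upto K S \<and> (\<forall>x\<le>0. S x = 0) \<and> (\<forall>x\<ge>real W. S x = 1)"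
proof (induction K)
  case 0
  show ?case
    by (intro exI[of _ "\<lambda>x. max 0 (min 1 x)"] exI[of _ 1]) (auto intro!: continuous_intros)
next
  case (Suc K)
  then obtain S W where W: "W > 0" and S: "smooth_upto K S" "\<And>x. x \<le> 0 \<Longrightarrow> S x = 0" "\<And>x. x \<ge> real W \<Longrightarrow> S x = 1"
    by auto
  have cont: "continuous_on A S" for A
    using smooth_upto_higher_deriv(2)[OF S(1), of 0] by (auto intro: continuous_on_subset)
  \<comment> \<open>Any lower limit below \<open>0\<close> works, as \<open>S\<close> vanishes there; this one leaves \<open>0\<close> in the interior.\<close>
  define F where "F x = integral {-1..x} S" for x
  have dF: "(F has_real_derivative S x) (at x)" for x
  proof (cases "x < 0")
    case True
    have "(F has_real_derivative 0) (at x)"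
    proof (rule has_field_derivative_transform_within_open[where f = "\<lambda>x. 0" and S = "{..<0}"])
      fix y :: real assume y: "y \<in> {..<0}"
      have "F y = integral {-1..y} (\<lambda>x. 0)"
        unfolding F_def using y S(2) by (intro integral_cong) auto
      then show "0 = F y" by simp
    qed (use True in auto)
    then show ?thesis using True S(2)[of x] by simp
  next
    case False
    have "(F has_real_derivative S x) (at x within {-1..x + 1})"
      unfolding F_def using False by (intro integral_has_real_derivative cont) auto
    moreover have "at x within {-1..x + 1} = at x"
      using False by (intro at_within_interior) auto
    ultimately show ?thesis by simp
  qed
  define G where "G x = F x - F (x - 1)" for x
  have dG: "(G has_real_derivative S x - S (x - 1)) (at x)" for x
  proof -
    have "((\<lambda>x. F (x + (-1))) has_real_derivative S (x + (-1))) (at x)"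
      by (subst DERIV_shift[symmetric]) (rule dF)
    then show ?thesis unfolding G_def using DERIV_diff[OF dF] by simp
  qed
  have mv: "\<exists>z. x - 1 < z \<and> z < x \<and> G x = S z" for x
    using MVT2[of "x - 1" x F S] dF by (auto simp: G_def)
  have GS: "\<And>x. x \<le> 0 \<Longrightarrow> G x = 0" "\<And>x. x \<ge> real (Suc W) \<Longrightarrow> G x = 1"
  proof -
    fix x :: real
    show "G x = 0" if "x \<le> 0" using mv[of x] that S(2) by force
    show "G x = 1" if "x \<ge> real (Suc W)" using mv[of x] that S(3) by force
  qed
  have "smooth_upto K (\<lambda>x. S x + (-1) * S (x + (-1)))"
    by (intro smooth_upto_add smooth_upto_mult smooth_upto_const smooth_upto_shift S)
  then have "smooth_upto (Suc K) G" using dG by (intro smooth_upto_SucI[where f' = "\<lambda>x. S x + (-1) * S (x + (-1))"]) simp_all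
  with GS show ?case by blast
qed

lemma exists_lagrange_basis:
  "\<exists>L :: nat \<Rightarrow> real poly. \<forall>p. degree p < D \<longrightarrow> p = (\<Sum>r<D. smult (poly p (real r)) (L r))"
proof -
  define P where "P r = (\<Prod>i\<in>{..<D} - {r}. [:- real i, 1:])" for r
  define L where "L r = smult (1 / poly (P r) (real r)) (P r)" for r
  have degP: "degree (P r) < D" if "r < D" for r
  proof -
    have "degree (P r) \<le> card ({..<D} - {r})"
      unfolding P_def using degree_prod_sum_le[of "{..<D} - {r}" "\<lambda>i. [:- real i, 1:]"] by simp
    then show ?thesis using that by simp
  qed
  have PL: "poly (L r) (real i) = (if i = r then 1 else 0)" if "i < D" "r < D" for i r
    using that by (auto simp: L_def P_def poly_prod)
  have "p = (\<Sum>r<D. smult (poly p (real r)) (L r))" (is "p = ?q") if "degree p < D" for p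
  proof (rule poly_eqI_degree[where A = "real ` {..<D}"])
    fix x assume "x \<in> real ` {..<D}"
    then obtain i where i: "x = real i" "i < D" by auto
    have "poly ?q x = (\<Sum>r<D. if r = i then poly p (real r) else 0)"
      unfolding poly_sum i(1) using PL i(2) by (intro sum.cong) auto
    then show "poly p x = poly ?q x" using i by simp
  next
    have c: "card (real ` {..<D}) = D" by (simp add: card_image)
    show "card (real ` {..<D}) > degree p" using that c by simp
    have "degree ?q \<le> D - 1"
    proof (rule degree_sum_le)
      fix r assume "r \<in> {..<D}"
      then have "degree (P r) \<le> D - 1" using degP[of r] by simp
      then show "degree (smult (poly p (real r)) (L r)) \<le> D - 1"
        unfolding L_def smult_smult using degree_smult_le order_trans by blast
    qed simp
    then show "card (real ` {..<D}) > degree ?q" using that c by simp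
  qed
  then show ?thesis by blast
qed

lemma sum_support_cong:
  fixes f :: "'i \<Rightarrow> real"
  assumes "finite I" "finite J" "\<And>i. f i \<noteq> 0 \<Longrightarrow> i \<in> I" "\<And>i. f i \<noteq> 0 \<Longrightarrow> i \<in> J"
  shows "sum f I = sum f J"
proof -
  have "sum f I = sum f (I \<inter> J)" using assms by (intro sum.mono_neutral_right) auto
  also have "\<dots> = sum f J" using assms by (intro sum.mono_neutral_left) auto
  finally show ?thesis .
qed

lemma finite_integers_near: "finite {i :: int. \<bar>x - of_int i\<bar> \<le> (W::real)}"
  and card_integers_near: "W \<ge> 0 \<Longrightarrow> real (card {i :: int. \<bar>x - of_int i\<bar> \<le> W}) \<le> 2 * W + 1"
proof -
  have eq: "{i :: int. \<bar>x - of_int i\<bar> \<le> W} = {\<lceil>x - W\<rceil>..\<lfloor>x + W\<rfloor>}"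
    by (auto simp: abs_le_iff ceiling_le_iff le_floor_iff)
  show "finite {i :: int. \<bar>x - of_int i\<bar> \<le> W}" unfolding eq by simp
  assume "W \<ge> 0"
  have "real_of_int \<lfloor>x + W\<rfloor> \<le> x + W" "x - W \<le> real_of_int \<lceil>x - W\<rceil>" by linarith+
  then have "real_of_int (\<lfloor>x + W\<rfloor> + 1 - \<lceil>x - W\<rceil>) \<le> 2 * W + 1"
    unfolding of_int_add of_int_diff of_int_1 by linarith
  then have "real (nat (\<lfloor>x + W\<rfloor> + 1 - \<lceil>x - W\<rceil>)) \<le> 2 * W + 1"
    using \<open>W \<ge> 0\<close> by (cases "0 \<le> \<lfloor>x + W\<rfloor> + 1 - \<lceil>x - W\<rceil>") simp_all
  then show "real (card {i :: int. \<bar>x - of_int i\<bar> \<le> W}) \<le> 2 * W + 1"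
    unfolding eq card_atLeastAtMost_int by (simp add: algebra_simps)
qed

text \<open>The differences \<open>B x = S (x + 1) - S x\<close> of a smooth step have integer translates summing to \<open>1\<close>, by
  telescoping. Blending with the weights \<open>B (x - j)\<close> the Lagrange polynomials that interpolate at
  \<open>j, \<dots>, j + D - 1\<close> reproduces every polynomial of degree less than \<open>D\<close>; collecting the terms that belong to the
  same sample gives \<open>\<eta>\<close>. The index set \<open>I\<close> may be any finite set that contains all active indices.\<close>

lemma exists_reproducing_kernel:
  "\<exists>\<eta> (W::nat). smooth_upto K \<eta> \<and> (\<forall>x. \<bar>x\<bar> > real W \<longrightarrow> \<eta> x = 0) \<and>
    (\<forall>p x I. degree p < D \<longrightarrow> finite I \<longrightarrow> {i :: int. \<bar>x - of_int i\<bar> \<le> real W} \<subseteq> I \<longrightarrow>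
      (\<Sum>i\<in>I. poly p (of_int i) * \<eta> (x - of_int i)) = poly p x)"
proof -
  obtain S W0 where S: "smooth_upto K S" "\<And>x. x \<le> 0 \<Longrightarrow> S x = 0" "\<And>x. x \<ge> real W0 \<Longrightarrow> S x = 1"
    using exists_smooth_step[of K] by auto
  obtain L :: "nat \<Rightarrow> real poly" where L: "\<And>p. degree p < D \<Longrightarrow> p = (\<Sum>r<D. smult (poly p (real r)) (L r))"
    using exists_lagrange_basis[of D] by auto
  define B where "B x = S (x + 1) - S x" for x
  have B0: "B x = 0" if "x \<le> -1 \<or> x \<ge> real W0" for x
    using that S by (auto simp: B_def)
  have Bsum: "(\<Sum>j=-int N..int N. B (x - of_int j)) = 1" if N: "real N \<ge> \<bar>x\<bar> + real W0" for N x
  proof -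
    have tele: "(\<Sum>j=a..b. B (x - of_int j)) = S (x - of_int a + 1) - S (x - of_int b)" if "a \<le> b" for a b :: int
      using that
    proof (induction rule: int_ge_induct)
      case (step b)
      have "{a..b + 1} = insert (b + 1) {a..b}" using step.hyps by auto
      then show ?case using step.IH by (simp add: B_def algebra_simps)
    qed (simp add: B_def)
    have "S (x + real N + 1) = 1" "S (x - real N) = 0"
      using N by (auto intro!: S)
    then show ?thesis using tele[of "-int N" "int N"] by simp
  qed
  define \<eta> where "\<eta> x = (\<Sum>r<D. B (x + real r) * poly (L r) (x + real r))" for x
  define W where "W = W0 + D + 1"
  have smooth: "smooth_upto K \<eta>"
  proof -
    have "smooth_upto K (\<lambda>x. S (x + 1) + (-1) * S x)"
      by (intro smooth_upto_add smooth_upto_mult smooth_upto_const smooth_upto_shift S)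
    then have "smooth_upto K B" by (simp add: B_def[abs_def])
    then show ?thesis
      unfolding \<eta>_def[abs_def]
      by (intro smooth_upto_sum smooth_upto_shift[of K "\<lambda>x. B x * poly (L _) x"] smooth_upto_mult smooth_upto_poly)
  qed
  have supp: "\<eta> x = 0" if "\<bar>x\<bar> > real W" for x
    unfolding \<eta>_def
  proof (rule sum.neutral, intro ballI)
    fix r assume "r \<in> {..<D}"
    then have "real r \<le> real D" by simp
    then have "B (x + real r) = 0" using that by (intro B0) (auto simp: W_def)
    then show "B (x + real r) * poly (L r) (x + real r) = 0" by simp
  qed
  have rep: "(\<Sum>i\<in>I. poly p (of_int i) * \<eta> (x - of_int i)) = poly p x"
    if p: "degree p < D" and I: "finite I" "{i :: int. \<bar>x - of_int i\<bar> \<le> real W} \<subseteq> I" for p x and I :: "int set"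
  proof -
    obtain N0 :: nat where "\<bar>x\<bar> + real W0 + real W \<le> real N0" using real_arch_simple by blast
    then have N0: "real N0 \<ge> \<bar>x\<bar> + real W0 + real W" .
    define N where "N = N0 + D"
    let ?J = "{-int N..int N}"
    let ?g = "\<lambda>j r. poly p (of_int j + real r) * (B (x - of_int j) * poly (L r) (x - of_int j))"
    have "(\<Sum>i\<in>I. poly p (of_int i) * \<eta> (x - of_int i)) = (\<Sum>i\<in>?J. poly p (of_int i) * \<eta> (x - of_int i))"
    proof (rule sum_support_cong[OF I(1)])
      fix i assume "poly p (of_int i) * \<eta> (x - of_int i) \<noteq> 0"
      then have i: "\<bar>x - of_int i\<bar> \<le> real W" using supp[of "x - of_int i"] by force
      then show "i \<in> I" using I(2) by auto
      have "\<bar>of_int i :: real\<bar> \<le> real N" using i N0 by (simp add: N_def)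
      then show "i \<in> ?J" by (simp add: abs_le_iff)
    qed simp
    also have "\<dots> = (\<Sum>r<D. \<Sum>i\<in>?J. poly p (of_int i) * (B (x - of_int i + real r) * poly (L r) (x - of_int i + real r)))"
      unfolding \<eta>_def sum_distrib_left by (rule sum.swap)
    also have "\<dots> = (\<Sum>r<D. \<Sum>j\<in>?J. ?g j r)"
    proof (rule sum.cong[OF refl])
      fix r assume "r \<in> {..<D}"
      then have r: "r < D" by simp
      have "(\<Sum>i\<in>?J. poly p (of_int i) * (B (x - of_int i + real r) * poly (L r) (x - of_int i + real r)))
         = (\<Sum>j\<in>(\<lambda>i. i - int r) ` ?J. ?g j r)"
        by (subst sum.reindex) (auto simp: inj_on_def algebra_simps)
      also have "\<dots> = (\<Sum>j\<in>?J. ?g j r)"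
      proof (rule sum_support_cong)
        fix j assume "?g j r \<noteq> 0"
        then have "\<not> (x - of_int j \<le> -1 \<or> x - of_int j \<ge> real W0)" using B0[of "x - of_int j"] by force
        then have j: "\<bar>real_of_int j\<bar> \<le> real N0" using N0 by (auto simp: W_def)
        then have j': "\<bar>j\<bar> \<le> int N0" by linarith
        then show "j \<in> ?J" by (auto simp: N_def abs_le_iff)
        have "j = (j + int r) - int r" "j + int r \<in> ?J" using j' r by (auto simp: N_def abs_le_iff)
        then show "j \<in> (\<lambda>i. i - int r) ` ?J" by blast
      qed auto
      finally show "(\<Sum>i\<in>?J. poly p (of_int i) * (B (x - of_int i + real r) * poly (L r) (x - of_int i + real r)))
         = (\<Sum>j\<in>?J. ?g j r)" .
    qed
    also have "\<dots> = (\<Sum>j\<in>?J. \<Sum>r<D. ?g j r)" by (rule sum.swap)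
    also have "\<dots> = (\<Sum>j\<in>?J. B (x - of_int j) * poly p x)"
    proof (rule sum.cong[OF refl])
      fix j
      define q where "q = pcompose p [:of_int j, 1:]"
      have "degree q < D" using p by (simp add: q_def degree_pcompose)
      from arg_cong[OF L[OF this], of "\<lambda>q. poly q (x - of_int j)"]
      have "poly p x = (\<Sum>r<D. poly p (of_int j + real r) * poly (L r) (x - of_int j))"
        by (simp add: q_def poly_pcompose poly_sum)
      then show "(\<Sum>r<D. ?g j r) = B (x - of_int j) * poly p x"
        by (simp add: sum_distrib_left mult_ac)
    qed
    also have "\<dots> = poly p x"
      unfolding sum_distrib_right[symmetric] using N0 by (subst Bsum) (auto simp: N_def)
    finally show ?thesis .
  qed
  show ?thesis using smooth supp rep by (intro exI[of _ \<eta>] exI[of _ W]) blast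
qed

lemma higher_deriv_kernel_support:
  assumes "\<And>x. \<bar>x\<bar> > W \<Longrightarrow> \<eta> x = (0::real)" and "\<bar>x\<bar> > W"
  shows "(deriv ^^ p) \<eta> x = 0"
  using assms(2)
proof (induction p arbitrary: x)
  case (Suc p)
  have "((deriv ^^ p) \<eta> has_real_derivative 0) (at x)"
  proof (rule has_field_derivative_transform_within_open[where f = "\<lambda>x. 0" and S = "{x. \<bar>x\<bar> > W}"])
    show "open {x. \<bar>x\<bar> > W}" by (intro open_Collect_less continuous_intros)
  qed (use Suc in auto)
  then show ?case by (simp add: DERIV_imp_deriv)
qed (use assms in auto)

text \<open>The reproduction identity can be differentiated once the index set is the same for all points near \<open>x\<close>, which
  a symmetric interval provides.\<close>

lemma higher_deriv_kernel_reproduces: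
  fixes W :: nat
  assumes smooth: "smooth_upto K \<eta>" and supp: "\<And>x. \<bar>x\<bar> > real W \<Longrightarrow> \<eta> x = 0"
    and rep: "\<And>x I. finite I \<Longrightarrow> {i :: int. \<bar>x - of_int i\<bar> \<le> real W} \<subseteq> I \<Longrightarrow>
      (\<Sum>i\<in>I. poly P (of_int i) * \<eta> (x - of_int i)) = poly P x"
    and n: "n \<le> K" and I: "finite I" "{i :: int. \<bar>x - of_int i\<bar> \<le> real W} \<subseteq> I"
  shows "(\<Sum>i\<in>I. poly P (of_int i) * (deriv ^^ n) \<eta> (x - of_int i)) = poly ((pderiv ^^ n) P) x"
proof -
  have main: "(\<Sum>i=-int N..int N. poly P (of_int i) * (deriv ^^ n) \<eta> (x - of_int i)) = poly ((pderiv ^^ n) P) x"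
    if "n \<le> K" "\<bar>x\<bar> < real N - real W" for n N x
    using that
  proof (induction n arbitrary: x)
    case 0
    have "{i :: int. \<bar>x - of_int i\<bar> \<le> real W} \<subseteq> {-int N..int N}"
    proof
      fix i :: int assume "i \<in> {i. \<bar>x - of_int i\<bar> \<le> real W}"
      then have "\<bar>real_of_int i\<bar> \<le> real N" using 0 by auto
      then show "i \<in> {-int N..int N}" by (simp add: abs_le_iff)
    qed
    then show ?case using rep[of "{-int N..int N}" x] by simp
  next
    case (Suc n)
    let ?F = "\<lambda>x. \<Sum>i=-int N..int N. poly P (of_int i) * (deriv ^^ n) \<eta> (x - of_int i)"
    have "(?F has_real_derivative (\<Sum>i=-int N..int N. poly P (of_int i) * (deriv ^^ Suc n) \<eta> (x - of_int i))) (at x)"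
    proof (intro DERIV_sum DERIV_cmult)
      fix i :: int
      have "((deriv ^^ n) \<eta> has_real_derivative (deriv ^^ Suc n) \<eta> (x + - of_int i)) (at (x + - of_int i))"
        using smooth_upto_higher_deriv(1)[OF smooth] Suc.prems by simp
      then show "((\<lambda>x. (deriv ^^ n) \<eta> (x - of_int i)) has_real_derivative (deriv ^^ Suc n) \<eta> (x - of_int i)) (at x)"
        unfolding DERIV_shift by simp
    qed
    moreover have "(?F has_real_derivative poly (pderiv ((pderiv ^^ n) P)) x) (at x)"
    proof (rule has_field_derivative_transform_within_open[OF poly_DERIV, where S = "{x. \<bar>x\<bar> < real N - real W}"])
      show "open {x. \<bar>x\<bar> < real N - real W}" by (intro open_Collect_less continuous_intros)
      show "x \<in> {x. \<bar>x\<bar> < real N - real W}" using Suc.prems by simp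
      show "poly ((pderiv ^^ n) P) y = ?F y" if "y \<in> {x. \<bar>x\<bar> < real N - real W}" for y
        using Suc.IH[of y] Suc.prems that by simp
    qed
    ultimately show ?case by (simp add: DERIV_unique)
  qed
  obtain N :: nat where N: "\<bar>x\<bar> + real W + 1 \<le> real N" using real_arch_simple by blast
  have "(\<Sum>i\<in>I. poly P (of_int i) * (deriv ^^ n) \<eta> (x - of_int i))
     = (\<Sum>i=-int N..int N. poly P (of_int i) * (deriv ^^ n) \<eta> (x - of_int i))"
  proof (rule sum_support_cong[OF I(1)])
    fix i assume "poly P (of_int i) * (deriv ^^ n) \<eta> (x - of_int i) \<noteq> 0"
    then have i: "\<bar>x - of_int i\<bar> \<le> real W"
      using higher_deriv_kernel_support[of "real W" \<eta> "x - of_int i" n, OF supp] by force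
    then show "i \<in> I" using I(2) by auto
    have "\<bar>of_int i :: real\<bar> \<le> real N" using i N by simp
    then show "i \<in> {-int N..int N}" by (simp add: abs_le_iff)
  qed simp
  also have "\<dots> = poly ((pderiv ^^ n) P) x" using main[OF n, of x N] N by simp
  finally show ?thesis .
qed

lemma higher_deriv_kernel_bounded:
  fixes W :: nat
  assumes smooth: "smooth_upto K \<eta>" and supp: "\<And>x. \<bar>x\<bar> > real W \<Longrightarrow> \<eta> x = 0"
  shows "\<exists>B>0. \<forall>n\<le>K. \<forall>x. \<bar>(deriv ^^ n) \<eta> x\<bar> \<le> B"
proof -
  have "\<exists>B. \<forall>x. \<bar>(deriv ^^ n) \<eta> x\<bar> \<le> B" if "n \<le> K" for n
  proof -
    have "compact ((deriv ^^ n) \<eta> ` {-real W..real W})"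
      using smooth_upto_higher_deriv(2)[OF smooth that]
      by (intro compact_continuous_image) (auto intro: continuous_on_subset)
    then obtain B where B: "\<And>x. x \<in> {-real W..real W} \<Longrightarrow> \<bar>(deriv ^^ n) \<eta> x\<bar> \<le> B"
      using bounded_real compact_imp_bounded by (metis imageI)
    have "\<bar>(deriv ^^ n) \<eta> x\<bar> \<le> max 0 B" for x
    proof (cases "\<bar>x\<bar> > real W")
      case True
      then show ?thesis using higher_deriv_kernel_support[of "real W" \<eta> x n, OF supp] by simp
    next
      case False
      then have "x \<in> {-real W..real W}" by auto
      from B[OF this] show ?thesis by simp
    qed
    then show ?thesis by blast
  qed
  then obtain B where B: "\<And>n x. n \<le> K \<Longrightarrow> \<bar>(deriv ^^ n) \<eta> x\<bar> \<le> B n" by metis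
  have "\<bar>(deriv ^^ n) \<eta> x\<bar> \<le> 1 + (\<Sum>n\<le>K. \<bar>B n\<bar>)" if "n \<le> K" for n x
  proof -
    have "\<bar>(deriv ^^ n) \<eta> x\<bar> \<le> \<bar>B n\<bar>" using B[OF that, of x] by linarith
    also have "\<dots> \<le> (\<Sum>n\<le>K. \<bar>B n\<bar>)" using that by (intro member_le_sum) auto
    finally show ?thesis by simp
  qed
  moreover have "0 < 1 + (\<Sum>n\<le>K. \<bar>B n\<bar>)" by (simp add: add_pos_nonneg sum_nonneg)
  ultimately show ?thesis by blast
qed

section \<open>Refining the sampling grid\<close>

text \<open>Newton's forward difference formula with remainder: a sequence with small differences of order \<open>D\<close> is close
  to a combination of the binomials \<open>i choose j\<close> with \<open>j < D\<close>. In the induction step the approximation of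
  the first differences is summed, by the hockey stick identity.\<close>

lemma newton_remainder:
  "\<exists>C\<ge>0. \<forall>f \<epsilon>. 0 \<le> \<epsilon> \<longrightarrow> (\<forall>m. m + D \<le> N \<longrightarrow> \<bar>binom_diff D (\<lambda>r. f (m + r))\<bar> \<le> \<epsilon>) \<longrightarrow>
    (\<exists>b :: nat \<Rightarrow> real. \<forall>i\<le>N. \<bar>f i - (\<Sum>j<D. b j * real (i choose j))\<bar> \<le> C * \<epsilon>)"
proof (induction D arbitrary: N)
  case 0
  show ?case by (intro exI[of _ 1]) auto
next
  case (Suc D)
  obtain C where C: "C \<ge> 0" and IH: "\<And>f \<epsilon>. 0 \<le> \<epsilon> \<Longrightarrow>
     (\<forall>m. m + D \<le> N - 1 \<longrightarrow> \<bar>binom_diff D (\<lambda>r. f (m + r))\<bar> \<le> \<epsilon>) \<Longrightarrow>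
    \<exists>b :: nat \<Rightarrow> real. \<forall>i\<le>N-1. \<bar>f i - (\<Sum>j<D. b j * real (i choose j))\<bar> \<le> C * \<epsilon>"
    using Suc.IH[of "N - 1"] by blast
  show ?case
  proof (intro exI[of _ "real N * C"] conjI allI impI)
    show "0 \<le> real N * C" using C by simp
    fix f :: "nat \<Rightarrow> real" and \<epsilon> :: real
    assume \<epsilon>: "0 \<le> \<epsilon>" and f: "\<forall>m. m + Suc D \<le> N \<longrightarrow> \<bar>binom_diff (Suc D) (\<lambda>r. f (m + r))\<bar> \<le> \<epsilon>"
    show "\<exists>b. \<forall>i\<le>N. \<bar>f i - (\<Sum>j<Suc D. b j * real (i choose j))\<bar> \<le> real N * C * \<epsilon>"
    proof (cases "N = 0")
      case True
      have "(\<Sum>j<Suc D. (if j = 0 then f 0 else 0) * real (0 choose j)) = f 0"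
        by (subst sum.lessThan_Suc_shift) simp
      then show ?thesis using True by (intro exI[of _ "\<lambda>j. if j = 0 then f 0 else 0"]) simp
    next
      case False
      define g where "g i = f (Suc i) - f i" for i
      have "\<forall>m. m + D \<le> N - 1 \<longrightarrow> \<bar>binom_diff D (\<lambda>r. g (m + r))\<bar> \<le> \<epsilon>"
        using f False by (auto simp: g_def binom_diff_Suc)
      from IH[OF \<epsilon> this] obtain b where b: "\<And>i. i \<le> N - 1 \<Longrightarrow> \<bar>g i - (\<Sum>j<D. b j * real (i choose j))\<bar> \<le> C * \<epsilon>"
        by blast
      define b' where "b' j = (case j of 0 \<Rightarrow> f 0 | Suc j \<Rightarrow> b j)" for j
      have "\<bar>f i - (\<Sum>j<Suc D. b' j * real (i choose j))\<bar> \<le> real N * C * \<epsilon>" if i: "i \<le> N" for i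
      proof -
        have choose: "(\<Sum>m<i. real (m choose j)) = real (i choose Suc j)" for j
          by (induction i) (simp_all add: add.commute)
        have "(\<Sum>j<Suc D. b' j * real (i choose j)) = f 0 + (\<Sum>j<D. b j * real (i choose Suc j))"
          unfolding sum.lessThan_Suc_shift by (simp add: b'_def)
        also have "(\<Sum>j<D. b j * real (i choose Suc j)) = (\<Sum>m<i. \<Sum>j<D. b j * real (m choose j))"
          unfolding choose[symmetric] sum_distrib_left by (rule sum.swap)
        finally have "f i - (\<Sum>j<Suc D. b' j * real (i choose j)) = (\<Sum>m<i. g m - (\<Sum>j<D. b j * real (m choose j)))"
          using sum_lessThan_telescope[of f i] by (simp add: g_def sum_subtractf)
        also have "\<bar>\<dots>\<bar> \<le> (\<Sum>m<i. C * \<epsilon>)"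
          using i by (intro order_trans[OF sum_abs] sum_mono b) auto
        also have "\<dots> = real i * (C * \<epsilon>)" by simp
        also have "\<dots> \<le> real N * (C * \<epsilon>)" using i C \<epsilon> by (intro mult_right_mono) auto
        finally show ?thesis by (simp add: mult.assoc)
      qed
      then show ?thesis by blast
    qed
  qed
qed

lemma exists_binomial_poly:
  "\<exists>p :: real poly. degree p \<le> j \<and> (\<forall>i. poly p (real i) = real (i choose j))"
proof -
  define p :: "real poly" where "p = smult (1 / fact j) (\<Prod>i<j. [:- real i, 1:])"
  have "degree p \<le> j"
    unfolding p_def using degree_prod_sum_le[of "{..<j}" "\<lambda>i. [:- real i, 1:]"]
    by (intro order_trans[OF degree_smult_le]) simp
  moreover have "poly p (real i) = real (i choose j)" for i
    by (simp add: p_def poly_prod binomial_gbinomial gbinomial_prod_rev atLeast0LessThan)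
  ultimately show ?thesis by blast
qed

lemma newton_remainder_poly:
  assumes "D > 0"
  shows "\<exists>C\<ge>0. \<forall>(f :: int \<Rightarrow> real) \<epsilon> i0. 0 \<le> \<epsilon> \<longrightarrow>
    (\<forall>m. i0 \<le> m \<and> m + int D \<le> i0 + int N \<longrightarrow> \<bar>binom_diff D (\<lambda>r. f (m + int r))\<bar> \<le> \<epsilon>) \<longrightarrow>
    (\<exists>p. degree p < D \<and> (\<forall>i. i0 \<le> i \<and> i \<le> i0 + int N \<longrightarrow> \<bar>f i - poly p (of_int i)\<bar> \<le> C * \<epsilon>))"
proof -
  obtain C where C: "C \<ge> 0" and newton: "\<And>f \<epsilon>. 0 \<le> \<epsilon> \<Longrightarrow>
     (\<forall>m. m + D \<le> N \<longrightarrow> \<bar>binom_diff D (\<lambda>r. f (m + r))\<bar> \<le> \<epsilon>) \<Longrightarrow>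
    \<exists>b :: nat \<Rightarrow> real. \<forall>i\<le>N. \<bar>f i - (\<Sum>j<D. b j * real (i choose j))\<bar> \<le> C * \<epsilon>"
    using newton_remainder[of D N] by blast
  obtain B :: "nat \<Rightarrow> real poly" where B: "\<And>j. degree (B j) \<le> j" "\<And>i j. poly (B j) (real i) = real (i choose j)"
    using exists_binomial_poly by metis
  show ?thesis
  proof (intro exI[of _ C] conjI allI impI C)
    fix f :: "int \<Rightarrow> real" and \<epsilon> :: real and i0 :: int
    assume \<epsilon>: "0 \<le> \<epsilon>"
      and f: "\<forall>m. i0 \<le> m \<and> m + int D \<le> i0 + int N \<longrightarrow> \<bar>binom_diff D (\<lambda>r. f (m + int r))\<bar> \<le> \<epsilon>"
    have "\<forall>m. m + D \<le> N \<longrightarrow> \<bar>binom_diff D (\<lambda>r. f (i0 + int (m + r)))\<bar> \<le> \<epsilon>"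
    proof (intro allI impI)
      fix m assume "m + D \<le> N"
      then show "\<bar>binom_diff D (\<lambda>r. f (i0 + int (m + r)))\<bar> \<le> \<epsilon>"
        using f[rule_format, of "i0 + int m"] by (simp add: add.assoc)
    qed
    from newton[OF \<epsilon> this] obtain b where
      b: "\<And>i. i \<le> N \<Longrightarrow> \<bar>f (i0 + int i) - (\<Sum>j<D. b j * real (i choose j))\<bar> \<le> C * \<epsilon>" by blast
    define q where "q = (\<Sum>j<D. smult (b j) (B j))"
    define p where "p = pcompose q [:- of_int i0, 1:]"
    have "degree q \<le> D - 1"
      unfolding q_def
    proof (rule degree_sum_le)
      fix j assume "j \<in> {..<D}"
      then have "degree (B j) \<le> D - 1" using B(1)[of j] by simp
      then show "degree (smult (b j) (B j)) \<le> D - 1" using degree_smult_le order_trans by blast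
    qed simp
    then have "degree p < D" using assms by (simp add: p_def degree_pcompose)
    moreover have "\<bar>f i - poly p (of_int i)\<bar> \<le> C * \<epsilon>" if i: "i0 \<le> i \<and> i \<le> i0 + int N" for i
    proof -
      define k where "k = nat (i - i0)"
      have k: "i = i0 + int k" "k \<le> N" using i by (auto simp: k_def)
      have "poly p (of_int i) = (\<Sum>j<D. b j * real (k choose j))"
        by (simp add: p_def q_def poly_pcompose poly_sum k(1) B(2))
      then show ?thesis using b[OF k(2)] k(1) by simp
    qed
    ultimately show "\<exists>p. degree p < D \<and> (\<forall>i. i0 \<le> i \<and> i \<le> i0 + int N \<longrightarrow> \<bar>f i - poly p (of_int i)\<bar> \<le> C * \<epsilon>)"
      by blast
  qed
qed

lemma kernel_sum_bound:
  fixes W :: nat and \<phi> :: "real \<Rightarrow> real"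
  assumes supp: "\<And>y. \<bar>y\<bar> > real W \<Longrightarrow> \<phi> y = 0" and B: "\<And>y. \<bar>\<phi> y\<bar> \<le> B"
    and fin: "finite I" and g: "\<And>i. i \<in> I \<Longrightarrow> \<bar>y - of_int i\<bar> \<le> real W \<Longrightarrow> \<bar>g i\<bar> \<le> \<epsilon>" and "0 \<le> \<epsilon>"
  shows "\<bar>\<Sum>i\<in>I. g i * \<phi> (y - of_int i)\<bar> \<le> (2 * real W + 1) * (\<epsilon> * B)"
proof -
  let ?I = "I \<inter> {i. \<bar>y - of_int i\<bar> \<le> real W}"
  have "0 \<le> B" using B[of 0] by linarith
  have "(\<Sum>i\<in>I. g i * \<phi> (y - of_int i)) = (\<Sum>i\<in>?I. g i * \<phi> (y - of_int i))"
  proof (rule sum.mono_neutral_right[OF fin])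
    show "\<forall>i\<in>I - ?I. g i * \<phi> (y - of_int i) = 0"
      using supp by (auto simp: not_le)
  qed auto
  also have "\<bar>\<dots>\<bar> \<le> (\<Sum>i\<in>?I. \<epsilon> * B)"
    using g B \<open>0 \<le> \<epsilon>\<close> by (intro order_trans[OF sum_abs] sum_mono) (auto simp: abs_mult intro!: mult_mono)
  also have "\<dots> = real (card ?I) * (\<epsilon> * B)" by simp
  also have "\<dots> \<le> (2 * real W + 1) * (\<epsilon> * B)"
  proof (rule mult_right_mono)
    have "card ?I \<le> card {i :: int. \<bar>y - of_int i\<bar> \<le> real W}"
      by (intro card_mono finite_integers_near) auto
    then show "real (card ?I) \<le> 2 * real W + 1"
      using card_integers_near[of "real W" y] by linarith
    show "0 \<le> \<epsilon> * B" using \<open>0 \<le> \<epsilon>\<close> \<open>0 \<le> B\<close> by simp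
  qed
  finally show ?thesis .
qed

locale reproducing_kernel =
  fixes K D W :: nat and \<eta> :: "real \<Rightarrow> real"
  assumes D_pos: "D > 0"
    and smooth: "smooth_upto K \<eta>"
    and supp: "\<bar>x\<bar> > real W \<Longrightarrow> \<eta> x = 0"
    and reproduces: "\<lbrakk>degree p < D; finite I; {i :: int. \<bar>x - of_int i\<bar> \<le> real W} \<subseteq> I\<rbrakk> \<Longrightarrow>
      (\<Sum>i\<in>I. poly p (of_int i) * \<eta> (x - of_int i)) = poly p x"
begin

abbreviation window :: "real \<Rightarrow> int set" where "window x \<equiv> {i. \<bar>x - of_int i\<bar> \<le> real W}"

abbreviation d\<eta> :: "nat \<Rightarrow> real \<Rightarrow> real" where "d\<eta> n \<equiv> (deriv ^^ n) \<eta>"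

lemma d\<eta>_reproduces:
  "\<lbrakk>degree p < D; n \<le> K; finite I; window x \<subseteq> I\<rbrakk> \<Longrightarrow>
    (\<Sum>i\<in>I. poly p (of_int i) * d\<eta> n (x - of_int i)) = poly ((pderiv ^^ n) p) x"
  using higher_deriv_kernel_reproduces[OF smooth supp reproduces] by blast

lemma d\<eta>_bounded:
  obtains B where "B > 0" "\<And>n x. n \<le> K \<Longrightarrow> \<bar>d\<eta> n x\<bar> \<le> B" "\<And>n x. n \<le> K \<Longrightarrow> \<bar>2 ^ n * d\<eta> n x\<bar> \<le> B"
proof -
  obtain B where B: "B > 0" "\<And>n x. n \<le> K \<Longrightarrow> \<bar>d\<eta> n x\<bar> \<le> B"
    using higher_deriv_kernel_bounded[OF smooth supp] by blast
  have "\<bar>2 ^ n * d\<eta> n x\<bar> \<le> 2 ^ K * B" if "n \<le> K" for n x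
    unfolding abs_mult using that B by (intro mult_mono) (auto intro: power_increasing)
  moreover have "1 * B \<le> 2 ^ K * B" using B(1) by (intro mult_right_mono) auto
  then have "\<bar>d\<eta> n x\<bar> \<le> 2 ^ K * B" if "n \<le> K" for n x using B(2)[OF that, of x] by linarith
  ultimately show ?thesis using that[of "2 ^ K * B"] B(1) by simp
qed

lemma d\<eta>_supp: "\<bar>x\<bar> > real W \<Longrightarrow> d\<eta> n x = 0"
  by (rule higher_deriv_kernel_support[of "real W" \<eta> x n, OF supp])

text \<open>The samples \<open>f i\<close> belong to the points \<open>i / 2\<close>, so that \<open>f (2 * i)\<close> are the samples of the coarse grid. The
  estimate covers the derivatives of the interpolants of order \<open>n\<close>.\<close>

abbreviation refines_1d :: "real \<Rightarrow> bool" where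
  "refines_1d C \<equiv> \<forall>n\<le>K. \<forall>x f \<epsilon> I J. 0 \<le> \<epsilon> \<longrightarrow> finite I \<longrightarrow> finite J \<longrightarrow>
    window (2 * x) \<subseteq> I \<longrightarrow> window x \<subseteq> J \<longrightarrow>
    (\<forall>m. \<bar>2 * x - of_int m\<bar> \<le> 2 * real W + 1 \<longrightarrow> \<bar>binom_diff D (\<lambda>r. f (m + int r))\<bar> \<le> \<epsilon>) \<longrightarrow>
    \<bar>(\<Sum>i\<in>I. f i * (2 ^ n * d\<eta> n (2 * x - of_int i))) - (\<Sum>i\<in>J. f (2 * i) * d\<eta> n (x - of_int i))\<bar> \<le> C * \<epsilon>"

text \<open>The difference between the interpolants on the grids of mesh \<open>1/2\<close> and \<open>1\<close> vanishes on polynomials of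
  degree less than \<open>D\<close>. It sees only a bounded window of samples, where these are close to a polynomial.\<close>

lemma refinement_estimate_1d:
  "\<exists>C\<ge>0. refines_1d C"
proof -
  \<comment> \<open>Both grids together use the samples \<open>i\<close> with \<open>\<bar>2x - i\<bar> \<le> 2W\<close>; rounding \<open>2x\<close> down needs one more.\<close>
  define N where "N = 4 * W + 1"
  obtain C where C: "C \<ge> 0" and newton: "\<And>(f :: int \<Rightarrow> real) \<epsilon> i0. 0 \<le> \<epsilon> \<Longrightarrow>
    (\<forall>m. i0 \<le> m \<and> m + int D \<le> i0 + int N \<longrightarrow> \<bar>binom_diff D (\<lambda>r. f (m + int r))\<bar> \<le> \<epsilon>) \<Longrightarrow>
    \<exists>p. degree p < D \<and> (\<forall>i. i0 \<le> i \<and> i \<le> i0 + int N \<longrightarrow> \<bar>f i - poly p (of_int i)\<bar> \<le> C * \<epsilon>)"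
    using newton_remainder_poly[OF D_pos, of N] by blast
  obtain B where B: "B > 0" "\<And>n x. n \<le> K \<Longrightarrow> \<bar>d\<eta> n x\<bar> \<le> B" "\<And>n x. n \<le> K \<Longrightarrow> \<bar>2 ^ n * d\<eta> n x\<bar> \<le> B"
    using d\<eta>_bounded by blast
  define C' where "C' = 2 * ((2 * real W + 1) * (C * B))"
  show ?thesis
  proof (intro exI[of _ C'] conjI allI impI)
    show "0 \<le> C'" using C B by (simp add: C'_def)
    fix n x \<epsilon> and f :: "int \<Rightarrow> real" and I J :: "int set"
    assume n: "n \<le> K" and \<epsilon>: "0 \<le> \<epsilon>" and fin: "finite I" "finite J"
      and I: "window (2 * x) \<subseteq> I" and J: "window x \<subseteq> J"
      and f: "\<forall>m. \<bar>2 * x - of_int m\<bar> \<le> 2 * real W + 1 \<longrightarrow> \<bar>binom_diff D (\<lambda>r. f (m + int r))\<bar> \<le> \<epsilon>"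
    define i0 where "i0 = \<lfloor>2 * x\<rfloor> - 2 * int W"
    have fl: "of_int \<lfloor>2 * x\<rfloor> \<le> 2 * x" "2 * x < of_int \<lfloor>2 * x\<rfloor> + 1" by linarith+
    have "\<forall>m. i0 \<le> m \<and> m + int D \<le> i0 + int N \<longrightarrow> \<bar>binom_diff D (\<lambda>r. f (m + int r))\<bar> \<le> \<epsilon>"
    proof (intro allI impI)
      fix m assume m: "i0 \<le> m \<and> m + int D \<le> i0 + int N"
      then have "\<lfloor>2 * x\<rfloor> - 2 * int W \<le> m" "m \<le> \<lfloor>2 * x\<rfloor> + 2 * int W + 1" by (auto simp: i0_def N_def)
      then have "real_of_int (\<lfloor>2 * x\<rfloor> - 2 * int W) \<le> of_int m" "real_of_int m \<le> of_int (\<lfloor>2 * x\<rfloor> + 2 * int W + 1)"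
        unfolding of_int_le_iff by auto
      then have "of_int \<lfloor>2 * x\<rfloor> - 2 * real W \<le> of_int m" "of_int m \<le> of_int \<lfloor>2 * x\<rfloor> + 2 * real W + 1" by simp_all
      then have "\<bar>2 * x - of_int m\<bar> \<le> 2 * real W + 1" using fl by linarith
      then show "\<bar>binom_diff D (\<lambda>r. f (m + int r))\<bar> \<le> \<epsilon>" using f by blast
    qed
    from newton[OF \<epsilon> this] obtain p where p: "degree p < D"
      and fp: "\<And>i. i0 \<le> i \<and> i \<le> i0 + int N \<Longrightarrow> \<bar>f i - poly p (of_int i)\<bar> \<le> C * \<epsilon>" by blast
    have near: "\<bar>f i - poly p (of_int i)\<bar> \<le> C * \<epsilon>" if "\<bar>2 * x - of_int i\<bar> \<le> 2 * real W" for i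
    proof (rule fp)
      have "real_of_int (\<lfloor>2 * x\<rfloor> - 2 * int W) \<le> of_int i" "real_of_int i < of_int (\<lfloor>2 * x\<rfloor> + 2 * int W + 1)"
      proof -
        have "of_int \<lfloor>2 * x\<rfloor> - 2 * real W \<le> of_int i" "of_int i < of_int \<lfloor>2 * x\<rfloor> + 2 * real W + 1"
          using that fl by linarith+
        then show "real_of_int (\<lfloor>2 * x\<rfloor> - 2 * int W) \<le> of_int i" "real_of_int i < of_int (\<lfloor>2 * x\<rfloor> + 2 * int W + 1)"
          by simp_all
      qed
      then show "i0 \<le> i \<and> i \<le> i0 + int N" unfolding of_int_le_iff of_int_less_iff by (auto simp: i0_def N_def)
    qed
    let ?S = "\<lambda>f. (\<Sum>i\<in>I. f i * (2 ^ n * d\<eta> n (2 * x - of_int i))) - (\<Sum>i\<in>J. f (2 * i) * d\<eta> n (x - of_int i))"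
    have "?S (\<lambda>i. poly p (of_int i)) = 0"
    proof -
      have "(\<Sum>i\<in>I. poly p (of_int i) * (2 ^ n * d\<eta> n (2 * x - of_int i))) = 2 ^ n * poly ((pderiv ^^ n) p) (2 * x)"
        unfolding d\<eta>_reproduces[OF p n fin(1) I, symmetric] by (simp add: sum_distrib_left mult_ac)
      moreover have "(\<Sum>i\<in>J. poly p (of_int (2 * i)) * d\<eta> n (x - of_int i)) = 2 ^ n * poly ((pderiv ^^ n) p) (2 * x)"
      proof -
        have "degree (pcompose p [:0, 2:]) < D" using p by (simp add: degree_pcompose)
        from d\<eta>_reproduces[OF this n fin(2) J]
        show ?thesis by (simp add: poly_pcompose pderiv_funpow_pcompose_affine mult.commute)
      qed
      ultimately show ?thesis by simp
    qed
    then have "?S f = ?S (\<lambda>i. f i - poly p (of_int i))"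
      by (simp add: left_diff_distrib sum_subtractf)
    also have "\<bar>\<dots>\<bar> \<le> (2 * real W + 1) * ((C * \<epsilon>) * B) + (2 * real W + 1) * ((C * \<epsilon>) * B)"
    proof (rule order_trans[OF abs_triangle_ineq4 add_mono])
      show "\<bar>\<Sum>i\<in>I. (f i - poly p (of_int i)) * (2 ^ n * d\<eta> n (2 * x - of_int i))\<bar> \<le> (2 * real W + 1) * ((C * \<epsilon>) * B)"
      proof (rule kernel_sum_bound[where \<phi> = "\<lambda>y. 2 ^ n * d\<eta> n y", OF _ B(3)[OF n] fin(1)])
        show "2 ^ n * d\<eta> n y = 0" if "\<bar>y\<bar> > real W" for y using d\<eta>_supp[OF that] by simp
        show "0 \<le> C * \<epsilon>" using C \<epsilon> by simp
        fix i assume "\<bar>2 * x - of_int i\<bar> \<le> real W"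
        then show "\<bar>f i - poly p (of_int i)\<bar> \<le> C * \<epsilon>" by (intro near) simp
      qed
      show "\<bar>\<Sum>i\<in>J. (f (2 * i) - poly p (of_int (2 * i))) * d\<eta> n (x - of_int i)\<bar> \<le> (2 * real W + 1) * ((C * \<epsilon>) * B)"
      proof (rule kernel_sum_bound[where \<phi> = "d\<eta> n", OF d\<eta>_supp B(2)[OF n] fin(2)])
        show "0 \<le> C * \<epsilon>" using C \<epsilon> by simp
        fix i assume "\<bar>x - of_int i\<bar> \<le> real W"
        then have "\<bar>2 * x - of_int (2 * i)\<bar> \<le> 2 * real W" by (simp add: abs_le_iff)
        then show "\<bar>f (2 * i) - poly p (of_int (2 * i))\<bar> \<le> C * \<epsilon>" by (rule near)
      qed
    qed
    also have "\<dots> = C' * \<epsilon>" by (simp add: C'_def)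
    finally show "\<bar>?S f\<bar> \<le> C' * \<epsilon>" .
  qed
qed

abbreviation refines_2d :: "real \<Rightarrow> bool" where
  "refines_2d C \<equiv> \<forall>m\<le>K. \<forall>n\<le>K. \<forall>x y G \<epsilon> I J. 0 \<le> \<epsilon> \<longrightarrow> finite I \<longrightarrow> finite J \<longrightarrow>
    window (2 * x) \<subseteq> I \<longrightarrow> window x \<subseteq> J \<longrightarrow>
    window (2 * y) \<subseteq> I \<longrightarrow> window y \<subseteq> J \<longrightarrow>
    (\<forall>i j. \<bar>2 * x - of_int i\<bar> \<le> 2 * real W + 1 \<longrightarrow> \<bar>2 * y - of_int j\<bar> \<le> 2 * real W + 1 \<longrightarrow>
      \<bar>binom_diff D (\<lambda>r. G (i + int r) j)\<bar> \<le> \<epsilon> \<and> \<bar>binom_diff D (\<lambda>r. G i (j + int r))\<bar> \<le> \<epsilon>) \<longrightarrow>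
    \<bar>(\<Sum>i\<in>I. \<Sum>j\<in>I. G i j * ((2 ^ m * d\<eta> m (2 * x - of_int i)) * (2 ^ n * d\<eta> n (2 * y - of_int j))))
      - (\<Sum>i\<in>J. \<Sum>j\<in>J. G (2 * i) (2 * j) * (d\<eta> m (x - of_int i) * d\<eta> n (y - of_int j)))\<bar> \<le> C * \<epsilon>"

text \<open>Writing \<open>Q\<close> for the interpolation operators of the two meshes in one variable, the tensor products differ by
  \<open>(Q\<^sub>1\<^sub>/\<^sub>2 - Q\<^sub>1) \<otimes> Q\<^sub>1\<^sub>/\<^sub>2 + Q\<^sub>1 \<otimes> (Q\<^sub>1\<^sub>/\<^sub>2 - Q\<^sub>1)\<close>, so the estimate in one variable applies twice.\<close>

lemma refinement_estimate_2d:
  "\<exists>C\<ge>0. refines_2d C"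
proof -
  obtain C where C: "C \<ge> 0" and est: "refines_1d C"
    using refinement_estimate_1d by blast
  obtain B where B: "B > 0" "\<And>n x. n \<le> K \<Longrightarrow> \<bar>d\<eta> n x\<bar> \<le> B" "\<And>n x. n \<le> K \<Longrightarrow> \<bar>2 ^ n * d\<eta> n x\<bar> \<le> B"
    using d\<eta>_bounded by blast
  define C' where "C' = 2 * ((2 * real W + 1) * (C * B))"
  show ?thesis
  proof (intro exI[of _ C'] conjI allI impI)
    show "0 \<le> C'" using C B by (simp add: C'_def)
    fix m n x y \<epsilon> and G :: "int \<Rightarrow> int \<Rightarrow> real" and I J :: "int set"
    assume mn: "m \<le> K" "n \<le> K" and \<epsilon>: "0 \<le> \<epsilon>" and fin: "finite I" "finite J"
      and I: "window (2 * x) \<subseteq> I" and J: "window x \<subseteq> J"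
      and I': "window (2 * y) \<subseteq> I" and J': "window y \<subseteq> J"
      and G: "\<forall>i j. \<bar>2 * x - of_int i\<bar> \<le> 2 * real W + 1 \<longrightarrow> \<bar>2 * y - of_int j\<bar> \<le> 2 * real W + 1 \<longrightarrow>
      \<bar>binom_diff D (\<lambda>r. G (i + int r) j)\<bar> \<le> \<epsilon> \<and> \<bar>binom_diff D (\<lambda>r. G i (j + int r))\<bar> \<le> \<epsilon>"
    define E1 where "E1 j = (\<Sum>i\<in>I. G i j * (2 ^ m * d\<eta> m (2 * x - of_int i))) - (\<Sum>i\<in>J. G (2 * i) j * d\<eta> m (x - of_int i))" for j
    define E2 where "E2 i = (\<Sum>j\<in>I. G (2 * i) j * (2 ^ n * d\<eta> n (2 * y - of_int j))) - (\<Sum>j\<in>J. G (2 * i) (2 * j) * d\<eta> n (y - of_int j))" for i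
    have 1: "\<bar>\<Sum>j\<in>I. E1 j * (2 ^ n * d\<eta> n (2 * y - of_int j))\<bar> \<le> (2 * real W + 1) * ((C * \<epsilon>) * B)"
    proof (rule kernel_sum_bound[where \<phi> = "\<lambda>y. 2 ^ n * d\<eta> n y", OF _ B(3)[OF mn(2)] fin(1)])
      show "2 ^ n * d\<eta> n y = 0" if "\<bar>y\<bar> > real W" for y using d\<eta>_supp[OF that] by simp
      show "0 \<le> C * \<epsilon>" using C \<epsilon> by simp
      fix j assume "\<bar>2 * y - of_int j\<bar> \<le> real W"
      then show "\<bar>E1 j\<bar> \<le> C * \<epsilon>"
        unfolding E1_def using G
        by (intro est[rule_format, of m \<epsilon> I J x "\<lambda>i. G i j", OF mn(1) \<epsilon> fin I J]) auto
    qed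
    have 2: "\<bar>\<Sum>i\<in>J. E2 i * d\<eta> m (x - of_int i)\<bar> \<le> (2 * real W + 1) * ((C * \<epsilon>) * B)"
    proof (rule kernel_sum_bound[where \<phi> = "d\<eta> m", OF d\<eta>_supp B(2)[OF mn(1)] fin(2)])
      show "0 \<le> C * \<epsilon>" using C \<epsilon> by simp
      fix i assume "\<bar>x - of_int i\<bar> \<le> real W"
      then have "\<bar>2 * x - of_int (2 * i)\<bar> \<le> 2 * real W + 1" by (simp add: abs_le_iff)
      then show "\<bar>E2 i\<bar> \<le> C * \<epsilon>"
        unfolding E2_def using G
        by (intro est[rule_format, of n \<epsilon> I J y "\<lambda>j. G (2 * i) j", OF mn(2) \<epsilon> fin I' J']) auto
    qed
    have "(\<Sum>i\<in>I. \<Sum>j\<in>I. G i j * ((2 ^ m * d\<eta> m (2 * x - of_int i)) * (2 ^ n * d\<eta> n (2 * y - of_int j))))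
      = (\<Sum>j\<in>I. (\<Sum>i\<in>I. G i j * (2 ^ m * d\<eta> m (2 * x - of_int i))) * (2 ^ n * d\<eta> n (2 * y - of_int j)))"
      unfolding sum_distrib_right by (subst sum.swap) (simp only: mult.assoc)
    moreover have "(\<Sum>i\<in>J. (\<Sum>j\<in>I. G (2 * i) j * (2 ^ n * d\<eta> n (2 * y - of_int j))) * d\<eta> m (x - of_int i))
      = (\<Sum>j\<in>I. (\<Sum>i\<in>J. G (2 * i) j * d\<eta> m (x - of_int i)) * (2 ^ n * d\<eta> n (2 * y - of_int j)))"
      unfolding sum_distrib_right by (subst sum.swap) (simp only: mult_ac)
    moreover have "(\<Sum>i\<in>J. \<Sum>j\<in>J. G (2 * i) (2 * j) * (d\<eta> m (x - of_int i) * d\<eta> n (y - of_int j)))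
      = (\<Sum>i\<in>J. (\<Sum>j\<in>J. G (2 * i) (2 * j) * d\<eta> n (y - of_int j)) * d\<eta> m (x - of_int i))"
      unfolding sum_distrib_right by (simp only: mult_ac)
    ultimately have "(\<Sum>i\<in>I. \<Sum>j\<in>I. G i j * ((2 ^ m * d\<eta> m (2 * x - of_int i)) * (2 ^ n * d\<eta> n (2 * y - of_int j))))
      - (\<Sum>i\<in>J. \<Sum>j\<in>J. G (2 * i) (2 * j) * (d\<eta> m (x - of_int i) * d\<eta> n (y - of_int j)))
      = (\<Sum>j\<in>I. E1 j * (2 ^ n * d\<eta> n (2 * y - of_int j))) + (\<Sum>i\<in>J. E2 i * d\<eta> m (x - of_int i))" (is "?L = _")
      by (simp add: E1_def E2_def left_diff_distrib sum_subtractf)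
    moreover have "(2 * real W + 1) * ((C * \<epsilon>) * B) + (2 * real W + 1) * ((C * \<epsilon>) * B) = C' * \<epsilon>"
      by (simp add: C'_def)
    ultimately show "\<bar>?L\<bar> \<le> C' * \<epsilon>"
      using 1 2 by linarith
  qed
qed

end

section \<open>Limits of smooth functions with geometrically small increments\<close>

lemma geometric_increments_limit:
  fixes a :: "nat \<Rightarrow> real"
  assumes x: "0 \<le> x" "x < 1" and a: "\<And>n. n \<ge> n0 \<Longrightarrow> \<bar>a (Suc n) - a n\<bar> \<le> C * x ^ n"
  shows "a \<longlonglongrightarrow> lim a" and "n \<ge> n0 \<Longrightarrow> \<bar>lim a - a n\<bar> \<le> C * x ^ n / (1 - x)"
proof -
  have geo: "(\<lambda>i. C * x ^ (i + n)) sums (C * x ^ n / (1 - x))" for n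
    using sums_mult[OF geometric_sums[of x], of "C * x ^ n"] x by (simp add: power_add mult_ac)
  have sm: "summable (\<lambda>i. a (Suc i + n) - a (i + n))" if "n \<ge> n0" for n
  proof (rule summable_comparison_test'[OF sums_summable[OF geo[of n]]])
    fix i show "norm (a (Suc i + n) - a (i + n)) \<le> C * x ^ (i + n)"
      using a[of "i + n"] that by simp
  qed
  have "convergent (\<lambda>i. a (i + n0))"
  proof -
    have "convergent (\<lambda>m. \<Sum>i<m. a (Suc i + n0) - a (i + n0))"
      using sm[of n0] by (simp add: summable_iff_convergent)
    then have "convergent (\<lambda>m. a (m + n0) - a n0)"
      using sum_lessThan_telescope[of "\<lambda>i. a (i + n0)"] by simp
    then show ?thesis using convergent_add[OF _ convergent_const[of "a n0"]] by fastforce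
  qed
  then show lim: "a \<longlonglongrightarrow> lim a"
    using convergent_LIMSEQ_iff LIMSEQ_offset[of a n0] by (metis convergentI convergent_def)
  assume n: "n \<ge> n0"
  have "(\<lambda>i. a (i + n)) \<longlonglongrightarrow> lim a" using lim by (rule LIMSEQ_ignore_initial_segment)
  then have sums: "(\<lambda>i. a (Suc i + n) - a (i + n)) sums (lim a - a n)"
    using telescope_sums[of "\<lambda>i. a (i + n)"] by simp
  have "\<bar>lim a - a n\<bar> \<le> (\<Sum>i. \<bar>a (Suc i + n) - a (i + n)\<bar>)"
  proof -
    have "summable (\<lambda>i. \<bar>a (Suc i + n) - a (i + n)\<bar>)"
    proof (rule summable_comparison_test'[OF sums_summable[OF geo[of n]]])
      fix i show "norm \<bar>a (Suc i + n) - a (i + n)\<bar> \<le> C * x ^ (i + n)"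
        using a[of "i + n"] n by simp
    qed
    from summable_rabs[OF this] show ?thesis using sums by (simp add: sums_iff)
  qed
  also have "\<dots> \<le> (\<Sum>i. C * x ^ (i + n))"
  proof (rule suminf_le)
    fix i show "\<bar>a (Suc i + n) - a (i + n)\<bar> \<le> C * x ^ (i + n)" using a[of "i + n"] n by simp
  next
    show "summable (\<lambda>i. C * x ^ (i + n))" using geo by (rule sums_summable)
    show "summable (\<lambda>i. \<bar>a (Suc i + n) - a (i + n)\<bar>)"
    proof (rule summable_comparison_test'[OF sums_summable[OF geo[of n]]])
      fix i show "norm \<bar>a (Suc i + n) - a (i + n)\<bar> \<le> C * x ^ (i + n)"
        using a[of "i + n"] n by simp
    qed
  qed
  also have "\<dots> = C * x ^ n / (1 - x)" using geo by (rule sums_unique[symmetric])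
  finally show "\<bar>lim a - a n\<bar> \<le> C * x ^ n / (1 - x)" .
qed

abbreviation total_deriv :: "('n::finite \<Rightarrow> real) \<Rightarrow> real ^ 'n \<Rightarrow> real"
  where "total_deriv c h \<equiv> \<Sum>i\<in>UNIV. h $ i * c i"

lemma abs_total_deriv_le:
  fixes h :: "real ^ 'n::finite"
  assumes "\<And>i. \<bar>c i\<bar> \<le> B"
  shows "\<bar>total_deriv c h\<bar> \<le> real CARD('n) * B * norm h"
proof -
  have "\<bar>total_deriv c h\<bar> \<le> (\<Sum>i\<in>(UNIV :: 'n set). norm h * B)"
    using assms component_le_norm_cart[of h]
    by (intro order_trans[OF sum_abs] sum_mono) (auto simp: abs_mult intro!: mult_mono)
  then show ?thesis by (simp add: mult_ac)
qed

lemma lipschitz_on_ball_if_partials_bounded: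
  fixes f :: "real ^ 'n::finite \<Rightarrow> real"
  assumes "\<And>u. (f has_derivative total_deriv (f' u)) (at u)"
    and "\<And>u i. norm u \<le> R \<Longrightarrow> \<bar>f' u i\<bar> \<le> B" and "norm u \<le> R" "norm v \<le> R"
  shows "\<bar>f u - f v\<bar> \<le> real CARD('n) * B * dist u v"
proof -
  have "norm (f u - f v) \<le> (real CARD('n) * B) * norm (u - v)"
  proof (rule differentiable_bound[of "cball 0 R"])
    fix w :: "real ^ 'n" assume w: "w \<in> cball 0 R"
    show "(f has_derivative total_deriv (f' w)) (at w within cball 0 R)"
      using assms(1) by (rule has_derivative_at_withinI)
    show "onorm (total_deriv (f' w)) \<le> real CARD('n) * B"
      using abs_total_deriv_le[of "f' w" B] assms(2)[of w] w by (intro onorm_le) auto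
  qed (use assms in auto)
  then show ?thesis by (simp add: dist_norm)
qed

lemma self_le_powr:
  assumes "0 \<le> t" "t \<le> 1" "0 \<le> \<alpha>" "\<alpha> \<le> (1::real)"
  shows "t \<le> t powr \<alpha>"
proof (cases "t = 0")
  case False
  then show ?thesis using powr_mono'[of \<alpha> 1 t] assms by simp
qed simp

lemma two_powr_nat_times: "2 powr (real n * x) = (2 powr x) ^ n"
  by (simp add: powr_powr[symmetric] powr_realpow mult.commute)

text \<open>One condition covers all Hoelder classes of order below \<open>b\<close>, including those of lower derivatives.\<close>

definition regular_upto :: "nat \<Rightarrow> real \<Rightarrow> (real ^ 'n::finite \<Rightarrow> real) \<Rightarrow> bool"
  where "regular_upto k b f \<longleftrightarrow> k_times_cont_diff k f \<and>
    (\<forall>js \<alpha>. 0 \<le> \<alpha> \<longrightarrow> \<alpha> \<le> 1 \<longrightarrow> length js \<le> k \<longrightarrow> real (length js) + \<alpha> < b \<longrightarrow>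
      locally_hoelder \<alpha> (iter_partial_deriv js f))"

text \<open>\<open>F n js\<close> stands for the partial derivative \<open>js\<close> of the \<open>n\<close>-th approximation. The increments of
  the derivatives of order at most \<open>k < b\<close> are summable, whereas those of order \<open>k + 1\<close> may grow; the latter
  serve only to estimate moduli of continuity.\<close>

locale smooth_approximation =
  fixes F :: "nat \<Rightarrow> 'n::finite list \<Rightarrow> real ^ 'n \<Rightarrow> real" and b :: real and k :: nat
  assumes der: "\<And>n js u. length js \<le> k \<Longrightarrow> (F n js has_derivative total_deriv (\<lambda>i. F n (i # js) u)) (at u)"
    and cont: "\<And>n js. length js \<le> Suc k \<Longrightarrow> continuous_on UNIV (F n js)"
    and est: "\<And>R \<gamma>. \<gamma> < b \<Longrightarrow> \<exists>C n0. \<forall>n\<ge>n0. \<forall>js u. length js \<le> Suc k \<longrightarrow> norm u \<le> R \<longrightarrow>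
        \<bar>F (Suc n) js u - F n js u\<bar> \<le> C * 2 powr (real n * (real (length js) - \<gamma>))"
    and kb: "real k < b"
begin

definition lim_F :: "'n list \<Rightarrow> real ^ 'n \<Rightarrow> real"
  where "lim_F js u = lim (\<lambda>n. F n js u)"

lemma geometric_convergence:
  assumes js: "length js \<le> k"
  shows "\<exists>C x n0. 0 \<le> x \<and> x < 1 \<and> (\<forall>n\<ge>n0. \<forall>u. norm u \<le> R \<longrightarrow>
      (\<lambda>n. F n js u) \<longlonglongrightarrow> lim_F js u \<and> \<bar>lim_F js u - F n js u\<bar> \<le> C * x ^ n)"
proof -
  define \<gamma> where "\<gamma> = (real k + b) / 2"
  have \<gamma>: "real k < \<gamma>" "\<gamma> < b" using kb by (auto simp: \<gamma>_def)
  obtain C n0 where C: "\<And>n u. n \<ge> n0 \<Longrightarrow> norm u \<le> R \<Longrightarrow>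
      \<bar>F (Suc n) js u - F n js u\<bar> \<le> C * 2 powr (real n * (real (length js) - \<gamma>))"
    using est[OF \<gamma>(2), of R] js by (metis le_SucI)
  define x where "x = 2 powr (real (length js) - \<gamma>)"
  have x: "0 \<le> x" "x < 1" using \<gamma> js by (auto simp: x_def powr_less_one)
  have inc: "\<bar>F (Suc n) js u - F n js u\<bar> \<le> C * x ^ n" if "n \<ge> n0" "norm u \<le> R" for n u
    using C[OF that] by (simp add: x_def two_powr_nat_times)
  have "(\<lambda>n. F n js u) \<longlonglongrightarrow> lim_F js u \<and> \<bar>lim_F js u - F n js u\<bar> \<le> (C / (1 - x)) * x ^ n"
    if "n \<ge> n0" "norm u \<le> R" for n u
    using geometric_increments_limit[of x n0 "\<lambda>n. F n js u" C] x inc that by (simp add: lim_F_def)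
  then show ?thesis using x by blast
qed

lemma tendsto_lim_F: "length js \<le> k \<Longrightarrow> (\<lambda>n. F n js u) \<longlonglongrightarrow> lim_F js u"
  using geometric_convergence[of js "norm u"] by blast

lemma uniform_convergence:
  assumes js: "length js \<le> k" and e: "e > 0"
  shows "\<exists>N. \<forall>n\<ge>N. \<forall>u. norm u \<le> R \<longrightarrow> \<bar>lim_F js u - F n js u\<bar> \<le> e"
proof -
  obtain C x n0 where x: "0 \<le> x" "x < 1" and C: "\<And>n u. n \<ge> n0 \<Longrightarrow> norm u \<le> R \<Longrightarrow> \<bar>lim_F js u - F n js u\<bar> \<le> C * x ^ n"
    using geometric_convergence[OF js, of R] by blast
  have "(\<lambda>n. C * x ^ n) \<longlonglongrightarrow> C * 0"
    using x by (intro tendsto_mult tendsto_const LIMSEQ_power_zero) auto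
  then have "\<forall>\<^sub>F n in sequentially. C * x ^ n < e" using e by (simp add: order_tendstoD)
  then obtain N where "\<And>n. n \<ge> N \<Longrightarrow> C * x ^ n < e" by (auto simp: eventually_sequentially)
  then show ?thesis using C by (intro exI[of _ "max N n0"]) force
qed

lemma continuous_on_lim_F:
  assumes js: "length js \<le> k"
  shows "continuous_on UNIV (lim_F js)"
proof -
  have "continuous_on (ball 0 R) (lim_F js)" for R
  proof (rule uniform_limit_theorem[where F = sequentially])
    show "\<forall>\<^sub>F n in sequentially. continuous_on (ball 0 R) (F n js)"
      using cont[of js] js by (intro always_eventually allI) (auto intro: continuous_on_subset)
    show "uniform_limit (ball 0 R) (\<lambda>n. F n js) (lim_F js) sequentially"
      unfolding uniform_limit_sequentially_iff
    proof (intro allI impI)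
      fix e :: real assume "e > 0"
      then obtain N where N: "\<And>n u. n \<ge> N \<Longrightarrow> norm u \<le> R \<Longrightarrow> \<bar>lim_F js u - F n js u\<bar> \<le> e / 2"
        using uniform_convergence[OF js, of "e / 2" R] by auto
      have "dist (F n js u) (lim_F js u) < e" if "n \<ge> N" "u \<in> ball 0 R" for n u
        using N[of n u] that \<open>e > 0\<close> by (simp add: dist_real_def abs_minus_commute)
      then show "\<exists>N. \<forall>n\<ge>N. \<forall>u\<in>ball 0 R. dist (F n js u) (lim_F js u) < e" by blast
    qed
  qed simp
  then have "isCont (lim_F js) u" for u
    using continuous_on_eq_continuous_at[OF open_ball, of 0 "norm u + 1" "lim_F js"] by simp
  then show ?thesis by (simp add: continuous_at_imp_continuous_on)
qed

lemma lim_F_has_derivative: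
  assumes js: "length js < k"
  shows "(lim_F js has_derivative total_deriv (\<lambda>i. lim_F (i # js) u)) (at u)"
proof -
  define R where "R = norm u + 1"
  have u: "u \<in> ball 0 R" by (simp add: R_def)
  have "\<exists>G. \<forall>v\<in>ball 0 R. (\<lambda>n. F n js v) \<longlonglongrightarrow> G v \<and>
      (G has_derivative total_deriv (\<lambda>i. lim_F (i # js) v)) (at v within ball 0 R)"
  proof (rule has_derivative_sequence[where f' = "\<lambda>n v. total_deriv (\<lambda>i. F n (i # js) v)"])
    show "(F n js has_derivative total_deriv (\<lambda>i. F n (i # js) v)) (at v within ball 0 R)" for n v
      using der[of js n v] js by (simp add: has_derivative_at_withinI)
    show "(\<lambda>n. F n js u) \<longlonglongrightarrow> lim_F js u" using tendsto_lim_F js by simp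
    show "u \<in> ball 0 R" by (rule u)
    fix e :: real assume "e > 0"
    define e' where "e' = e / real CARD('n)"
    have "e' > 0" using \<open>e > 0\<close> by (simp add: e'_def)
    have "\<exists>N. \<forall>n\<ge>N. \<forall>u. norm u \<le> R \<longrightarrow> \<bar>lim_F (i # js) u - F n (i # js) u\<bar> \<le> e'" for i
      using uniform_convergence[of "i # js" e' R] js \<open>e' > 0\<close> by simp
    then obtain N where N: "\<And>i n v. n \<ge> N i \<Longrightarrow> norm v \<le> R \<Longrightarrow> \<bar>lim_F (i # js) v - F n (i # js) v\<bar> \<le> e'"
      by metis
    show "\<forall>\<^sub>F n in sequentially. \<forall>v\<in>ball 0 R. \<forall>h.
        norm (total_deriv (\<lambda>i. F n (i # js) v) h - total_deriv (\<lambda>i. lim_F (i # js) v) h) \<le> e * norm h"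
      unfolding eventually_sequentially
    proof (intro exI[of _ "Max (range N)"] allI impI ballI)
      fix n and v h :: "real ^ 'n" assume n: "Max (range N) \<le> n" and v: "v \<in> ball 0 R"
      have "n \<ge> N i" for i using order_trans[OF Max_ge n] by simp
      then have "\<bar>F n (i # js) v - lim_F (i # js) v\<bar> \<le> e'" for i
        using N[of i n v] v by (simp add: abs_minus_commute)
      from abs_total_deriv_le[OF this, of h]
      have "\<bar>total_deriv (\<lambda>i. F n (i # js) v - lim_F (i # js) v) h\<bar> \<le> e * norm h"
        by (simp add: e'_def)
      then show "norm (total_deriv (\<lambda>i. F n (i # js) v) h - total_deriv (\<lambda>i. lim_F (i # js) v) h) \<le> e * norm h"
        by (simp add: right_diff_distrib sum_subtractf)
    qed
  qed simp
  then obtain G where G: "\<And>v. v \<in> ball 0 R \<Longrightarrow> (\<lambda>n. F n js v) \<longlonglongrightarrow> G v"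
    "(G has_derivative total_deriv (\<lambda>i. lim_F (i # js) u)) (at u within ball 0 R)" using u by blast
  have "G v = lim_F js v" if "v \<in> ball 0 R" for v
    using LIMSEQ_unique[OF G(1)[OF that] tendsto_lim_F] js by simp
  then have "(lim_F js has_derivative total_deriv (\<lambda>i. lim_F (i # js) u)) (at u within ball 0 R)"
    using has_derivative_transform[OF u _ G(2), of "lim_F js"] by simp
  then show ?thesis using at_within_open[OF u] by simp
qed

lemma iter_partial_deriv_lim_F:
  assumes "length js \<le> k"
  shows "iter_partial_deriv js (lim_F []) = lim_F js"
  using assms
proof (induction js)
  case (Cons i js)
  then have IH: "iter_partial_deriv js (lim_F []) = lim_F js" by simp
  have "partial_deriv i (lim_F js) u = lim_F (i # js) u" for u
  proof -
    have "frechet_derivative (lim_F js) (at u) = total_deriv (\<lambda>i. lim_F (i # js) u)"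
      using lim_F_has_derivative[of js u] Cons.prems by (intro frechet_derivative_at[symmetric]) simp
    then show ?thesis
      by (simp add: partial_deriv_def axis_def if_distrib[of "\<lambda>x. x * _"] cong: if_cong)
  qed
  then show ?case using IH by (auto simp: iter_partial_deriv_def)
qed (simp add: iter_partial_deriv_def)

text \<open>With \<open>j = length js\<close> and \<open>\<delta> = dist u v\<close>, an increment varies between \<open>u\<close> and \<open>v\<close> by at most
  \<open>2^(n (j - \<gamma>)) min 1 (2^n \<delta>)\<close>, up to a constant, by the bounds for the orders \<open>j\<close> and \<open>j + 1\<close>. Since
  \<open>min 1 t \<le> t powr \<alpha>\<close>, this is at most \<open>2^(n (j + \<alpha> - \<gamma>)) \<delta> powr \<alpha>\<close>, which is summable over \<open>n\<close> as
  soon as \<open>\<gamma> > j + \<alpha>\<close>.\<close>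

lemma hoelder_lim_F:
  assumes \<alpha>: "0 \<le> \<alpha>" "\<alpha> \<le> 1" and js: "length js \<le> k" and b: "real (length js) + \<alpha> < b"
  shows "locally_hoelder \<alpha> (lim_F js)"
  unfolding locally_hoelder_def
proof (intro allI impI)
  fix S :: "(real ^ 'n) set" assume "compact S"
  then obtain R0 where R0: "\<And>u. u \<in> S \<Longrightarrow> norm u \<le> R0"
    using compact_imp_bounded[OF \<open>compact S\<close>] unfolding bounded_iff by blast
  define R where "R = max 1 R0"
  have R: "R \<ge> 1" "\<And>u. u \<in> S \<Longrightarrow> norm u \<le> R" using R0 by (auto simp: R_def le_max_iff_disj)
  define \<gamma> where "\<gamma> = (real (length js) + \<alpha> + b) / 2"
  have \<gamma>: "real (length js) + \<alpha> < \<gamma>" "\<gamma> < b" using b by (auto simp: \<gamma>_def)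
  obtain C1 n0 where C1: "\<And>n js u. n \<ge> n0 \<Longrightarrow> length js \<le> Suc k \<Longrightarrow> norm u \<le> R \<Longrightarrow>
      \<bar>F (Suc n) js u - F n js u\<bar> \<le> C1 * 2 powr (real n * (real (length js) - \<gamma>))"
    using est[OF \<gamma>(2), of R] by blast
  define C0 where "C0 = max 0 C1"
  have "C0 \<ge> 0" by (simp add: C0_def)
  have C0: "\<bar>F (Suc n) js u - F n js u\<bar> \<le> C0 * 2 powr (real n * (real (length js) - \<gamma>))"
    if "n \<ge> n0" "length js \<le> Suc k" "norm u \<le> R" for n js u
    by (rule order_trans[OF C1[OF that] mult_right_mono]) (auto simp: C0_def)
  define C where "C = 2 * real CARD('n) * C0"
  have "C \<ge> 0" using \<open>C0 \<ge> 0\<close> by (simp add: C_def)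
  have CN: "1 \<le> real CARD('n)" by (simp add: Suc_leI)
  define x where "x = 2 powr (real (length js) + \<alpha> - \<gamma>)"
  have x: "0 \<le> x" "x < 1" using \<gamma> by (auto simp: x_def powr_less_one)
  have step: "\<bar>(F (Suc n) js u - F (Suc n) js v) - (F n js u - F n js v)\<bar> \<le> (C * dist u v powr \<alpha>) * x ^ n"
    if n: "n \<ge> n0" and u: "norm u \<le> R" and v: "norm v \<le> R" for n u v
  proof -
    let ?d = "\<lambda>js u. F (Suc n) js u - F n js u"
    define P where "P = C0 * 2 powr (real n * (real (length js) - \<gamma>))"
    have "P \<ge> 0" using \<open>C0 \<ge> 0\<close> by (simp add: P_def)
    have b0: "\<bar>?d js w\<bar> \<le> P" if "norm w \<le> R" for w
      using C0[OF n, of js w] js that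
      by (simp add: P_def)
    have b1: "\<bar>?d (i # js) w\<bar> \<le> P * 2 ^ n" if "norm w \<le> R" for w i
    proof -
      have "real n * (real (length (i # js)) - \<gamma>) = real n * (real (length js) - \<gamma>) + real n"
        by (simp add: algebra_simps)
      then have "2 powr (real n * (real (length (i # js)) - \<gamma>)) = 2 powr (real n * (real (length js) - \<gamma>)) * 2 ^ n"
        by (simp add: powr_add powr_realpow)
      then show ?thesis
        using C0[OF n, of "i # js" w] js that
        by (simp add: P_def mult.assoc)
    qed
    have lip: "\<bar>?d js u - ?d js v\<bar> \<le> real CARD('n) * (P * 2 ^ n) * dist u v"
    proof (rule lipschitz_on_ball_if_partials_bounded[where f' = "\<lambda>u i. ?d (i # js) u", OF _ b1 u v])
      fix w
      have "((\<lambda>u. ?d js u) has_derivative (\<lambda>h. total_deriv (\<lambda>i. F (Suc n) (i # js) w) h - total_deriv (\<lambda>i. F n (i # js) w) h)) (at w)"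
        using js by (intro has_derivative_diff der) auto
      then show "((\<lambda>u. ?d js u) has_derivative total_deriv (\<lambda>i. ?d (i # js) w)) (at w)"
        by (simp add: right_diff_distrib sum_subtractf)
    qed auto
    let ?t = "2 ^ n * dist u v"
    have "\<bar>?d js u - ?d js v\<bar> \<le> 2 * real CARD('n) * P * ?t powr \<alpha>"
    proof (cases "?t \<le> 1")
      case True
      then have "?t \<le> ?t powr \<alpha>" using \<alpha> by (intro self_le_powr) auto
      then have "real CARD('n) * P * ?t \<le> 2 * real CARD('n) * P * ?t powr \<alpha>"
        using \<open>P \<ge> 0\<close> by (intro mult_mono) auto
      then show ?thesis using lip by (simp add: mult_ac)
    next
      case False
      then have "1 \<le> ?t powr \<alpha>" using \<alpha> by (intro ge_one_powr_ge_zero) auto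
      then have "2 * P * 1 \<le> 2 * real CARD('n) * P * ?t powr \<alpha>"
        using \<open>P \<ge> 0\<close> CN by (intro mult_mono) auto
      then show ?thesis using b0[OF u] b0[OF v] by linarith
    qed
    also have "?t powr \<alpha> = 2 powr (real n * \<alpha>) * dist u v powr \<alpha>"
      by (simp add: powr_mult powr_realpow[symmetric] powr_powr)
    also have "2 * real CARD('n) * P * (2 powr (real n * \<alpha>) * dist u v powr \<alpha>) = (C * dist u v powr \<alpha>) * x ^ n"
    proof -
      have "2 powr (real n * (real (length js) - \<gamma>)) * 2 powr (real n * \<alpha>) = x ^ n"
        unfolding x_def two_powr_nat_times[symmetric] powr_add[symmetric] by (simp add: algebra_simps)
      then show ?thesis by (simp add: P_def C_def mult_ac)
    qed
    finally show ?thesis by (simp add: algebra_simps)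
  qed
  have "\<exists>B. \<forall>i w. norm w \<le> R \<longrightarrow> \<bar>F n0 (i # js) w\<bar> \<le> B"
  proof -
    have "\<exists>B. \<forall>w. norm w \<le> R \<longrightarrow> \<bar>F n0 (i # js) w\<bar> \<le> B" for i
    proof -
      have "compact (F n0 (i # js) ` cball 0 R)"
        using cont[of "i # js" n0] js by (intro compact_continuous_image) (auto intro: continuous_on_subset)
      then obtain B where "\<forall>x\<in>cball 0 R. \<bar>F n0 (i # js) x\<bar> \<le> B"
        using compact_imp_bounded[OF \<open>compact (F n0 (i # js) ` cball 0 R)\<close>] unfolding bounded_iff by force
      then show ?thesis by (intro exI[of _ B]) simp
    qed
    then obtain B where B: "\<And>i w. norm w \<le> R \<Longrightarrow> \<bar>F n0 (i # js) w\<bar> \<le> B i" by metis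
    have "\<bar>F n0 (i # js) w\<bar> \<le> Max (range B)" if "norm w \<le> R" for i w
      using order_trans[OF B[OF that, of i] Max_ge[of "range B" "B i"]] by simp
    then show ?thesis by blast
  qed
  then obtain B where B: "\<And>i w. norm w \<le> R \<Longrightarrow> \<bar>F n0 (i # js) w\<bar> \<le> B" by blast
  define E where "E = real CARD('n) * max 0 B * (2 * R) + C * x ^ n0 / (1 - x)"
  show "\<exists>C. \<forall>u\<in>S. \<forall>v\<in>S. \<bar>lim_F js u - lim_F js v\<bar> \<le> C * dist u v powr \<alpha>"
  proof (intro exI[of _ E] ballI)
    fix u v assume "u \<in> S" "v \<in> S"
    then have u: "norm u \<le> R" and v: "norm v \<le> R" using R by auto
    define a where "a n = F n js u - F n js v" for n
    have "a \<longlonglongrightarrow> lim_F js u - lim_F js v" unfolding a_def by (intro tendsto_diff tendsto_lim_F js)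
    then have lim_a: "lim a = lim_F js u - lim_F js v" by (rule limI)
    have "\<bar>lim a - a n0\<bar> \<le> (C * dist u v powr \<alpha>) * x ^ n0 / (1 - x)"
      using step[OF _ u v] by (intro geometric_increments_limit(2)[OF x, of n0]) (auto simp: a_def)
    moreover have "\<bar>a n0\<bar> \<le> real CARD('n) * max 0 B * (2 * R) * dist u v powr \<alpha>"
    proof -
      have "\<bar>F n0 js u - F n0 js v\<bar> \<le> real CARD('n) * max 0 B * dist u v"
      proof (rule lipschitz_on_ball_if_partials_bounded[where f' = "\<lambda>u i. F n0 (i # js) u", OF der _ u v])
        show "\<bar>F n0 (i # js) w\<bar> \<le> max 0 B" if "norm w \<le> R" for w i using B[OF that, of i] by simp
      qed (rule js)
      also have "dist u v \<le> (2 * R) * dist u v powr \<alpha>"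
      proof (cases "dist u v \<le> 1")
        case True
        have "1 * dist u v \<le> (2 * R) * dist u v powr \<alpha>"
          using R True \<alpha> by (intro mult_mono self_le_powr) auto
        then show ?thesis by simp
      next
        case False
        then have "1 \<le> dist u v powr \<alpha>" using \<alpha> by (intro ge_one_powr_ge_zero) auto
        moreover have "dist u v \<le> 2 * R"
          using norm_triangle_ineq4[of u v] u v by (simp add: dist_norm)
        ultimately have "dist u v * 1 \<le> (2 * R) * dist u v powr \<alpha>"
          using R by (intro mult_mono) auto
        then show ?thesis by simp
      qed
      finally show ?thesis by (simp add: a_def mult_left_mono mult.assoc)
    qed
    ultimately have "\<bar>lim a\<bar> \<le> real CARD('n) * max 0 B * (2 * R) * dist u v powr \<alpha> + (C * dist u v powr \<alpha>) * x ^ n0 / (1 - x)"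
      by linarith
    then show "\<bar>lim_F js u - lim_F js v\<bar> \<le> E * dist u v powr \<alpha>"
      unfolding lim_a E_def distrib_right by (simp add: mult_ac)
  qed
qed

theorem smooth_limit:
  "\<exists>f. (\<forall>u. (\<lambda>n. F n [] u) \<longlonglongrightarrow> f u) \<and> regular_upto k b f"
proof (intro exI[of _ "lim_F []"] conjI allI tendsto_lim_F)
  have "k_times_cont_diff k (lim_F [])"
    unfolding k_times_cont_diff_def
    using iter_partial_deriv_lim_F continuous_on_lim_F lim_F_has_derivative by (auto simp: differentiable_def intro!: exI)
  then show "regular_upto k b (lim_F [])"
    using iter_partial_deriv_lim_F hoelder_lim_F by (simp add: regular_upto_def)
qed simp

end

section \<open>Quasi-interpolation on dyadic grids\<close>

lemma vec2_eq_iff: "(u :: real ^ 2) = v \<longleftrightarrow> u $ 1 = v $ 1 \<and> u $ 2 = v $ 2"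
  by (simp add: vec_eq_iff forall_2)

definition grid_point :: "nat \<Rightarrow> int \<Rightarrow> int \<Rightarrow> real ^ 2"
  where "grid_point n i j = vector [of_int i / 2 ^ n, of_int j / 2 ^ n]"

lemma norm_grid_point_le:
  assumes "\<bar>real_of_int i\<bar> \<le> R * 2 ^ n" "\<bar>real_of_int j\<bar> \<le> R * 2 ^ n"
  shows "norm (grid_point n i j) \<le> 2 * R"
proof -
  have "norm (grid_point n i j) \<le> (\<Sum>e\<in>UNIV. \<bar>grid_point n i j $ e\<bar>)" by (rule norm_le_l1_cart)
  also have "\<dots> = \<bar>real_of_int i\<bar> / 2 ^ n + \<bar>real_of_int j\<bar> / 2 ^ n"
    by (simp add: sum_2 grid_point_def)
  also have "\<dots> \<le> R + R" using assms by (intro add_mono) (simp_all add: pos_divide_le_eq)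
  finally show ?thesis by simp
qed

lemma grid_point_shift:
  "grid_point n (i + int r) j = grid_point n i j + (1 / 2 ^ n * real r) *\<^sub>R axis 1 1"
  "grid_point n i (j + int r) = grid_point n i j + (1 / 2 ^ n * real r) *\<^sub>R axis 2 1"
  by (simp_all add: vec2_eq_iff grid_point_def axis_def add_divide_distrib)

context reproducing_kernel
begin

text \<open>The quasi-interpolant of mesh \<open>2^(-n)\<close> for \<open>js = []\<close>, and its partial derivative \<open>js\<close> in general. The sum is
  cut off at the indices \<open>\<bar>i\<bar>, \<bar>j\<bar> \<le> 4^n\<close>, that is at points of size \<open>2^n\<close>: this makes it finite without
  affecting any bounded region for large \<open>n\<close>.\<close>

definition grid_sum :: "(real ^ 2 \<Rightarrow> real) \<Rightarrow> nat \<Rightarrow> 2 list \<Rightarrow> real ^ 2 \<Rightarrow> real"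
  where "grid_sum g n js u = (2 ^ n) ^ length js * (\<Sum>i=-(4^n)..4^n. \<Sum>j=-(4^n)..4^n.
    g (grid_point n i j) *
      (d\<eta> (count_list js 1) (2 ^ n * u $ 1 - of_int i) * d\<eta> (count_list js 2) (2 ^ n * u $ 2 - of_int j)))"

lemma length_eq_count_list_2: "length (js :: 2 list) = count_list js 1 + count_list js 2"
proof (induction js)
  case (Cons i js)
  then show ?case using exhaust_2[of i] by auto
qed simp

lemma continuous_grid_sum:
  assumes "length js \<le> K"
  shows "continuous_on UNIV (grid_sum g n js)"
proof -
  have c: "continuous_on UNIV (d\<eta> m)" if "m \<le> K" for m
    using smooth_upto_higher_deriv(2)[OF smooth that] .
  have le: "count_list js 1 \<le> K" "count_list js 2 \<le> K"
    using assms length_eq_count_list_2[of js] by auto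
  have c': "continuous_on UNIV (\<lambda>u :: real ^ 2. d\<eta> m (2 ^ n * u $ e - of_int i))" if "m \<le> K" for m e i
    by (rule continuous_on_compose2[OF c[OF that]]) (auto intro!: continuous_intros)
  show ?thesis
    unfolding grid_sum_def[abs_def]
    by (intro continuous_on_mult continuous_on_sum continuous_on_const c' le)
qed

lemma grid_sum_has_derivative:
  assumes "length js < K"
  shows "(grid_sum g n js has_derivative total_deriv (\<lambda>e. grid_sum g n (e # js) u)) (at u)"
proof -
  let ?a = "count_list js 1" and ?b = "count_list js 2"
  have le: "?a < K" "?b < K"
    using assms length_eq_count_list_2[of js] by auto
  have comp: "((\<lambda>u :: real ^ 2. d\<eta> m (2 ^ n * u $ e - of_int i)) has_derivative
      (\<lambda>h. 2 ^ n * h $ e * d\<eta> (Suc m) (2 ^ n * u $ e - of_int i))) (at u)" if "m < K" for m e i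
  proof -
    have "(d\<eta> m has_derivative (*) (d\<eta> (Suc m) (2 ^ n * u $ e - of_int i))) (at (2 ^ n * u $ e - of_int i))"
      using smooth_upto_higher_deriv(1)[OF smooth that] unfolding has_field_derivative_def .
    then have d: "(d\<eta> m has_derivative (\<lambda>h. h * d\<eta> (Suc m) (2 ^ n * u $ e - of_int i))) (at (2 ^ n * u $ e - of_int i))"
      by (rule has_derivative_eq_rhs) (auto simp: mult.commute)
    have "((\<lambda>u :: real ^ 2. 2 ^ n * u $ e - of_int i) has_derivative (\<lambda>h. 2 ^ n * h $ e)) (at u)"
      using has_derivative_diff[OF has_derivative_mult_right[OF
          bounded_linear_imp_has_derivative[OF bounded_linear_vec_nth]] has_derivative_const] by simp
    from has_derivative_compose[OF this d] show ?thesis .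
  qed
  let ?g = "\<lambda>i j. g (grid_point n i j)"
  have "((\<lambda>u. (2 ^ n) ^ length js * (\<Sum>i=-(4^n)..4^n. \<Sum>j=-(4^n)..4^n. ?g i j *
      (d\<eta> ?a (2 ^ n * u $ 1 - of_int i) * d\<eta> ?b (2 ^ n * u $ 2 - of_int j)))) has_derivative
     (\<lambda>h. (2 ^ n) ^ length js * (\<Sum>i=-(4^n)..4^n. \<Sum>j=-(4^n)..4^n. ?g i j *
      (d\<eta> ?a (2 ^ n * u $ 1 - of_int i) * (2 ^ n * h $ 2 * d\<eta> (Suc ?b) (2 ^ n * u $ 2 - of_int j)) +
       2 ^ n * h $ 1 * d\<eta> (Suc ?a) (2 ^ n * u $ 1 - of_int i) * d\<eta> ?b (2 ^ n * u $ 2 - of_int j))))) (at u)"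
    by (intro has_derivative_mult_right has_derivative_sum has_derivative_mult comp le)
  moreover have "(\<lambda>h. (2 ^ n) ^ length js * (\<Sum>i=-(4^n)..4^n. \<Sum>j=-(4^n)..4^n. ?g i j *
      (d\<eta> ?a (2 ^ n * u $ 1 - of_int i) * (2 ^ n * h $ 2 * d\<eta> (Suc ?b) (2 ^ n * u $ 2 - of_int j)) +
       2 ^ n * h $ 1 * d\<eta> (Suc ?a) (2 ^ n * u $ 1 - of_int i) * d\<eta> ?b (2 ^ n * u $ 2 - of_int j))))
     = total_deriv (\<lambda>e. grid_sum g n (e # js) u)"
  proof
    fix h :: "real ^ 2"
    let ?A = "\<Sum>i=-(4^n)..4^n. \<Sum>j=-(4^n)..4^n. ?g i j * (d\<eta> (Suc ?a) (2 ^ n * u $ 1 - of_int i) * d\<eta> ?b (2 ^ n * u $ 2 - of_int j))"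
    let ?B = "\<Sum>i=-(4^n)..4^n. \<Sum>j=-(4^n)..4^n. ?g i j * (d\<eta> ?a (2 ^ n * u $ 1 - of_int i) * d\<eta> (Suc ?b) (2 ^ n * u $ 2 - of_int j))"
    have "(\<Sum>i=-(4^n)..4^n. \<Sum>j=-(4^n)..4^n. ?g i j *
      (d\<eta> ?a (2 ^ n * u $ 1 - of_int i) * (2 ^ n * h $ 2 * d\<eta> (Suc ?b) (2 ^ n * u $ 2 - of_int j)) +
       2 ^ n * h $ 1 * d\<eta> (Suc ?a) (2 ^ n * u $ 1 - of_int i) * d\<eta> ?b (2 ^ n * u $ 2 - of_int j)))
      = 2 ^ n * h $ 2 * ?B + 2 ^ n * h $ 1 * ?A"
      unfolding sum_distrib_left sum.distrib[symmetric]
      by (intro sum.cong refl) (simp only: distrib_left mult_ac)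
    moreover have "grid_sum g n (1 # js) u = (2 ^ n) ^ Suc (length js) * ?A"
      "grid_sum g n (2 # js) u = (2 ^ n) ^ Suc (length js) * ?B"
      by (simp_all add: grid_sum_def)
    ultimately show "(2 ^ n) ^ length js * (\<Sum>i=-(4^n)..4^n. \<Sum>j=-(4^n)..4^n. ?g i j *
      (d\<eta> ?a (2 ^ n * u $ 1 - of_int i) * (2 ^ n * h $ 2 * d\<eta> (Suc ?b) (2 ^ n * u $ 2 - of_int j)) +
       2 ^ n * h $ 1 * d\<eta> (Suc ?a) (2 ^ n * u $ 1 - of_int i) * d\<eta> ?b (2 ^ n * u $ 2 - of_int j)))
      = total_deriv (\<lambda>e. grid_sum g n (e # js) u) h"
      unfolding sum_2 by (simp add: algebra_simps)
  qed
  ultimately show ?thesis unfolding grid_sum_def[abs_def] by (simp only:)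
qed

lemma eventually_window_in_grid:
  "\<forall>\<^sub>F n in sequentially. \<forall>x m. \<bar>x\<bar> \<le> R \<longrightarrow> \<bar>2 ^ n * x - of_int m\<bar> \<le> real W \<longrightarrow> m \<in> {-(4^n)..(4^n)}"
proof -
  obtain N :: nat where N: "R + real W \<le> real N" using real_arch_simple by blast
  have "R + real W \<le> 2 ^ n" if "n \<ge> N" for n
  proof -
    have "N \<le> 2 ^ n" using that less_exp[of n] by linarith
    then have "real N \<le> 2 ^ n" by (metis of_nat_le_iff of_nat_numeral of_nat_power)
    then show ?thesis using N by linarith
  qed
  then have "\<forall>\<^sub>F n in sequentially. R + real W \<le> 2 ^ n" by (auto simp: eventually_sequentially)
  then show ?thesis
  proof eventually_elim
    case (elim n)
    show ?case
    proof (intro allI impI)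
      fix x m assume x: "\<bar>x\<bar> \<le> R" and m: "\<bar>2 ^ n * x - of_int m\<bar> \<le> real W"
      have "\<bar>2 ^ n * x\<bar> \<le> 2 ^ n * R" using x by (simp add: abs_mult)
      then have "\<bar>of_int m\<bar> \<le> 2 ^ n * R + 1 * real W" using m by linarith
      also have "\<dots> \<le> 2 ^ n * R + 2 ^ n * real W"
        by (intro add_left_mono mult_right_mono) auto
      also have "\<dots> \<le> 2 ^ n * 2 ^ n" using elim by (simp flip: distrib_left)
      also have "\<dots> = (4 ^ n :: real)" by (simp flip: power_mult_distrib)
      finally have "real_of_int \<bar>m\<bar> \<le> real_of_int (4 ^ n)" by simp
      then have "\<bar>m\<bar> \<le> 4 ^ n" unfolding of_int_le_iff .
      then show "m \<in> {-(4^n)..(4^n)}" by auto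
    qed
  qed
qed

abbreviation small_differences :: "real \<Rightarrow> (real ^ 2 \<Rightarrow> real) \<Rightarrow> bool" where
  "small_differences b g \<equiv> \<forall>R \<gamma>. \<gamma> < b \<longrightarrow> (\<forall>\<^sub>F n in sequentially.
    \<forall>e i j. \<bar>real_of_int i\<bar> \<le> R * 2 ^ n \<longrightarrow> \<bar>real_of_int j\<bar> \<le> R * 2 ^ n \<longrightarrow>
      \<bar>binom_diff D (\<lambda>r. g (grid_point n i j + (1 / 2 ^ n * real r) *\<^sub>R axis e 1))\<bar> \<le> 2 powr (- real n * \<gamma>))"

text \<open>Rescaling by \<open>2^n\<close> turns two consecutive grids into those of mesh \<open>1/2\<close> and \<open>1\<close>; each derivative costs a
  factor \<open>2^n\<close>.\<close>

lemma grid_sum_increment: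
  assumes small: "small_differences b g"
    and \<gamma>: "\<gamma> < b"
  shows "\<exists>C n0. \<forall>n\<ge>n0. \<forall>js u. length js \<le> K \<longrightarrow> norm u \<le> R \<longrightarrow>
    \<bar>grid_sum g (Suc n) js u - grid_sum g n js u\<bar> \<le> C * 2 powr (real n * (real (length js) - \<gamma>))"
proof -
  obtain C where C: "C \<ge> 0" and est: "refines_2d C"
    using refinement_estimate_2d by blast
  define R' where "R' = \<bar>R\<bar> + 2 * real W + 1"
  define P where "P n \<longleftrightarrow> (\<forall>e i j. \<bar>real_of_int i\<bar> \<le> R' * 2 ^ n \<longrightarrow> \<bar>real_of_int j\<bar> \<le> R' * 2 ^ n \<longrightarrow>
      \<bar>binom_diff D (\<lambda>r. g (grid_point n i j + (1 / 2 ^ n * real r) *\<^sub>R axis e 1))\<bar> \<le> 2 powr (- real n * \<gamma>))" for n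
  define Q where "Q n \<longleftrightarrow> (\<forall>x m. \<bar>x\<bar> \<le> R \<longrightarrow> \<bar>2 ^ n * x - of_int m\<bar> \<le> real W \<longrightarrow> m \<in> {-(4^n)..(4^n)})" for n
  have "\<forall>\<^sub>F n in sequentially. P n \<and> Q n"
    unfolding P_def Q_def by (rule eventually_conj[OF small[THEN spec, THEN spec, THEN mp, OF \<gamma>] eventually_window_in_grid])
  then obtain n0 where n0: "\<And>n. n \<ge> n0 \<Longrightarrow> P n \<and> Q n" by (auto simp: eventually_sequentially)
  define C' where "C' = C * 2 powr (- \<gamma>)"
  show ?thesis
  proof (intro exI[of _ C'] exI[of _ n0] allI impI)
    fix n and js :: "2 list" and u :: "real ^ 2" assume n: "n \<ge> n0" and js: "length js \<le> K" and u: "norm u \<le> R"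
    let ?a = "count_list js 1" and ?b = "count_list js 2"
    have le: "?a \<le> K" "?b \<le> K" using js length_eq_count_list_2[of js] by auto
    define G where "G i j = g (grid_point (Suc n) i j)" for i j :: int
    define x where "x = 2 ^ n * u $ 1"
    define y where "y = 2 ^ n * u $ 2"
    define I where "I = {-(4 ^ Suc n)..(4 :: int) ^ Suc n}"
    define J where "J = {-(4 ^ n)..(4 :: int) ^ n}"
    define \<epsilon> where "\<epsilon> = 2 powr (- real (Suc n) * \<gamma>)"
    have u12: "\<bar>u $ 1\<bar> \<le> R" "\<bar>u $ 2\<bar> \<le> R"
      using component_le_norm_cart[of u] u order_trans by blast+
    have QQ: "Q n" "Q (Suc n)" "P (Suc n)" using n0[of n] n0[of "Suc n"] n by auto
    have win: "i \<in> I" if "\<bar>2 * x - of_int i\<bar> \<le> real W \<or> \<bar>2 * y - of_int i\<bar> \<le> real W" for i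
      using QQ(2) u12 that unfolding Q_def I_def x_def y_def by (auto simp: mult.assoc)
    have win': "i \<in> J" if "\<bar>x - of_int i\<bar> \<le> real W \<or> \<bar>y - of_int i\<bar> \<le> real W" for i
      using QQ(1) u12 that unfolding Q_def J_def x_def y_def by blast
    have range: "\<bar>real_of_int i\<bar> \<le> R' * 2 ^ Suc n" if "\<bar>2 * (2 ^ n * v) - of_int i\<bar> \<le> 2 * real W + 1" "\<bar>v\<bar> \<le> R" for i v
    proof -
      have "\<bar>2 * (2 ^ n * v)\<bar> = 2 ^ Suc n * \<bar>v\<bar>" by (simp add: abs_mult)
      also have "\<dots> \<le> 2 ^ Suc n * \<bar>R\<bar>" using that(2) by (intro mult_left_mono) auto
      finally have b: "\<bar>2 * (2 ^ n * v)\<bar> \<le> 2 ^ Suc n * \<bar>R\<bar>" .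
      have "\<bar>c\<bar> \<le> \<bar>a\<bar> + \<bar>a - c\<bar>" for a c :: real by linarith
      from order_trans[OF this add_mono[OF b that(1)]]
      have "\<bar>real_of_int i\<bar> \<le> 2 ^ Suc n * \<bar>R\<bar> + 1 * (2 * real W + 1)" by simp
      also have "\<dots> \<le> 2 ^ Suc n * \<bar>R\<bar> + 2 ^ Suc n * (2 * real W + 1)"
      proof (intro add_left_mono mult_right_mono)
        show "(1 :: real) \<le> 2 ^ Suc n" by (rule one_le_power) simp
      qed simp
      also have "\<dots> = R' * 2 ^ Suc n" by (simp add: R'_def algebra_simps)
      finally show ?thesis .
    qed
    have "\<bar>(\<Sum>i\<in>I. \<Sum>j\<in>I. G i j * ((2 ^ ?a * d\<eta> ?a (2 * x - of_int i)) * (2 ^ ?b * d\<eta> ?b (2 * y - of_int j))))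
      - (\<Sum>i\<in>J. \<Sum>j\<in>J. G (2 * i) (2 * j) * (d\<eta> ?a (x - of_int i) * d\<eta> ?b (y - of_int j)))\<bar> \<le> C * \<epsilon>"
      (is "\<bar>?S1 - ?S2\<bar> \<le> _")
    proof (rule est[rule_format, OF le])
      show "0 \<le> \<epsilon>" by (simp add: \<epsilon>_def)
      show "finite I" "finite J" by (simp_all add: I_def J_def)
      show "window (2 * x) \<subseteq> I" "window x \<subseteq> J"
        "window (2 * y) \<subseteq> I" "window y \<subseteq> J"
        using win win' by auto
      fix i j :: int
      assume ij: "\<bar>2 * x - of_int i\<bar> \<le> 2 * real W + 1" "\<bar>2 * y - of_int j\<bar> \<le> 2 * real W + 1"
      have "\<bar>real_of_int i\<bar> \<le> R' * 2 ^ Suc n" "\<bar>real_of_int j\<bar> \<le> R' * 2 ^ Suc n"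
        using ij u12 range unfolding x_def y_def by auto
      then show "\<bar>binom_diff D (\<lambda>r. G (i + int r) j)\<bar> \<le> \<epsilon> \<and> \<bar>binom_diff D (\<lambda>r. G i (j + int r))\<bar> \<le> \<epsilon>"
        using QQ(3) unfolding P_def G_def \<epsilon>_def grid_point_shift by blast
    qed
    moreover have "grid_sum g (Suc n) js u = (2 ^ n) ^ length js * ?S1"
    proof -
      have "(2 ^ Suc n) ^ length js = (2 ^ n) ^ length js * (2 ^ ?a * 2 ^ ?b :: real)"
        unfolding power_add[symmetric] length_eq_count_list_2[of js, symmetric]
        by (simp add: power_mult_distrib mult.commute)
      then have "grid_sum g (Suc n) js u = (2 ^ n) ^ length js * ((2 ^ ?a * 2 ^ ?b) *
        (\<Sum>i\<in>I. \<Sum>j\<in>I. G i j * (d\<eta> ?a (2 * x - of_int i) * d\<eta> ?b (2 * y - of_int j))))"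
        unfolding grid_sum_def G_def I_def x_def y_def by (simp only: mult.assoc power_Suc)
      also have "(2 ^ ?a * 2 ^ ?b) * (\<Sum>i\<in>I. \<Sum>j\<in>I. G i j * (d\<eta> ?a (2 * x - of_int i) * d\<eta> ?b (2 * y - of_int j))) = ?S1"
        unfolding sum_distrib_left by (intro sum.cong refl) (simp only: mult_ac)
      finally show ?thesis .
    qed
    moreover have "grid_sum g n js u = (2 ^ n) ^ length js * ?S2"
      unfolding grid_sum_def G_def J_def x_def y_def by (simp add: grid_point_def)
    ultimately have "\<bar>grid_sum g (Suc n) js u - grid_sum g n js u\<bar> \<le> (2 ^ n) ^ length js * (C * \<epsilon>)"
      by (simp add: abs_mult flip: right_diff_distrib)
    also have "\<dots> = C' * 2 powr (real n * (real (length js) - \<gamma>))"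
    proof -
      have "(2 ^ n) ^ length js = 2 powr (real n * real (length js))"
        by (simp add: powr_realpow[symmetric] powr_powr)
      then show ?thesis
        by (simp add: C'_def \<epsilon>_def algebra_simps powr_add powr_diff powr_minus divide_simps)
    qed
    finally show "\<bar>grid_sum g (Suc n) js u - grid_sum g n js u\<bar> \<le> C' * 2 powr (real n * (real (length js) - \<gamma>))" .
  qed
qed

theorem grid_sum_limit:
  assumes small: "small_differences b g"
    and K: "K = Suc k" and kb: "real k < b"
  shows "\<exists>f. (\<forall>u. (\<lambda>n. grid_sum g n [] u) \<longlonglongrightarrow> f u) \<and> regular_upto k b f"
proof (rule smooth_approximation.smooth_limit, unfold_locales)
  show "(grid_sum g n js has_derivative total_deriv (\<lambda>e. grid_sum g n (e # js) u)) (at u)" if "length js \<le> k" for n js u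
    using that K by (intro grid_sum_has_derivative) simp
  show "continuous_on UNIV (grid_sum g n js)" if "length js \<le> Suc k" for n js
    using that K by (intro continuous_grid_sum) simp
  show "\<exists>C n0. \<forall>n\<ge>n0. \<forall>js u. length js \<le> Suc k \<longrightarrow> norm u \<le> R \<longrightarrow>
      \<bar>grid_sum g (Suc n) js u - grid_sum g n js u\<bar> \<le> C * 2 powr (real n * (real (length js) - \<gamma>))"
    if "\<gamma> < b" for R \<gamma>
    using grid_sum_increment[OF small that, of R] K by simp
qed (rule kb)

end

section \<open>Gaussian variables and the variance of linear combinations\<close>

lemma (in prob_space) centered_gaussian_moments:
  assumes X: "gaussian_rv M X" and mean: "expectation X = 0"
  shows "integrable M (\<lambda>\<omega>. X \<omega> ^ (2 * p))"
    and "expectation (\<lambda>\<omega>. X \<omega> ^ (2 * p)) = (expectation (\<lambda>\<omega>. (X \<omega>)\<^sup>2)) ^ p * (fact (2 * p) / (2 ^ p * fact p))"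
proof -
  have [measurable]: "X \<in> borel_measurable M" using X by (simp add: gaussian_rv_def)
  obtain \<mu> \<sigma> where \<sigma>: "0 \<le> \<sigma>" and distr: "distr M borel X =
        (if \<sigma> = 0 then return borel \<mu> else density lborel (\<lambda>x. ennreal (normal_density \<mu> \<sigma> x)))"
    using X by (auto simp: gaussian_rv_def)
  have int_eq: "expectation (\<lambda>\<omega>. f (X \<omega>)) = integral\<^sup>L (distr M borel X) f" if "f \<in> borel_measurable borel" for f :: "real \<Rightarrow> real"
    using that by (simp add: integral_distr)
  have "integrable M (\<lambda>\<omega>. X \<omega> ^ (2 * p)) \<and>
    expectation (\<lambda>\<omega>. X \<omega> ^ (2 * p)) = (expectation (\<lambda>\<omega>. (X \<omega>)\<^sup>2)) ^ p * (fact (2 * p) / (2 ^ p * fact p))"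
  proof (cases "\<sigma> = 0")
    case True
    then have d: "distr M borel X = return borel \<mu>" using distr by simp
    have "\<mu> = 0" using int_eq[of "\<lambda>x. x"] mean by (simp add: d integral_return)
    have "AE x in return borel \<mu>. x = 0" using \<open>\<mu> = 0\<close> by (simp add: AE_return)
    then have "AE \<omega> in M. X \<omega> = 0" unfolding d[symmetric] by (simp add: AE_distr_iff)
    then have ae: "AE \<omega> in M. X \<omega> ^ (2 * p) = 0 ^ (2 * p)" by auto
    have "integrable M (\<lambda>\<omega>. X \<omega> ^ (2 * p))"
      using ae by (subst integrable_cong_AE[where g = "\<lambda>\<omega>. 0 ^ (2 * p)"]) auto
    moreover have "expectation (\<lambda>\<omega>. X \<omega> ^ (2 * p)) = 0 ^ (2 * p)"
      using ae by (subst integral_cong_AE[where g = "\<lambda>\<omega>. 0 ^ (2 * p)"]) (auto simp: prob_space)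
    moreover have "expectation (\<lambda>\<omega>. (X \<omega>)\<^sup>2) = 0"
      using \<open>AE \<omega> in M. X \<omega> = 0\<close> by (subst integral_cong_AE[where g = "\<lambda>\<omega>. 0"]) auto
    ultimately show ?thesis by (cases "p = 0") (auto simp: zero_power)
  next
    case False
    then have \<sigma>: "0 < \<sigma>" using \<sigma> by simp
    have d: "distr M borel X = density lborel (\<lambda>x. ennreal (normal_density \<mu> \<sigma> x))" using distr False by simp
    have E: "expectation (\<lambda>\<omega>. f (X \<omega>)) = integral\<^sup>L lborel (\<lambda>x. normal_density \<mu> \<sigma> x * f x)"
      if [measurable]: "f \<in> borel_measurable borel" for f :: "real \<Rightarrow> real"
      unfolding int_eq[OF that] d by (subst integral_density) auto
    have I: "integrable M (\<lambda>\<omega>. f (X \<omega>)) \<longleftrightarrow> integrable lborel (\<lambda>x. normal_density \<mu> \<sigma> x * f x)"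
      if [measurable]: "f \<in> borel_measurable borel" for f :: "real \<Rightarrow> real"
    proof -
      have "integrable M (\<lambda>\<omega>. f (X \<omega>)) \<longleftrightarrow> integrable (distr M borel X) f"
        by (rule integrable_distr_eq[symmetric]) auto
      then show ?thesis unfolding d by (subst (asm) integrable_density) auto
    qed
    have "\<mu> = 0" using E[of "\<lambda>x. x"] mean integral_normal_moment_nz_1[OF \<sigma>, of \<mu>] by simp
    have m: "expectation (\<lambda>\<omega>. X \<omega> ^ (2 * q)) = fact (2 * q) / ((2 / \<sigma>\<^sup>2) ^ q * fact q)" for q
      using E[of "\<lambda>x. x ^ (2 * q)"] integral_normal_moment_even[OF \<sigma>, of \<mu> q] \<open>\<mu> = 0\<close> by simp
    have "expectation (\<lambda>\<omega>. (X \<omega>)\<^sup>2) = \<sigma>\<^sup>2" using m[of 1] by (simp add: fact_numeral)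
    moreover have "integrable M (\<lambda>\<omega>. X \<omega> ^ (2 * p))"
      using I[of "\<lambda>x. x ^ (2 * p)"] integrable_normal_moment[OF \<sigma>, of \<mu> "2 * p"] \<open>\<mu> = 0\<close> by simp
    ultimately show ?thesis using m[of p] \<sigma> by (simp add: power_divide)
  qed
  then show "integrable M (\<lambda>\<omega>. X \<omega> ^ (2 * p))"
    and "expectation (\<lambda>\<omega>. X \<omega> ^ (2 * p)) = (expectation (\<lambda>\<omega>. (X \<omega>)\<^sup>2)) ^ p * (fact (2 * p) / (2 ^ p * fact p))"
    by auto
qed

text \<open>Chebyshev's inequality for an arbitrarily high even moment.\<close>

lemma (in prob_space) centered_gaussian_tail:
  assumes X: "gaussian_rv M X" and mean: "expectation X = 0"
    and V: "expectation (\<lambda>\<omega>. (X \<omega>)\<^sup>2) \<le> V" and a: "a > 0"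
  shows "prob {\<omega> \<in> space M. a < \<bar>X \<omega>\<bar>} \<le> (fact (2 * p) / (2 ^ p * fact p)) * V ^ p / a ^ (2 * p)"
proof -
  have [measurable]: "X \<in> borel_measurable M" using X by (simp add: gaussian_rv_def)
  have "prob {\<omega> \<in> space M. a < \<bar>X \<omega>\<bar>} \<le> prob {\<omega> \<in> space M. a ^ (2 * p) \<le> X \<omega> ^ (2 * p)}"
  proof (intro finite_measure_mono subsetI)
    fix \<omega> assume "\<omega> \<in> {\<omega> \<in> space M. a < \<bar>X \<omega>\<bar>}"
    then have "\<omega> \<in> space M" "a ^ (2 * p) \<le> \<bar>X \<omega>\<bar> ^ (2 * p)" using a by (auto intro: power_mono)
    then show "\<omega> \<in> {\<omega> \<in> space M. a ^ (2 * p) \<le> X \<omega> ^ (2 * p)}" by (simp add: power_even_abs)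
  qed measurable
  also have "\<dots> \<le> expectation (\<lambda>\<omega>. X \<omega> ^ (2 * p)) / a ^ (2 * p)"
    using a by (intro integral_Markov_inequality_measure[where A = "{}"] centered_gaussian_moments[OF X mean]) auto
  also have "\<dots> \<le> (fact (2 * p) / (2 ^ p * fact p)) * V ^ p / a ^ (2 * p)"
  proof (rule divide_right_mono)
    have "(expectation (\<lambda>\<omega>. (X \<omega>)\<^sup>2)) ^ p \<le> V ^ p"
      by (intro power_mono V) simp
    then show "expectation (\<lambda>\<omega>. X \<omega> ^ (2 * p)) \<le> fact (2 * p) / (2 ^ p * fact p) * V ^ p"
      unfolding centered_gaussian_moments(2)[OF X mean] by (subst mult.commute) (intro mult_left_mono, auto)
  qed (use a in simp)
  finally show ?thesis .
qed

locale isotropic_gaussian_field = prob_space M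
  for M :: "'a measure" +
  fixes T :: "'a \<Rightarrow> real ^ 3 \<Rightarrow> real" and A :: "nat \<Rightarrow> real" and \<beta> :: real
  assumes field: "centered_isotropic_gaussian_field M T"
    and spectrum: "angular_power_spectrum M T A"
    and \<beta>_pos: "\<beta> > 0"
    and spectrum_decay: "summable (\<lambda>l. A l * real l powr (1 + \<beta>))"
begin

lemma A_nonneg: "0 \<le> A l" using spectrum by (simp add: angular_power_spectrum_def)

lemma gaussian_combination:
  fixes n :: nat and x :: "nat \<Rightarrow> real ^ 3"
  assumes "\<And>i. i < n \<Longrightarrow> x i \<in> S2"
  shows "gaussian_rv M (\<lambda>\<omega>. \<Sum>i<n. a i * T \<omega> (x i))"
proof -
  have "\<forall>n x. (\<forall>i<n. x i \<in> S2) \<longrightarrow> multivariate_gaussian M n (\<lambda>i \<omega>. T \<omega> (x i))"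
    using field unfolding centered_isotropic_gaussian_field_def gaussian_field_def by (elim conjE)
  then have "multivariate_gaussian M n (\<lambda>i \<omega>. T \<omega> (x i))" using assms by blast
  then show ?thesis unfolding multivariate_gaussian_def by (rule spec)
qed

lemma gaussian_value: "x \<in> S2 \<Longrightarrow> gaussian_rv M (\<lambda>\<omega>. T \<omega> x)"
  using gaussian_combination[of "Suc 0" "\<lambda>_. x" "\<lambda>_. 1"] by simp

lemma measurable_value: "x \<in> S2 \<Longrightarrow> (\<lambda>\<omega>. T \<omega> x) \<in> borel_measurable M"
  using gaussian_value by (simp add: gaussian_rv_def)

lemma mean_value: "x \<in> S2 \<Longrightarrow> expectation (\<lambda>\<omega>. T \<omega> x) = 0"
  using field unfolding centered_isotropic_gaussian_field_def by simp

lemma square_integrable_value: "x \<in> S2 \<Longrightarrow> integrable M (\<lambda>\<omega>. (T \<omega> x)\<^sup>2)"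
  using centered_gaussian_moments(1)[OF gaussian_value mean_value, of x 1] by simp

lemma integrable_value: "x \<in> S2 \<Longrightarrow> integrable M (\<lambda>\<omega>. T \<omega> x)"
  using square_integrable_imp_integrable[OF measurable_value square_integrable_value] by blast

lemma integrable_product: "x \<in> S2 \<Longrightarrow> y \<in> S2 \<Longrightarrow> integrable M (\<lambda>\<omega>. T \<omega> x * T \<omega> y)"
proof -
  assume xy: "x \<in> S2" "y \<in> S2"
  note [measurable] = measurable_value[OF xy(1)] measurable_value[OF xy(2)]
  show ?thesis
  proof (rule Bochner_Integration.integrable_bound[where f = "\<lambda>\<omega>. (T \<omega> x)\<^sup>2 + (T \<omega> y)\<^sup>2"])
    show "integrable M (\<lambda>\<omega>. (T \<omega> x)\<^sup>2 + (T \<omega> y)\<^sup>2)" using square_integrable_value xy by simp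
    have "\<bar>a * b\<bar> \<le> a\<^sup>2 + b\<^sup>2" for a b :: real
    proof -
      have "2 * (\<bar>a\<bar> * \<bar>b\<bar>) \<le> a\<^sup>2 + b\<^sup>2" using sum_squares_bound[of "\<bar>a\<bar>" "\<bar>b\<bar>"] by (simp add: mult.assoc)
      moreover have "0 \<le> \<bar>a\<bar> * \<bar>b\<bar>" by simp
      ultimately show ?thesis unfolding abs_mult by linarith
    qed
    then show "AE \<omega> in M. norm (T \<omega> x * T \<omega> y) \<le> norm ((T \<omega> x)\<^sup>2 + (T \<omega> y)\<^sup>2)"
      by (intro always_eventually) simp
  qed measurable
qed

lemma covariance_sums:
  "x \<in> S2 \<Longrightarrow> y \<in> S2 \<Longrightarrow> (\<lambda>l. A l * ((2 * real l + 1) / (4 * pi)) * poly (legendre_poly l) (x \<bullet> y))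
    sums expectation (\<lambda>\<omega>. T \<omega> x * T \<omega> y)"
  using spectrum by (simp add: angular_power_spectrum_def)

lemma mean_combination:
  fixes n :: nat and x :: "nat \<Rightarrow> real ^ 3"
  assumes "\<And>i. i < n \<Longrightarrow> x i \<in> S2"
  shows "expectation (\<lambda>\<omega>. \<Sum>i<n. a i * T \<omega> (x i)) = 0"
  using assms by (subst Bochner_Integration.integral_sum) (auto simp: integrable_value mean_value)

lemma variance_combination_sums:
  fixes n :: nat and x :: "nat \<Rightarrow> real ^ 3"
  assumes x: "\<And>i. i < n \<Longrightarrow> x i \<in> S2"
  shows "(\<lambda>l. A l * ((2 * real l + 1) / (4 * pi)) * (\<Sum>j<n. a j * (\<Sum>i<n. a i * poly (legendre_poly l) (x i \<bullet> x j))))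
    sums expectation (\<lambda>\<omega>. (\<Sum>i<n. a i * T \<omega> (x i))\<^sup>2)"
proof -
  have "expectation (\<lambda>\<omega>. (\<Sum>i<n. a i * T \<omega> (x i))\<^sup>2)
    = expectation (\<lambda>\<omega>. \<Sum>j<n. \<Sum>i<n. a j * a i * (T \<omega> (x i) * T \<omega> (x j)))"
    unfolding power2_eq_square sum_product
    by (rule arg_cong[where f = expectation], rule ext, subst sum.swap) (simp add: mult_ac)
  also have "\<dots> = (\<Sum>j<n. \<Sum>i<n. a j * a i * expectation (\<lambda>\<omega>. T \<omega> (x i) * T \<omega> (x j)))"
  proof -
    have int: "integrable M (\<lambda>\<omega>. a j * a i * (T \<omega> (x i) * T \<omega> (x j)))" if "i < n" "j < n" for i j
      using that by (intro integrable_mult_right integrable_product x)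
    have "expectation (\<lambda>\<omega>. \<Sum>j<n. \<Sum>i<n. a j * a i * (T \<omega> (x i) * T \<omega> (x j)))
      = (\<Sum>j<n. expectation (\<lambda>\<omega>. \<Sum>i<n. a j * a i * (T \<omega> (x i) * T \<omega> (x j))))"
      by (rule Bochner_Integration.integral_sum) (auto intro!: Bochner_Integration.integrable_sum int)
    also have "\<dots> = (\<Sum>j<n. \<Sum>i<n. expectation (\<lambda>\<omega>. a j * a i * (T \<omega> (x i) * T \<omega> (x j))))"
      by (intro sum.cong refl Bochner_Integration.integral_sum int) auto
    finally show ?thesis by simp
  qed
  finally have eq: "expectation (\<lambda>\<omega>. (\<Sum>i<n. a i * T \<omega> (x i))\<^sup>2)
    = (\<Sum>j<n. \<Sum>i<n. a j * a i * expectation (\<lambda>\<omega>. T \<omega> (x i) * T \<omega> (x j)))" .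
  have "(\<lambda>l. \<Sum>j<n. \<Sum>i<n. a j * a i * (A l * ((2 * real l + 1) / (4 * pi)) * poly (legendre_poly l) (x i \<bullet> x j)))
    sums (\<Sum>j<n. \<Sum>i<n. a j * a i * expectation (\<lambda>\<omega>. T \<omega> (x i) * T \<omega> (x j)))"
    using x by (intro sums_sum sums_mult covariance_sums) auto
  moreover have "(\<Sum>j<n. \<Sum>i<n. a j * a i * (A l * ((2 * real l + 1) / (4 * pi)) * poly (legendre_poly l) (x i \<bullet> x j)))
    = A l * ((2 * real l + 1) / (4 * pi)) * (\<Sum>j<n. a j * (\<Sum>i<n. a i * poly (legendre_poly l) (x i \<bullet> x j)))" for l
    unfolding sum_distrib_left by (intro sum.cong refl) (simp only: mult_ac)
  ultimately show ?thesis unfolding eq by simp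
qed

end

section \<open>Smallness of the differences on dyadic grids\<close>

lemma binom_diff_eq_sum_lessThan:
  "binom_diff D f = (\<Sum>r<Suc D. (-1) ^ (D - r) * real (D choose r) * f r)"
  by (simp add: binom_diff_def lessThan_Suc_atMost)

context isotropic_gaussian_field
begin

definition chart_diff :: "nat \<Rightarrow> real \<Rightarrow> real ^ 2 \<Rightarrow> real \<Rightarrow> 2 \<Rightarrow> 'a \<Rightarrow> real"
  where "chart_diff D s u h e \<omega> = binom_diff D (\<lambda>r. T \<omega> (stereo_inv s (u + (h * real r) *\<^sub>R axis e 1)))"

lemma chart_diff_gaussian:
  assumes "s\<^sup>2 = 1"
  shows "gaussian_rv M (chart_diff D s u h e)" and "expectation (chart_diff D s u h e) = 0"
proof -
  have S: "stereo_inv s (u + (h * real r) *\<^sub>R axis e 1) \<in> S2" for r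
    using stereo_inv_in_S2[OF assms] .
  show "gaussian_rv M (chart_diff D s u h e)"
    unfolding chart_diff_def[abs_def] binom_diff_eq_sum_lessThan by (rule gaussian_combination) (rule S)
  show "expectation (chart_diff D s u h e) = 0"
    unfolding chart_diff_def[abs_def] binom_diff_eq_sum_lessThan by (rule mean_combination) (rule S)
qed

text \<open>The double difference of the kernel costs \<open>l powr \<beta>\<close>, and the weight \<open>(2l + 1) / (4\<pi>)\<close> costs one more power
  of \<open>l\<close>: together the \<open>l powr (1 + \<beta>)\<close> of the hypothesis.\<close>

lemma chart_diff_variance:
  fixes R :: real and D m :: nat
  assumes "R \<ge> 0" and m: "\<beta> \<le> 2 * real m" and D: "2 * m + 4 * m * m < D"
  shows "\<exists>V\<ge>0. \<forall>s u h e. s\<^sup>2 = 1 \<longrightarrow> norm u \<le> R \<longrightarrow> 0 < h \<longrightarrow> h \<le> 1 \<longrightarrow>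
    expectation (\<lambda>\<omega>. (chart_diff D s u h e \<omega>)\<^sup>2) \<le> V * h powr \<beta>"
proof -
  obtain C where C: "C \<ge> 0" and bound: "\<forall>s u h l e. s\<^sup>2 = 1 \<longrightarrow> norm (u :: real ^ 2) \<le> R \<longrightarrow> 0 < h \<longrightarrow> h \<le> 1 \<longrightarrow>
    \<bar>legendre_chart_diff2 D l s u h e\<bar>
    \<le> C * (real l powr \<beta> * h powr \<beta>)"
    using legendre_stereo_difference_bound[OF assms(1) \<beta>_pos m D] by (elim exE conjE) (rule that)
  define V where "V = C * (\<Sum>l. A l * real l powr (1 + \<beta>))"
  show ?thesis
  proof (intro exI[of _ V] conjI allI impI)
    show "V \<ge> 0" unfolding V_def using C A_nonneg spectrum_decay by (intro mult_nonneg_nonneg suminf_nonneg) auto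
    fix s h :: real and u :: "real ^ 2" and e :: 2
    assume s: "s\<^sup>2 = 1" and u: "norm u \<le> R" and h: "0 < h" "h \<le> 1"
    let ?x = "\<lambda>r. stereo_inv s (u + (h * real r) *\<^sub>R axis e 1)"
    let ?B = "\<lambda>l. binom_diff D (\<lambda>j. binom_diff D (\<lambda>r. poly (legendre_poly l) (?x r \<bullet> ?x j)))"
    have sums: "(\<lambda>l. A l * ((2 * real l + 1) / (4 * pi)) * ?B l) sums expectation (\<lambda>\<omega>. (chart_diff D s u h e \<omega>)\<^sup>2)"
      unfolding chart_diff_def binom_diff_eq_sum_lessThan
      by (rule variance_combination_sums) (rule stereo_inv_in_S2[OF s])
    have "(\<lambda>l. (C * h powr \<beta>) * (A l * real l powr (1 + \<beta>))) sums ((C * h powr \<beta>) * (\<Sum>l. A l * real l powr (1 + \<beta>)))"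
      by (intro sums_mult summable_sums spectrum_decay)
    note sums_bound = this
    have le: "A l * ((2 * real l + 1) / (4 * pi)) * ?B l \<le> (C * h powr \<beta>) * (A l * real l powr (1 + \<beta>))" for l
    proof -
      have "?B l \<le> C * (real l powr \<beta> * h powr \<beta>)"
        using bound[rule_format, OF s u h, of l e] by linarith
      then have "A l * ((2 * real l + 1) / (4 * pi)) * ?B l
        \<le> A l * ((2 * real l + 1) / (4 * pi)) * (C * (real l powr \<beta> * h powr \<beta>))"
        using A_nonneg[of l] by (intro mult_left_mono) auto
      also have "\<dots> = (C * h powr \<beta>) * (A l * (((2 * real l + 1) / (4 * pi)) * real l powr \<beta>))"
        by (simp only: mult_ac)
      also have "\<dots> \<le> (C * h powr \<beta>) * (A l * real l powr (1 + \<beta>))"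
      proof (intro mult_left_mono A_nonneg)
        show "(2 * real l + 1) / (4 * pi) * real l powr \<beta> \<le> real l powr (1 + \<beta>)"
        proof (cases "l = 0")
          case False
          then have "2 * real l + 1 \<le> 3 * real l" by simp
          also have "\<dots> \<le> (4 * pi) * real l" using pi_gt3 by (intro mult_right_mono) auto
          finally have "(2 * real l + 1) / (4 * pi) \<le> real l" by (simp add: divide_le_eq mult.commute)
          then have "(2 * real l + 1) / (4 * pi) * real l powr \<beta> \<le> real l * real l powr \<beta>"
            by (intro mult_right_mono) auto
          then show ?thesis using False by (simp add: powr_add)
        qed simp
        show "0 \<le> C * h powr \<beta>" using C by simp
      qed
      finally show ?thesis .
    qed
    have "expectation (\<lambda>\<omega>. (chart_diff D s u h e \<omega>)\<^sup>2) \<le> (C * h powr \<beta>) * (\<Sum>l. A l * real l powr (1 + \<beta>))"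
      by (rule sums_le[OF le sums sums_bound])
    then show "expectation (\<lambda>\<omega>. (chart_diff D s u h e \<omega>)\<^sup>2) \<le> V * h powr \<beta>"
      by (simp add: V_def mult_ac)
  qed
qed

text \<open>There are about \<open>4^n\<close> grid points, while a moment of high order makes the probability of a large difference
  at one of them smaller than \<open>8^(-n)\<close>. The union bound is summable, and Borel--Cantelli applies.\<close>

lemma chart_diff_small_on_grid:
  fixes R :: nat and D m :: nat
  assumes m: "\<beta> \<le> 2 * real m" and D: "2 * m + 4 * m * m < D" and s: "s\<^sup>2 = 1" and \<gamma>: "\<gamma> < \<beta> / 2"
  shows "AE \<omega> in M. \<forall>\<^sub>F n in sequentially. \<forall>i j. \<bar>real_of_int i\<bar> \<le> real R * 2 ^ n \<longrightarrow> \<bar>real_of_int j\<bar> \<le> real R * 2 ^ n \<longrightarrow>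
    \<bar>chart_diff D s (grid_point n i j) (1 / 2 ^ n) e \<omega>\<bar> \<le> 2 powr (- real n * \<gamma>)"
proof -
  obtain V where V: "V \<ge> 0" and var: "\<forall>s u h e. s\<^sup>2 = 1 \<longrightarrow> norm u \<le> 2 * real R \<longrightarrow> 0 < h \<longrightarrow> h \<le> 1 \<longrightarrow>
    expectation (\<lambda>\<omega>. (chart_diff D s u h e \<omega>)\<^sup>2) \<le> V * h powr \<beta>"
    using chart_diff_variance[of "2 * real R" m D, OF _ m D] by auto
  \<comment> \<open>At a grid point the moment of order \<open>2p\<close> gives \<open>2^(-n p (\<beta> - 2\<gamma>)) \<le> 8^(-n)\<close>, up to a constant, which beats the \<open>4^n\<close> grid points.\<close>
  define p where "p = nat \<lceil>3 / (\<beta> - 2 * \<gamma>)\<rceil>"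
  have p: "real p * (\<beta> - 2 * \<gamma>) \<ge> 3"
  proof -
    have "3 / (\<beta> - 2 * \<gamma>) \<le> real p" unfolding p_def by (rule real_nat_ceiling_ge)
    then show ?thesis using \<gamma> by (simp add: pos_divide_le_eq)
  qed
  define c :: real where "c = fact (2 * p) / (2 ^ p * fact p)"
  have "c \<ge> 0" by (simp add: c_def)
  define Z where "Z n = {- (int R * 2 ^ n)..int R * 2 ^ n}" for n :: nat
  have Zmem: "i \<in> Z n \<longleftrightarrow> \<bar>real_of_int i\<bar> \<le> real R * 2 ^ n" for i n
  proof -
    have "\<bar>real_of_int i\<bar> \<le> real R * 2 ^ n \<longleftrightarrow> real_of_int \<bar>i\<bar> \<le> real_of_int (int R * 2 ^ n)" by simp
    then show ?thesis unfolding Z_def of_int_le_iff by auto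
  qed
  have fin: "finite (Z n)" and card_Z: "real (card (Z n)) \<le> (2 * real R + 1) * 2 ^ n" for n
  proof -
    show "finite (Z n)" by (simp add: Z_def)
    have "real (card (Z n)) = 2 * real R * 2 ^ n + 1" by (simp add: Z_def)
    also have "\<dots> \<le> 2 * real R * 2 ^ n + 1 * 2 ^ n" by simp
    finally show "real (card (Z n)) \<le> (2 * real R + 1) * 2 ^ n" by (simp add: distrib_right)
  qed
  let ?X = "\<lambda>n ij. chart_diff D s (grid_point n (fst ij) (snd ij)) (1 / 2 ^ n) e"
  define E where "E n ij = {\<omega> \<in> space M. 2 powr (- real n * \<gamma>) < \<bar>?X n ij \<omega>\<bar>}" for n ij
  define U where "U n = (\<Union>ij\<in>Z n \<times> Z n. E n ij)" for n
  have measX: "?X n ij \<in> borel_measurable M" for n ij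
    using chart_diff_gaussian(1)[OF s] by (auto simp: gaussian_rv_def)
  have E_sets: "E n ij \<in> sets M" for n ij
    unfolding E_def using measX[of n ij] by measurable
  have U_sets: "U n \<in> sets M" for n
    unfolding U_def using fin E_sets by (intro sets.finite_UN) auto
  have prob_E: "prob (E n ij) \<le> c * V ^ p * (1 / 8) ^ n" if "ij \<in> Z n \<times> Z n" for n ij
  proof -
    have "norm (grid_point n (fst ij) (snd ij)) \<le> 2 * real R"
      using that Zmem by (intro norm_grid_point_le) auto
    then have v: "expectation (\<lambda>\<omega>. (?X n ij \<omega>)\<^sup>2) \<le> V * (1 / 2 ^ n) powr \<beta>"
      by (intro var[rule_format] s) auto
    have "prob (E n ij) \<le> c * (V * (1 / 2 ^ n) powr \<beta>) ^ p / (2 powr (- real n * \<gamma>)) ^ (2 * p)"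
      unfolding E_def c_def by (rule centered_gaussian_tail[OF chart_diff_gaussian[OF s] v]) simp
    also have "\<dots> = c * V ^ p * (2 powr (- (real p * (\<beta> - 2 * \<gamma>)))) ^ n"
    proof -
      have 1: "(1 / 2 ^ n) powr \<beta> = 2 powr (- (real n * \<beta>))"
        by (simp add: powr_divide powr_realpow[symmetric] powr_powr powr_minus_divide)
      have 2: "(2 powr x) ^ k = 2 powr (real k * x)" for x and k :: nat
        by (simp add: powr_powr powr_realpow[symmetric] mult.commute)
      have "(2 powr (- (real n * \<beta>))) ^ p / (2 powr (- real n * \<gamma>)) ^ (2 * p) = (2 powr (- (real p * (\<beta> - 2 * \<gamma>)))) ^ n"
        unfolding 2 powr_diff[symmetric] by (simp add: algebra_simps)
      moreover have "c * (V ^ p * a) / b = c * V ^ p * (a / b)" for a b by simp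
      ultimately show ?thesis unfolding 1 power_mult_distrib by (simp only:)
    qed
    also have "\<dots> \<le> c * V ^ p * (1 / 8) ^ n"
    proof (intro mult_left_mono power_mono)
      have "2 powr (- (real p * (\<beta> - 2 * \<gamma>))) \<le> 2 powr (- 3 :: real)" using p by (intro powr_mono) auto
      also have "\<dots> = 1 / 8" by (simp add: powr_minus_divide)
      finally show "2 powr (- (real p * (\<beta> - 2 * \<gamma>))) \<le> 1 / 8" .
    qed (use \<open>c \<ge> 0\<close> V in auto)
    finally show ?thesis .
  qed
  have prob_U: "prob (U n) \<le> (2 * real R + 1)\<^sup>2 * (c * V ^ p) * (1 / 2) ^ n" for n
  proof -
    have "prob (U n) \<le> (\<Sum>ij\<in>Z n \<times> Z n. prob (E n ij))"
      unfolding U_def using fin E_sets by (intro finite_measure_subadditive_finite) auto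
    also have "\<dots> \<le> (\<Sum>ij\<in>Z n \<times> Z n. c * V ^ p * (1 / 8) ^ n)" by (intro sum_mono prob_E)
    also have "\<dots> = (real (card (Z n)))\<^sup>2 * (c * V ^ p * (1 / 8) ^ n)"
      by (simp add: card_cartesian_product power2_eq_square)
    also have "\<dots> \<le> ((2 * real R + 1) * 2 ^ n)\<^sup>2 * (c * V ^ p * (1 / 8) ^ n)"
      using card_Z \<open>c \<ge> 0\<close> V by (intro mult_right_mono power_mono) auto
    also have "\<dots> = (2 * real R + 1)\<^sup>2 * (c * V ^ p) * ((2 ^ n)\<^sup>2 * (1 / 8) ^ n)"
      unfolding power_mult_distrib[of "2 * real R + 1" "2 ^ n"] by (simp only: mult_ac)
    also have "(2 ^ n)\<^sup>2 * (1 / 8) ^ n = ((1 / 2) ^ n :: real)"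
    proof -
      have "(2 ^ n)\<^sup>2 * (1 / 8) ^ n = (2 * 2 * (1 / 8) :: real) ^ n"
        unfolding power2_eq_square power_mult_distrib ..
      then show ?thesis by simp
    qed
    finally show ?thesis .
  qed
  have "AE \<omega> in M. \<forall>\<^sub>F n in sequentially. \<omega> \<in> space M - U n"
  proof (rule borel_cantelli_AE1[OF U_sets])
    show "emeasure M (U n) < \<infinity>" for n by (simp add: less_top[symmetric])
    have "summable (\<lambda>n. (2 * real R + 1)\<^sup>2 * (c * V ^ p) * (1 / 2) ^ n)"
      by (intro summable_mult summable_geometric) simp
    then show "summable (\<lambda>n. prob (U n))"
      by (rule summable_comparison_test'[where N = 0]) (use prob_U in simp)
  qed
  then show ?thesis
  proof eventually_elim
    case (elim \<omega>)
    then show ?case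
    proof eventually_elim
      case (elim n)
      show ?case
      proof (intro allI impI)
        fix i j assume "\<bar>real_of_int i\<bar> \<le> real R * 2 ^ n" "\<bar>real_of_int j\<bar> \<le> real R * 2 ^ n"
        then have "(i, j) \<in> Z n \<times> Z n" using Zmem by auto
        then have "\<omega> \<notin> E n (i, j)" using elim by (auto simp: U_def)
        then show "\<bar>chart_diff D s (grid_point n i j) (1 / 2 ^ n) e \<omega>\<bar> \<le> 2 powr (- real n * \<gamma>)"
          using elim by (auto simp: E_def not_less)
      qed
    qed
  qed
qed

end

section \<open>Convergence of the quasi-interpolants in mean\<close>

context isotropic_gaussian_field
begin

definition legendre_weight :: "nat \<Rightarrow> real"
  where "legendre_weight l = A l * ((2 * real l + 1) / (4 * pi))"

lemma summable_legendre_weight: "summable legendre_weight"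
proof -
  have x: "axis 1 1 \<in> S2" by (simp add: norm_axis_1)
  have "(axis 1 1 :: real ^ 3) \<bullet> axis 1 1 = 1" by (simp add: inner_axis_axis)
  then have "legendre_weight sums expectation (\<lambda>\<omega>. T \<omega> (axis 1 1) * T \<omega> (axis 1 1))"
    using covariance_sums[OF x x] by (simp add: legendre_weight_def[abs_def] legendre_poly_at_1)
  then show ?thesis by (rule sums_summable)
qed

definition covariance_profile :: "real \<Rightarrow> real"
  where "covariance_profile t = (\<Sum>l. legendre_weight l * poly (legendre_poly l) t)"

lemma covariance_eq_profile:
  "x \<in> S2 \<Longrightarrow> y \<in> S2 \<Longrightarrow> expectation (\<lambda>\<omega>. T \<omega> x * T \<omega> y) = covariance_profile (x \<bullet> y)"
  using covariance_sums[of x y] by (simp add: covariance_profile_def legendre_weight_def sums_iff)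

text \<open>By \<open>\<bar>P\<^sub>l\<bar> \<le> 1\<close> the weights \<open>A l (2l+1)/(4\<pi>)\<close>, whose sum is the variance of the field, dominate the
  Legendre series.\<close>

lemma continuous_on_covariance_profile: "continuous_on {-1..1} covariance_profile"
proof -
  have "uniform_limit {-1..1} (\<lambda>n t. \<Sum>l<n. legendre_weight l * poly (legendre_poly l) t) covariance_profile sequentially"
    unfolding covariance_profile_def[abs_def]
  proof (rule Weierstrass_m_test[OF _ summable_legendre_weight])
    fix l and t :: real assume t: "t \<in> {-1..1}"
    have "0 \<le> legendre_weight l" using A_nonneg by (simp add: legendre_weight_def)
    moreover have "\<bar>poly (legendre_poly l) t\<bar> \<le> 1" using t by (intro abs_legendre_poly_le_1) auto
    ultimately show "norm (legendre_weight l * poly (legendre_poly l) t) \<le> legendre_weight l"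
      by (simp add: abs_mult mult_left_le)
  qed
  then show ?thesis
    by (rule uniform_limit_theorem[rotated]) (auto intro!: always_eventually continuous_on_sum continuous_on_mult continuous_on_const continuous_on_poly continuous_on_id)
qed

text \<open>The field is continuous in mean square because its covariance function is continuous; the mean of the
  absolute value is bounded by \<open>2 \<bar>z\<bar> \<le> \<epsilon> + z\<^sup>2 / \<epsilon>\<close>.\<close>

lemma mean_abs_increment_small:
  assumes "\<epsilon> > 0"
  shows "\<exists>\<delta>>0. \<forall>x\<in>S2. \<forall>y\<in>S2. 1 - x \<bullet> y < \<delta> \<longrightarrow> expectation (\<lambda>\<omega>. \<bar>T \<omega> x - T \<omega> y\<bar>) \<le> \<epsilon>"
proof -
  obtain \<delta> where \<delta>: "\<delta> > 0" "\<And>t. t \<in> {-1..1} \<Longrightarrow> dist t 1 < \<delta> \<Longrightarrow> dist (covariance_profile t) (covariance_profile 1) < \<epsilon>\<^sup>2 / 2"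
  proof -
    have "\<exists>\<delta>>0. \<forall>t\<in>{-1..1}. dist t 1 < \<delta> \<longrightarrow> dist (covariance_profile t) (covariance_profile 1) < \<epsilon>\<^sup>2 / 2"
      using continuous_on_covariance_profile[unfolded continuous_on_iff, rule_format, of 1 "\<epsilon>\<^sup>2 / 2"] assms by simp
    then show ?thesis using that by blast
  qed
  show ?thesis
  proof (intro exI[of _ \<delta>] conjI \<delta> ballI impI)
    fix x y :: "real ^ 3" assume xy: "x \<in> S2" "y \<in> S2" and d: "1 - x \<bullet> y < \<delta>"
    have n: "norm x = 1" "norm y = 1" using xy by auto
    have "\<bar>x \<bullet> y\<bar> \<le> 1" using Cauchy_Schwarz_ineq2[of x y] n by simp
    then have c: "dist (covariance_profile (x \<bullet> y)) (covariance_profile 1) < \<epsilon>\<^sup>2 / 2"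
      using d by (intro \<delta>(2)) (auto simp: dist_real_def)
    have int: "integrable M (\<lambda>\<omega>. T \<omega> a * T \<omega> b)" if "a \<in> S2" "b \<in> S2" for a b using integrable_product that .
    have int2: "integrable M (\<lambda>\<omega>. (T \<omega> x - T \<omega> y)\<^sup>2)"
      unfolding power2_eq_square left_diff_distrib right_diff_distrib
      by (intro Bochner_Integration.integrable_diff int xy)
    have "expectation (\<lambda>\<omega>. (T \<omega> x - T \<omega> y)\<^sup>2)
      = expectation (\<lambda>\<omega>. T \<omega> x * T \<omega> x + T \<omega> y * T \<omega> y - 2 * (T \<omega> x * T \<omega> y))"
      by (rule arg_cong[where f = expectation]) (auto simp: power2_eq_square algebra_simps)
    also have "\<dots> = covariance_profile 1 + covariance_profile 1 - 2 * covariance_profile (x \<bullet> y)"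
      using int xy n by (simp add: covariance_eq_profile dot_square_norm)
    also have "\<dots> \<le> \<epsilon>\<^sup>2" using c unfolding dist_real_def by linarith
    finally have sq: "expectation (\<lambda>\<omega>. (T \<omega> x - T \<omega> y)\<^sup>2) \<le> \<epsilon>\<^sup>2" .
    have "expectation (\<lambda>\<omega>. \<bar>T \<omega> x - T \<omega> y\<bar>) \<le> expectation (\<lambda>\<omega>. \<epsilon> / 2 + (T \<omega> x - T \<omega> y)\<^sup>2 * (1 / (2 * \<epsilon>)))"
    proof (rule integral_mono)
      show "integrable M (\<lambda>\<omega>. \<bar>T \<omega> x - T \<omega> y\<bar>)" using integrable_value xy by simp
      show "integrable M (\<lambda>\<omega>. \<epsilon> / 2 + (T \<omega> x - T \<omega> y)\<^sup>2 * (1 / (2 * \<epsilon>)))" using int2 by simp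
      fix \<omega>
      have "2 * (\<bar>T \<omega> x - T \<omega> y\<bar> * \<epsilon>) \<le> (T \<omega> x - T \<omega> y)\<^sup>2 + \<epsilon>\<^sup>2"
        using sum_squares_bound[of "\<bar>T \<omega> x - T \<omega> y\<bar>" \<epsilon>] by (simp add: mult.assoc)
      then have "\<bar>T \<omega> x - T \<omega> y\<bar> \<le> ((T \<omega> x - T \<omega> y)\<^sup>2 + \<epsilon>\<^sup>2) / (2 * \<epsilon>)"
        using assms by (simp add: pos_le_divide_eq mult_ac)
      also have "\<dots> = \<epsilon> / 2 + (T \<omega> x - T \<omega> y)\<^sup>2 * (1 / (2 * \<epsilon>))"
        using assms by (simp add: add_divide_distrib power2_eq_square)
      finally show "\<bar>T \<omega> x - T \<omega> y\<bar> \<le> \<epsilon> / 2 + (T \<omega> x - T \<omega> y)\<^sup>2 * (1 / (2 * \<epsilon>))" .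
    qed
    also have "\<dots> = \<epsilon> / 2 + expectation (\<lambda>\<omega>. (T \<omega> x - T \<omega> y)\<^sup>2) * (1 / (2 * \<epsilon>))"
      using int2 by (simp add: prob_space)
    also have "\<dots> \<le> \<epsilon> / 2 + \<epsilon>\<^sup>2 * (1 / (2 * \<epsilon>))"
      using sq assms by (intro add_left_mono mult_right_mono) auto
    also have "\<dots> = \<epsilon>" using assms by (simp add: power2_eq_square)
    finally show "expectation (\<lambda>\<omega>. \<bar>T \<omega> x - T \<omega> y\<bar>) \<le> \<epsilon>" .
  qed
qed

end

locale field_approximation = isotropic_gaussian_field M T A \<beta> + reproducing_kernel K D W \<eta>
  for M :: "'a measure" and T A \<beta> K D W \<eta>
begin

definition chart_approx :: "real \<Rightarrow> nat \<Rightarrow> 'a \<Rightarrow> real ^ 2 \<Rightarrow> real"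
  where "chart_approx s n \<omega> u = grid_sum (\<lambda>v. T \<omega> (stereo_inv s v)) n [] u"

lemma chart_approx_eq:
  "chart_approx s n \<omega> u = (\<Sum>i=-(4^n)..4^n. \<Sum>j=-(4^n)..4^n. T \<omega> (stereo_inv s (grid_point n i j)) *
      (\<eta> (2 ^ n * u $ 1 - of_int i) * \<eta> (2 ^ n * u $ 2 - of_int j)))"
  by (simp add: chart_approx_def grid_sum_def)

text \<open>The weights of the quasi-interpolant sum to \<open>1\<close>, are bounded in absolute sum, and charge only points at a
  distance of order \<open>2^(-n)\<close>.\<close>

lemma chart_approx_tendsto_L1:
  assumes s: "s\<^sup>2 = 1"
  shows "(\<lambda>n. expectation (\<lambda>\<omega>. \<bar>chart_approx s n \<omega> u - T \<omega> (stereo_inv s u)\<bar>)) \<longlonglongrightarrow> 0"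
proof -
  let ?err = "\<lambda>n. expectation (\<lambda>\<omega>. \<bar>chart_approx s n \<omega> u - T \<omega> (stereo_inv s u)\<bar>)"
  note S = stereo_inv_in_S2[OF s]
  obtain B where B: "B > 0" "\<And>x. \<bar>\<eta> x\<bar> \<le> B"
  proof -
    obtain B where "B > 0" "\<And>n x. n \<le> K \<Longrightarrow> \<bar>d\<eta> n x\<bar> \<le> B"
      using higher_deriv_kernel_bounded[OF smooth supp] by blast
    from this(1) this(2)[of 0] show ?thesis using that by simp
  qed
  define w where "w = (2 * real W + 1) * (1 * B)"
  have "w > 0" using B by (simp add: w_def add_nonneg_pos)
  have key: "\<forall>\<^sub>F n in sequentially. ?err n \<le> w * w * \<epsilon>"
    if \<epsilon>: "\<epsilon> > 0" for \<epsilon>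
  proof -
    obtain \<delta> where \<delta>: "\<delta> > 0" "\<And>x y. x \<in> S2 \<Longrightarrow> y \<in> S2 \<Longrightarrow> 1 - x \<bullet> y < \<delta> \<Longrightarrow> expectation (\<lambda>\<omega>. \<bar>T \<omega> x - T \<omega> y\<bar>) \<le> \<epsilon>"
      using mean_abs_increment_small[OF \<epsilon>] by blast
    have "(\<lambda>n. 2 * (2 * real W * (1 / 2) ^ n)\<^sup>2) \<longlonglongrightarrow> 2 * (2 * real W * 0)\<^sup>2"
      by (intro tendsto_intros LIMSEQ_power_zero) simp
    then have "\<forall>\<^sub>F n in sequentially. 2 * (2 * real W * (1 / 2) ^ n)\<^sup>2 < \<delta>"
      by (rule order_tendstoD(2)) (use \<delta>(1) in simp)
    then show ?thesis
      using eventually_window_in_grid[of "norm u"]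
    proof eventually_elim
      case (elim n)
      let ?Z = "{-(4^n)..4^n} :: int set"
      let ?a = "\<lambda>i. \<eta> (2 ^ n * u $ 1 - of_int i)" and ?b = "\<lambda>j. \<eta> (2 ^ n * u $ 2 - of_int j)"
      let ?w = "\<lambda>i j. \<bar>?a i\<bar> * \<bar>?b j\<bar>"
      let ?d = "\<lambda>i j \<omega>. T \<omega> (stereo_inv s (grid_point n i j)) - T \<omega> (stereo_inv s u)"
      have comp: "\<bar>u $ 1\<bar> \<le> norm u" "\<bar>u $ 2\<bar> \<le> norm u" by (rule component_le_norm_cart)+
      have win: "window (2 ^ n * u $ e) \<subseteq> ?Z" if "\<bar>u $ e\<bar> \<le> norm u" for e
        using elim(2) that by blast
      have one: "(\<Sum>i\<in>?Z. ?a i) = 1" "(\<Sum>j\<in>?Z. ?b j) = 1"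
        using reproduces[of "[:1:]", OF _ _ win[OF comp(1)]] reproduces[of "[:1:]", OF _ _ win[OF comp(2)]] D_pos by simp_all
      have abs_sum: "(\<Sum>i\<in>?Z. \<bar>\<eta> (y - of_int i)\<bar>) \<le> w" for y
        using kernel_sum_bound[of W "\<lambda>x. \<bar>\<eta> x\<bar>" B ?Z y "\<lambda>_. 1" 1] supp B by (simp add: w_def)
      have mean: "expectation (\<lambda>\<omega>. \<bar>?d i j \<omega>\<bar>) * ?w i j \<le> \<epsilon> * ?w i j" for i j
      proof (cases "\<bar>2 ^ n * u $ 1 - of_int i\<bar> \<le> real W \<and> \<bar>2 ^ n * u $ 2 - of_int j\<bar> \<le> real W")
        case False
        then have "?a i = 0 \<or> ?b j = 0" using supp not_le by blast
        then show ?thesis by auto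
      next
        case True
        have "norm (grid_point n i j - u) \<le> 2 * real W * (1 / 2) ^ n"
        proof -
          have "norm (grid_point n i j - u) \<le> (\<Sum>e\<in>UNIV. \<bar>(grid_point n i j - u) $ e\<bar>)" by (rule norm_le_l1_cart)
          also have "\<dots> = \<bar>2 ^ n * u $ 1 - of_int i\<bar> * (1 / 2) ^ n + \<bar>2 ^ n * u $ 2 - of_int j\<bar> * (1 / 2) ^ n"
          proof -
            have "\<bar>of_int i / 2 ^ n - z\<bar> = \<bar>2 ^ n * z - of_int i\<bar> * (1 / 2) ^ n" for i :: int and z :: real
            proof -
              have "\<bar>2 ^ n * z - of_int i\<bar> * (1 / 2) ^ n = \<bar>(2 ^ n * z - of_int i) * (1 / 2) ^ n\<bar>" by (simp add: abs_mult)
              also have "(2 ^ n * z - of_int i) * (1 / 2) ^ n = z - of_int i / 2 ^ n"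
                by (simp add: power_divide diff_divide_distrib)
              finally show ?thesis by (simp add: abs_minus_commute)
            qed
            then show ?thesis by (simp add: sum_2 grid_point_def)
          qed
          also have "\<dots> \<le> real W * (1 / 2) ^ n + real W * (1 / 2) ^ n"
            using True by (intro add_mono mult_right_mono) auto
          finally show ?thesis by simp
        qed
        then have sq: "(norm (grid_point n i j - u))\<^sup>2 \<le> (2 * real W * (1 / 2) ^ n)\<^sup>2" by (rule power_mono) simp
        have "1 - stereo_inv s (grid_point n i j) \<bullet> stereo_inv s u
          = 2 * ((norm (grid_point n i j - u))\<^sup>2 / (((norm (grid_point n i j))\<^sup>2 + 1) * ((norm u)\<^sup>2 + 1)))"
          unfolding inner_stereo_inv[OF s] by simp
        also have "\<dots> \<le> 2 * ((norm (grid_point n i j - u))\<^sup>2 / 1)"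
          by (intro mult_left_mono divide_left_mono) (auto simp: mult_ge1_I intro!: mult_pos_pos add_nonneg_pos)
        also have "\<dots> < \<delta>" using sq elim(1) unfolding div_by_1 by linarith
        finally have "expectation (\<lambda>\<omega>. \<bar>?d i j \<omega>\<bar>) \<le> \<epsilon>" by (intro \<delta>(2) S)
        then show ?thesis by (intro mult_right_mono) auto
      qed
      have int: "integrable M (?d i j)" for i j by (intro Bochner_Integration.integrable_diff integrable_value S)
      have diff: "chart_approx s n \<omega> u - T \<omega> (stereo_inv s u) = (\<Sum>i\<in>?Z. \<Sum>j\<in>?Z. ?d i j \<omega> * (?a i * ?b j))" for \<omega>
      proof -
        have "T \<omega> (stereo_inv s u) = T \<omega> (stereo_inv s u) * ((\<Sum>i\<in>?Z. ?a i) * (\<Sum>j\<in>?Z. ?b j))" by (simp add: one)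
        also have "\<dots> = (\<Sum>i\<in>?Z. \<Sum>j\<in>?Z. T \<omega> (stereo_inv s u) * (?a i * ?b j))"
          unfolding sum_product unfolding sum_distrib_left ..
        finally have e: "T \<omega> (stereo_inv s u) = (\<Sum>i\<in>?Z. \<Sum>j\<in>?Z. T \<omega> (stereo_inv s u) * (?a i * ?b j))" .
        show ?thesis
          unfolding chart_approx_eq left_diff_distrib sum_subtractf using e by simp
      qed
      have "?err n
        \<le> expectation (\<lambda>\<omega>. \<Sum>i\<in>?Z. \<Sum>j\<in>?Z. \<bar>?d i j \<omega>\<bar> * ?w i j)"
      proof (rule integral_mono)
        show "integrable M (\<lambda>\<omega>. \<bar>chart_approx s n \<omega> u - T \<omega> (stereo_inv s u)\<bar>)"
          unfolding diff by (intro integrable_abs Bochner_Integration.integrable_sum integrable_mult_left int)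
        show "integrable M (\<lambda>\<omega>. \<Sum>i\<in>?Z. \<Sum>j\<in>?Z. \<bar>?d i j \<omega>\<bar> * ?w i j)"
          by (intro Bochner_Integration.integrable_sum integrable_mult_left integrable_abs int)
        show "\<bar>chart_approx s n \<omega> u - T \<omega> (stereo_inv s u)\<bar> \<le> (\<Sum>i\<in>?Z. \<Sum>j\<in>?Z. \<bar>?d i j \<omega>\<bar> * ?w i j)" for \<omega>
          unfolding diff by (intro order_trans[OF sum_abs] sum_mono) (auto simp: abs_mult intro!: order_trans[OF sum_abs])
      qed
      also have "\<dots> = (\<Sum>i\<in>?Z. \<Sum>j\<in>?Z. expectation (\<lambda>\<omega>. \<bar>?d i j \<omega>\<bar>) * ?w i j)"
      proof -
        have i: "integrable M (\<lambda>\<omega>. \<bar>?d i j \<omega>\<bar> * ?w i j)" for i j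
          by (intro integrable_mult_left integrable_abs int)
        have "expectation (\<lambda>\<omega>. \<Sum>i\<in>?Z. \<Sum>j\<in>?Z. \<bar>?d i j \<omega>\<bar> * ?w i j)
          = (\<Sum>i\<in>?Z. expectation (\<lambda>\<omega>. \<Sum>j\<in>?Z. \<bar>?d i j \<omega>\<bar> * ?w i j))"
          by (rule Bochner_Integration.integral_sum) (intro Bochner_Integration.integrable_sum i)
        also have "\<dots> = (\<Sum>i\<in>?Z. \<Sum>j\<in>?Z. expectation (\<lambda>\<omega>. \<bar>?d i j \<omega>\<bar> * ?w i j))"
          by (intro sum.cong refl Bochner_Integration.integral_sum i)
        finally show ?thesis by simp
      qed
      also have "\<dots> \<le> (\<Sum>i\<in>?Z. \<Sum>j\<in>?Z. \<epsilon> * ?w i j)" by (intro sum_mono mean)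
      also have "\<dots> = \<epsilon> * ((\<Sum>i\<in>?Z. \<bar>?a i\<bar>) * (\<Sum>j\<in>?Z. \<bar>?b j\<bar>))"
        unfolding sum_product unfolding sum_distrib_left ..
      also have "\<dots> \<le> \<epsilon> * (w * w)"
        using \<epsilon> \<open>w > 0\<close> by (intro mult_left_mono mult_mono abs_sum sum_nonneg) auto
      finally show "?err n \<le> w * w * \<epsilon>"
        by (simp add: mult_ac)
    qed
  qed
  show ?thesis
  proof (rule tendstoI)
    fix e :: real assume "e > 0"
    have "\<forall>\<^sub>F n in sequentially. ?err n \<le> w * w * (e / (2 * (w * w)))"
      using \<open>e > 0\<close> \<open>w > 0\<close> by (intro key) simp
    then show "\<forall>\<^sub>F n in sequentially. dist (?err n) 0 < e"
    proof eventually_elim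
      case (elim n)
      have "0 \<le> ?err n" by simp
      moreover have "w * w * (e / (2 * (w * w))) < e" using \<open>e > 0\<close> \<open>w > 0\<close> by simp
      ultimately show ?case using elim by (simp add: dist_real_def)
    qed
  qed
qed

end

section \<open>Stereographic charts and regularity on the sphere\<close>

lemma iter_partial_deriv_const_0: "iter_partial_deriv js (\<lambda>u. 0) = (\<lambda>u. 0)"
proof (induction js)
  case (Cons j js)
  have "partial_deriv j (\<lambda>u. 0) = (\<lambda>u. 0)"
    by (simp add: partial_deriv_def fun_eq_iff)
  with Cons show ?case by (simp add: iter_partial_deriv_def)
qed (simp add: iter_partial_deriv_def)

text \<open>Inverse of the chart \<open>stereo_inv 1\<close>; junk at the pole \<open>(0, 0, 1)\<close>, which that chart omits.\<close>

definition stereo :: "real ^ 3 \<Rightarrow> real ^ 2"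
  where "stereo x = vector [x $ 1 / (1 - x $ 3), x $ 2 / (1 - x $ 3)]"

lemma stereo_inv_components:
  "stereo_inv s u $ 1 = 2 * u $ 1 / ((norm u)\<^sup>2 + 1)"
  "stereo_inv s u $ 2 = 2 * u $ 2 / ((norm u)\<^sup>2 + 1)"
  "stereo_inv s u $ 3 = s * ((norm u)\<^sup>2 - 1) / ((norm u)\<^sup>2 + 1)"
  by (simp_all add: stereo_inv_def)

lemma vec3_eq_iff: "(u :: real ^ 3) = v \<longleftrightarrow> u $ 1 = v $ 1 \<and> u $ 2 = v $ 2 \<and> u $ 3 = v $ 3"
  by (simp add: vec_eq_iff forall_3)

lemma one_minus_stereo_inv_3: "1 - stereo_inv 1 u $ 3 = 2 / ((norm u)\<^sup>2 + 1)"
proof -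
  have "(norm u)\<^sup>2 + 1 > 0" by (intro add_nonneg_pos) auto
  then show ?thesis by (simp add: stereo_inv_components field_simps)
qed

lemma stereo_stereo_inv: "stereo (stereo_inv 1 u) = u"
proof -
  have "(norm u)\<^sup>2 + 1 > 0" by (intro add_nonneg_pos) auto
  then show ?thesis
    unfolding vec2_eq_iff stereo_def vector_2 one_minus_stereo_inv_3 by (simp add: stereo_inv_components)
qed

lemma stereo_inv_3_neq_1: "stereo_inv 1 u $ 3 \<noteq> 1"
proof -
  have "(norm u)\<^sup>2 + 1 > 0" by (intro add_nonneg_pos) auto
  then have "1 - stereo_inv 1 u $ 3 > 0" unfolding one_minus_stereo_inv_3 by simp
  then show ?thesis by simp
qed

lemma stereo_inv_stereo:
  assumes x: "x \<in> S2" and "x $ 3 \<noteq> 1"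
  shows "stereo_inv 1 (stereo x) = x"
proof -
  define c where "c = 1 - x $ 3"
  have c: "c \<noteq> 0" "x $ 3 = 1 - c" using assms(2) by (auto simp: c_def)
  have "x \<bullet> x = 1" using x by (simp add: dot_square_norm)
  then have n: "(x $ 1)\<^sup>2 + (x $ 2)\<^sup>2 + (1 - c)\<^sup>2 = 1"
    by (simp add: inner_vec_def sum_3 power2_eq_square c(2))
  have s: "stereo x $ 1 = x $ 1 / c" "stereo x $ 2 = x $ 2 / c" by (simp_all add: stereo_def c_def)
  have "(norm (stereo x))\<^sup>2 = ((x $ 1)\<^sup>2 + (x $ 2)\<^sup>2) / c\<^sup>2"
    unfolding norm_plane s by (simp add: power_divide add_divide_distrib)
  also have "(x $ 1)\<^sup>2 + (x $ 2)\<^sup>2 = c * (2 - c)" using n by (simp add: power2_eq_square algebra_simps)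
  also have "c * (2 - c) / c\<^sup>2 = (2 - c) / c" using c by (simp add: power2_eq_square)
  finally have nn: "(norm (stereo x))\<^sup>2 = (2 - c) / c" .
  have p: "(2 - c) / c + 1 = 2 / c" "(2 - c) / c - 1 = (2 - 2 * c) / c" using c by (simp_all add: field_simps)
  show ?thesis
    unfolding vec3_eq_iff stereo_inv_components nn s p c(2) using c(1) by (simp add: field_simps)
qed

lemma north_pole:
  assumes x: "x \<in> S2" and "x $ 3 = 1"
  shows "x = stereo_inv (-1) 0"
proof -
  have "x \<bullet> x = 1" using x by (simp add: dot_square_norm)
  then have "(x $ 1)\<^sup>2 + (x $ 2)\<^sup>2 = 0"
    by (simp add: inner_vec_def sum_3 power2_eq_square assms(2))
  then have "x $ 1 = 0 \<and> x $ 2 = 0" by (simp add: sum_power2_eq_zero_iff)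
  then show ?thesis
    unfolding vec3_eq_iff stereo_inv_components using assms(2) by simp
qed

text \<open>The two charts are related by inversion in the unit circle.\<close>

lemma stereo_inv_change_of_chart:
  assumes "v \<noteq> 0"
  shows "stereo_inv (-1) v = stereo_inv 1 ((1 / (norm v)\<^sup>2) *\<^sub>R v)"
proof -
  define a where "a = (norm v)\<^sup>2"
  have a: "a > 0" using assms by (simp add: a_def)
  have "(norm ((1 / a) *\<^sub>R v))\<^sup>2 = (1 / a)\<^sup>2 * a" unfolding norm_scaleR power_mult_distrib a_def by simp
  also have "\<dots> = 1 / a" using a by (simp add: power2_eq_square)
  finally have n: "(norm ((1 / a) *\<^sub>R v))\<^sup>2 = 1 / a" .
  have p: "1 / a + 1 = (a + 1) / a" "1 / a - 1 = (1 - a) / a" using a by (simp_all add: field_simps)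
  have "a + 1 > 0" using a by simp
  then show ?thesis
    unfolding vec3_eq_iff stereo_inv_components a_def[symmetric] n p using a
    by (simp add: minus_divide_left)
qed

lemma continuous_on_eq_if_eq_on_dense:
  fixes f g :: "real ^ 2 \<Rightarrow> real"
  assumes Q: "\<And>X. open X \<Longrightarrow> X \<noteq> {} \<Longrightarrow> \<exists>q\<in>Q. q \<in> X" and U: "open U"
    and cont: "continuous_on U f" "continuous_on U g"
    and eq: "\<And>q. q \<in> Q \<Longrightarrow> q \<in> U \<Longrightarrow> f q = g q" and v: "v \<in> U"
  shows "f v = g v"
proof (rule ccontr)
  assume ne: "f v \<noteq> g v"
  let ?X = "U \<inter> (\<lambda>u. f u - g u) -` (- {0})"
  have "open ?X"
    by (intro continuous_open_preimage continuous_on_diff cont U) auto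
  moreover have "v \<in> ?X" using ne v by simp
  then have "?X \<noteq> {}" by blast
  ultimately have "\<exists>q\<in>Q. q \<in> ?X" by (rule Q)
  then obtain q where "q \<in> Q" "q \<in> ?X" by (elim bexE)
  then show False using eq[of q] by simp
qed

lemma k_times_cont_diff_imp_continuous: "k_times_cont_diff k f \<Longrightarrow> continuous_on UNIV f"
proof -
  assume "k_times_cont_diff k f"
  then have "continuous_on UNIV (iter_partial_deriv [] f)"
    unfolding k_times_cont_diff_def by (elim conjE allE[of _ "[]"]) simp
  then show ?thesis by (simp add: iter_partial_deriv_def)
qed

lemma k_times_cont_diff_mono: "k_times_cont_diff k f \<Longrightarrow> j \<le> k \<Longrightarrow> k_times_cont_diff j f"
  unfolding k_times_cont_diff_def by (meson less_le_trans order_trans)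

lemma regular_upto_0: "regular_upto k b (\<lambda>u. 0)"
  by (auto simp: regular_upto_def k_times_cont_diff_def iter_partial_deriv_const_0 locally_hoelder_def intro!: exI[of _ 0])

text \<open>The conclusions are instances of \<open>regular_upto\<close>: since \<open>b \<le> k + 1\<close>, every \<open>\<gamma> < b\<close> is the sum of an order
  \<open>j \<le> k\<close> and an exponent in \<open>[0, 1]\<close>.\<close>

lemma regularity_on_sphere:
  assumes reg: "\<And>s. s \<in> {1, -1} \<Longrightarrow> regular_upto k b (f \<circ> stereo_inv s)"
    and k: "k = nat (\<lceil>b\<rceil> - 1)" and b: "b > 0"
  shows "(\<forall>\<gamma>. 0 \<le> \<gamma> \<and> \<gamma> < b \<longrightarrow> f \<in> C_gamma_S2 \<gamma>) \<and> k_times_cont_diff_S2 k f \<and>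
    (\<forall>\<gamma>. real k < \<gamma> \<and> \<gamma> < b \<longrightarrow> derivs_hoelder_S2 k (\<gamma> - real k) f)"
proof (intro conjI allI impI)
  show diff: "k_times_cont_diff_S2 k f"
    using reg by (auto simp: k_times_cont_diff_S2_def regular_upto_def)
  fix \<gamma> :: real
  have kb: "b \<le> real k + 1" unfolding k using b by linarith
  show "derivs_hoelder_S2 k (\<gamma> - real k) f" if "real k < \<gamma> \<and> \<gamma> < b"
    using reg that kb unfolding derivs_hoelder_S2_def regular_upto_def by auto
  show "f \<in> C_gamma_S2 \<gamma>" if \<gamma>: "0 \<le> \<gamma> \<and> \<gamma> < b"
  proof -
    have fl: "real (nat \<lfloor>\<gamma>\<rfloor>) = of_int \<lfloor>\<gamma>\<rfloor>" using \<gamma> by simp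
    have "\<lfloor>\<gamma>\<rfloor> < \<lceil>b\<rceil>" using \<gamma> by linarith
    then have le: "nat \<lfloor>\<gamma>\<rfloor> \<le> k" using k \<gamma> by linarith
    have frac: "0 \<le> \<gamma> - of_int \<lfloor>\<gamma>\<rfloor>" "\<gamma> - of_int \<lfloor>\<gamma>\<rfloor> \<le> 1" by linarith+
    have "k_times_cont_diff_S2 (nat \<lfloor>\<gamma>\<rfloor>) f"
      using diff k_times_cont_diff_mono[OF _ le] by (auto simp: k_times_cont_diff_S2_def)
    moreover have "derivs_hoelder_S2 (nat \<lfloor>\<gamma>\<rfloor>) (\<gamma> - of_int \<lfloor>\<gamma>\<rfloor>) f"
      unfolding derivs_hoelder_S2_def
    proof (intro ballI allI impI)
      fix s and js :: "2 list" assume s: "s \<in> {1, - 1 :: real}" and js: "length js = nat \<lfloor>\<gamma>\<rfloor>"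
      then show "locally_hoelder (\<gamma> - of_int \<lfloor>\<gamma>\<rfloor>) (iter_partial_deriv js (f \<circ> stereo_inv s))"
        using reg[OF s] frac le \<gamma> fl unfolding regular_upto_def by auto
    qed
    ultimately show ?thesis by (simp add: C_gamma_S2_def)
  qed
qed

section \<open>The limit field in one chart\<close>

context field_approximation
begin

definition chart_limit :: "real \<Rightarrow> 'a \<Rightarrow> real ^ 2 \<Rightarrow> real"
  where "chart_limit s \<omega> u = lim (\<lambda>n. chart_approx s n \<omega> u)"

definition tame :: "real \<Rightarrow> 'a \<Rightarrow> bool"
  where "tame s \<omega> \<longleftrightarrow> small_differences (\<beta> / 2) (\<lambda>v. T \<omega> (stereo_inv s v))"

lemma AE_tame:
  assumes m: "\<beta> \<le> 2 * real m" and D: "2 * m + 4 * m * m < D" and s: "s\<^sup>2 = 1"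
  shows "AE \<omega> in M. tame s \<omega>"
proof -
  \<comment> \<open>Countably many exponents below \<open>\<beta>/2\<close> and radii cover the others, by monotonicity.\<close>
  have "AE \<omega> in M. \<forall>q R e. \<forall>\<^sub>F n in sequentially. \<forall>i j. \<bar>real_of_int i\<bar> \<le> real R * 2 ^ n \<longrightarrow> \<bar>real_of_int j\<bar> \<le> real R * 2 ^ n \<longrightarrow>
    \<bar>chart_diff D s (grid_point n i j) (1 / 2 ^ n) e \<omega>\<bar> \<le> 2 powr (- real n * (\<beta> / 2 - 1 / real (Suc q)))"
    unfolding AE_all_countable
    by (intro allI chart_diff_small_on_grid[OF m D s]) simp
  then show ?thesis
  proof eventually_elim
    case (elim \<omega>)
    show ?case
      unfolding tame_def
    proof (intro allI impI)
      fix R \<gamma> :: real assume "\<gamma> < \<beta> / 2"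
      then obtain q where q: "inverse (real (Suc q)) < \<beta> / 2 - \<gamma>"
        using reals_Archimedean[of "\<beta> / 2 - \<gamma>"] by auto
      define \<gamma>' where "\<gamma>' = \<beta> / 2 - 1 / real (Suc q)"
      have \<gamma>': "\<gamma> \<le> \<gamma>'" using q by (simp add: \<gamma>'_def inverse_eq_divide)
      obtain N :: nat where N: "R \<le> real N" using real_arch_simple by blast
      have ev: "\<forall>\<^sub>F n in sequentially. \<forall>i j. \<bar>real_of_int i\<bar> \<le> real N * 2 ^ n \<longrightarrow> \<bar>real_of_int j\<bar> \<le> real N * 2 ^ n \<longrightarrow>
        \<bar>chart_diff D s (grid_point n i j) (1 / 2 ^ n) e \<omega>\<bar> \<le> 2 powr (- real n * \<gamma>')" for e
        using elim unfolding \<gamma>'_def by blast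
      show "\<forall>\<^sub>F n in sequentially. \<forall>e i j. \<bar>real_of_int i\<bar> \<le> R * 2 ^ n \<longrightarrow> \<bar>real_of_int j\<bar> \<le> R * 2 ^ n \<longrightarrow>
      \<bar>binom_diff D (\<lambda>r. T \<omega> (stereo_inv s (grid_point n i j + (1 / 2 ^ n * real r) *\<^sub>R axis e 1)))\<bar> \<le> 2 powr (- real n * \<gamma>)"
        using ev[of 1] ev[of 2]
      proof eventually_elim
        case (elim n)
        have le: "2 powr (- real n * \<gamma>') \<le> 2 powr (- real n * \<gamma>)"
          using \<gamma>' by (intro powr_mono) (auto intro: mult_left_mono)
        have RN: "R * 2 ^ n \<le> real N * 2 ^ n" using N by (intro mult_right_mono) auto
        show ?case
        proof (intro allI impI)
          fix e :: 2 and i j assume "\<bar>real_of_int i\<bar> \<le> R * 2 ^ n" "\<bar>real_of_int j\<bar> \<le> R * 2 ^ n"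
          then have "\<bar>real_of_int i\<bar> \<le> real N * 2 ^ n" "\<bar>real_of_int j\<bar> \<le> real N * 2 ^ n" using RN by linarith+
          then have "\<bar>chart_diff D s (grid_point n i j) (1 / 2 ^ n) e \<omega>\<bar> \<le> 2 powr (- real n * \<gamma>')"
            using elim exhaust_2[of e] by blast
          with le show "\<bar>binom_diff D (\<lambda>r. T \<omega> (stereo_inv s (grid_point n i j + (1 / 2 ^ n * real r) *\<^sub>R axis e 1)))\<bar> \<le> 2 powr (- real n * \<gamma>)"
            unfolding chart_diff_def by linarith
        qed
      qed
    qed
  qed
qed

lemma tame_limit:
  assumes "tame s \<omega>" and K: "K = Suc k" and kb: "real k < \<beta> / 2"
  shows "(\<lambda>n. chart_approx s n \<omega> u) \<longlonglongrightarrow> chart_limit s \<omega> u" and "regular_upto k (\<beta> / 2) (chart_limit s \<omega>)"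
proof -
  have "\<exists>f. (\<forall>u. (\<lambda>n. grid_sum (\<lambda>v. T \<omega> (stereo_inv s v)) n [] u) \<longlonglongrightarrow> f u) \<and> regular_upto k (\<beta> / 2) f"
    using assms(1) unfolding tame_def by (rule grid_sum_limit[OF _ K kb])
  then obtain f where f: "\<And>u. (\<lambda>n. chart_approx s n \<omega> u) \<longlonglongrightarrow> f u" "regular_upto k (\<beta> / 2) f"
    unfolding chart_approx_def by blast
  have "chart_limit s \<omega> = f" unfolding chart_limit_def[abs_def] using f(1) by (auto intro: limI)
  then show "(\<lambda>n. chart_approx s n \<omega> u) \<longlonglongrightarrow> chart_limit s \<omega> u" and "regular_upto k (\<beta> / 2) (chart_limit s \<omega>)"
    using f by auto
qed

text \<open>Convergence in mean yields almost sure convergence to \<open>T\<close> along a subsequence, whereas on tame paths the whole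
  sequence converges to \<open>chart_limit\<close>.\<close>

lemma chart_limit_AE_eq:
  assumes m: "\<beta> \<le> 2 * real m" and D: "2 * m + 4 * m * m < D" and s: "s\<^sup>2 = 1"
    and K: "K = Suc k" and kb: "real k < \<beta> / 2"
  shows "AE \<omega> in M. chart_limit s \<omega> u = T \<omega> (stereo_inv s u)"
proof -
  note S = stereo_inv_in_S2[OF s]
  let ?d = "\<lambda>n \<omega>. chart_approx s n \<omega> u - T \<omega> (stereo_inv s u)"
  have "integrable M (?d n)" for n
    unfolding chart_approx_eq
    by (intro Bochner_Integration.integrable_diff Bochner_Integration.integrable_sum integrable_mult_left integrable_value S)
  moreover have "(\<lambda>n. \<integral>\<omega>. norm (?d n \<omega>) \<partial>M) \<longlonglongrightarrow> 0"
    using chart_approx_tendsto_L1[OF s, of u] by simp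
  ultimately obtain r where r: "strict_mono r" "AE \<omega> in M. (\<lambda>n. ?d (r n) \<omega>) \<longlonglongrightarrow> 0"
    using tendsto_L1_AE_subseq[of M ?d] by blast
  from r(2) AE_tame[OF m D s] show ?thesis
  proof eventually_elim
    case (elim \<omega>)
    have "(\<lambda>n. chart_approx s n \<omega> u) \<longlonglongrightarrow> chart_limit s \<omega> u" by (rule tame_limit(1)[OF elim(2) K kb])
    from LIMSEQ_subseq_LIMSEQ[OF this r(1)]
    have "(\<lambda>n. ?d (r n) \<omega>) \<longlonglongrightarrow> chart_limit s \<omega> u - T \<omega> (stereo_inv s u)"
      by (intro tendsto_diff tendsto_const) (simp add: o_def)
    from LIMSEQ_unique[OF this elim(1)] show ?case by simp
  qed
qed

lemma chart_limit_measurable: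
  assumes s: "s\<^sup>2 = 1" and p: "p \<in> borel_measurable (restrict_space borel S2)"
  shows "(\<lambda>z. chart_limit s (fst z) (p (snd z))) \<in> borel_measurable (M \<Otimes>\<^sub>M restrict_space borel S2)"
proof -
  have c: "\<eta> \<in> borel_measurable borel"
    using smooth_upto_higher_deriv(2)[OF smooth, of 0] by (intro borel_measurable_continuous_onI) simp
  have comp: "(\<lambda>x. p x $ e) \<in> borel_measurable (restrict_space borel S2)" for e
  proof -
    have "(\<lambda>v :: real ^ 2. v $ e) \<in> borel_measurable borel"
      by (intro borel_measurable_continuous_onI linear_continuous_on bounded_linear_vec_nth)
    from measurable_compose[OF p this] show ?thesis .
  qed
  have w: "(\<lambda>z. \<eta> (2 ^ n * p (snd z) $ e - of_int i)) \<in> borel_measurable (M \<Otimes>\<^sub>M restrict_space borel S2)" for n e i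
  proof -
    have "(\<lambda>z. 2 ^ n * p (snd z) $ e - of_int i) \<in> borel_measurable (M \<Otimes>\<^sub>M restrict_space borel S2)"
      using measurable_compose[OF measurable_snd comp] by (intro borel_measurable_diff borel_measurable_times) auto
    from measurable_compose[OF this c] show ?thesis .
  qed
  have t: "(\<lambda>z. T (fst z) (stereo_inv s v)) \<in> borel_measurable (M \<Otimes>\<^sub>M restrict_space borel S2)" for v
    using measurable_compose[OF measurable_fst measurable_value[OF stereo_inv_in_S2[OF s, of v]]] .
  have "(\<lambda>z. chart_approx s n (fst z) (p (snd z))) \<in> borel_measurable (M \<Otimes>\<^sub>M restrict_space borel S2)" for n
    unfolding chart_approx_eq by (intro borel_measurable_sum borel_measurable_times t w)
  then show ?thesis
    unfolding chart_limit_def by (rule borel_measurable_lim_metric)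
qed

end

section \<open>Gluing the charts\<close>

lemma stereo_measurable: "stereo \<in> borel_measurable (restrict_space borel S2)"
proof -
  have c: "(\<lambda>x :: real ^ 3. x $ e) \<in> borel_measurable borel" for e
    by (intro borel_measurable_continuous_onI linear_continuous_on bounded_linear_vec_nth)
  have q: "(\<lambda>x :: real ^ 3. x $ e / (1 - x $ 3)) \<in> borel_measurable borel" for e
    by (intro borel_measurable_divide borel_measurable_diff c) simp
  have eq: "stereo = (\<lambda>x. (x $ 1 / (1 - x $ 3)) *\<^sub>R axis 1 1 + (x $ 2 / (1 - x $ 3)) *\<^sub>R axis 2 1)"
    by (simp add: fun_eq_iff vec2_eq_iff stereo_def axis_def)
  have "stereo \<in> borel_measurable borel"
    unfolding eq by (intro borel_measurable_add borel_measurable_scaleR q borel_measurable_const)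
  then show ?thesis by (rule measurable_restrict_space1)
qed

context field_approximation
begin

lemma exists_regular_modification:
  assumes m: "\<beta> \<le> 2 * real m" and D: "2 * m + 4 * m * m < D"
    and K: "K = Suc k" and kb: "real k < \<beta> / 2"
  shows "\<exists>T'. modification M T T' \<and>
    (\<forall>\<omega>\<in>space M. \<forall>s\<in>{1, -1}. regular_upto k (\<beta> / 2) (T' \<omega> \<circ> stereo_inv s))"
proof -
  have sq: "(1 :: real)\<^sup>2 = 1" "(-1 :: real)\<^sup>2 = 1" by simp_all
  \<comment> \<open>Agreement of the two charts has to be an almost sure event, so it is required at countably many points only.\<close>
  obtain Q :: "(real ^ 2) set" where Q: "countable Q" "\<And>X. open X \<Longrightarrow> X \<noteq> {} \<Longrightarrow> \<exists>q\<in>Q. q \<in> X"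
    using countable_dense_setE by blast
  let ?swap = "\<lambda>v :: real ^ 2. (1 / (norm v)\<^sup>2) *\<^sub>R v"
  have "AE \<omega> in M. \<forall>q\<in>Q. q \<noteq> 0 \<longrightarrow> chart_limit (-1) \<omega> q = chart_limit 1 \<omega> (?swap q)"
    unfolding AE_ball_countable[OF Q(1)]
  proof
    fix q assume "q \<in> Q"
    from chart_limit_AE_eq[OF m D sq(2) K kb, of q] chart_limit_AE_eq[OF m D sq(1) K kb, of "?swap q"]
    show "AE \<omega> in M. q \<noteq> 0 \<longrightarrow> chart_limit (-1) \<omega> q = chart_limit 1 \<omega> (?swap q)"
      by eventually_elim (simp add: stereo_inv_change_of_chart)
  qed
  with AE_tame[OF m D sq(1)] AE_tame[OF m D sq(2)]
  have "AE \<omega> in M. tame 1 \<omega> \<and> tame (-1) \<omega> \<and> (\<forall>q\<in>Q. q \<noteq> 0 \<longrightarrow> chart_limit (-1) \<omega> q = chart_limit 1 \<omega> (?swap q))"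
    by eventually_elim simp
  then obtain N where N: "{\<omega> \<in> space M. \<not> (tame 1 \<omega> \<and> tame (-1) \<omega> \<and>
      (\<forall>q\<in>Q. q \<noteq> 0 \<longrightarrow> chart_limit (-1) \<omega> q = chart_limit 1 \<omega> (?swap q)))} \<subseteq> N" "emeasure M N = 0" "N \<in> sets M"
    by (rule AE_E)
  have good: "tame 1 \<omega>" "tame (-1) \<omega>" "\<And>q. q \<in> Q \<Longrightarrow> q \<noteq> 0 \<Longrightarrow> chart_limit (-1) \<omega> q = chart_limit 1 \<omega> (?swap q)"
    if "\<omega> \<in> space M" "\<omega> \<notin> N" for \<omega>
    using N(1) that by blast+
  have agree: "chart_limit (-1) \<omega> v = chart_limit 1 \<omega> (?swap v)" if \<omega>: "\<omega> \<in> space M" "\<omega> \<notin> N" and v: "v \<noteq> 0" for \<omega> v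
  proof (rule continuous_on_eq_if_eq_on_dense[where U = "- {0}" and f = "chart_limit (-1) \<omega>" and g = "\<lambda>v. chart_limit 1 \<omega> (?swap v)", OF Q(2)])
    have c: "continuous_on UNIV (chart_limit s \<omega>)" if "tame s \<omega>" for s
      using tame_limit(2)[OF that K kb] by (intro k_times_cont_diff_imp_continuous) (auto simp: regular_upto_def)
    show "continuous_on (- {0}) (chart_limit (-1) \<omega>)"
      using c[OF good(2)[OF \<omega>]] by (rule continuous_on_subset) simp
    show "continuous_on (- {0}) (\<lambda>v. chart_limit 1 \<omega> (?swap v))"
      by (rule continuous_on_compose2[OF c[OF good(1)[OF \<omega>]]]) (auto intro!: continuous_intros)
  qed (use good(3)[OF \<omega>] v in auto)
  \<comment> \<open>The point with third coordinate \<open>1\<close> is the pole missed by the first chart and the origin of the second.\<close>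
  define T' where "T' \<omega> x = (if \<omega> \<in> N then 0 else if x $ 3 = 1 then chart_limit (-1) \<omega> 0 else chart_limit 1 \<omega> (stereo x))"
    for \<omega> and x :: "real ^ 3"
  have T'_1: "T' \<omega> \<circ> stereo_inv 1 = chart_limit 1 \<omega>" if "\<omega> \<notin> N" for \<omega>
    using that by (auto simp: T'_def stereo_inv_3_neq_1 stereo_stereo_inv)
  have T'_2: "T' \<omega> \<circ> stereo_inv (-1) = chart_limit (-1) \<omega>" if \<omega>: "\<omega> \<in> space M" "\<omega> \<notin> N" for \<omega>
  proof
    fix v :: "real ^ 2"
    show "(T' \<omega> \<circ> stereo_inv (-1)) v = chart_limit (-1) \<omega> v"
    proof (cases "v = 0")
      case True
      then show ?thesis using \<omega> by (simp add: T'_def stereo_inv_components)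
    next
      case False
      have "(T' \<omega> \<circ> stereo_inv (-1)) v = (T' \<omega> \<circ> stereo_inv 1) (?swap v)"
        by (simp add: stereo_inv_change_of_chart[OF False])
      then show ?thesis unfolding T'_1[OF \<omega>(2)] agree[OF \<omega> False] .
    qed
  qed
  have regular: "regular_upto k (\<beta> / 2) (T' \<omega> \<circ> stereo_inv s)" if "\<omega> \<in> space M" "s \<in> {1, -1}" for \<omega> s
  proof (cases "\<omega> \<in> N")
    case True
    then have "T' \<omega> \<circ> stereo_inv s = (\<lambda>u. 0)" by (auto simp: T'_def)
    then show ?thesis by (simp only: regular_upto_0)
  next
    case False
    then have "T' \<omega> \<circ> stereo_inv s = chart_limit s \<omega> \<and> tame s \<omega>"
      using that T'_1[OF False] T'_2[OF that(1) False] good(1,2)[OF that(1) False] by auto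
    then show ?thesis using tame_limit(2)[of s \<omega>, OF _ K kb] by simp
  qed
  have rf: "random_field M T'"
    unfolding random_field_def
  proof -
    let ?P = "M \<Otimes>\<^sub>M restrict_space borel S2"
    have c3: "(\<lambda>x :: real ^ 3. x $ 3) \<in> borel_measurable (restrict_space borel S2)"
      by (intro measurable_restrict_space1 borel_measurable_continuous_onI linear_continuous_on bounded_linear_vec_nth)
    have [measurable]: "(\<lambda>z. snd z $ 3) \<in> borel_measurable ?P"
      using measurable_compose[OF measurable_snd c3] .
    have [measurable]: "N \<in> sets M" by (rule N)
    have [measurable]: "(\<lambda>z. chart_limit (-1) (fst z) 0) \<in> borel_measurable ?P"
      "(\<lambda>z. chart_limit 1 (fst z) (stereo (snd z))) \<in> borel_measurable ?P"
      using chart_limit_measurable[OF sq(2) borel_measurable_const, of 0]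
        chart_limit_measurable[OF sq(1) stereo_measurable] .
    have "(\<lambda>z. if fst z \<in> N then 0 else if snd z $ 3 = 1 then chart_limit (-1) (fst z) 0
        else chart_limit 1 (fst z) (stereo (snd z))) \<in> borel_measurable ?P"
      by measurable
    then show "(\<lambda>(\<omega>, x). T' \<omega> x) \<in> borel_measurable ?P"
      by (simp add: T'_def case_prod_beta)
  qed
  have "\<P>(\<omega> in M. T' \<omega> x = T \<omega> x) = 1" if x: "x \<in> S2" for x
  proof -
    have "(\<lambda>\<omega>. (\<omega>, x)) \<in> measurable M (M \<Otimes>\<^sub>M restrict_space borel S2)"
      using x by (intro measurable_Pair measurable_ident measurable_const) (simp_all add: space_restrict_space)
    from measurable_compose[OF this rf[unfolded random_field_def]]
    have [measurable]: "(\<lambda>\<omega>. T' \<omega> x) \<in> borel_measurable M" by simp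
    have [measurable]: "(\<lambda>\<omega>. T \<omega> x) \<in> borel_measurable M" by (rule measurable_value[OF x])
    have notN: "AE \<omega> in M. \<omega> \<notin> N" using N(2,3) by (intro AE_not_in) (auto simp: null_sets_def)
    have "AE \<omega> in M. T' \<omega> x = T \<omega> x"
    proof (cases "x $ 3 = 1")
      case True
      from notN chart_limit_AE_eq[OF m D sq(2) K kb, of 0] show ?thesis
        by eventually_elim (simp add: T'_def True north_pole[OF x True, symmetric])
    next
      case False
      from notN chart_limit_AE_eq[OF m D sq(1) K kb, of "stereo x"] show ?thesis
        by eventually_elim (simp add: T'_def False stereo_inv_stereo[OF x False])
    qed
    then show ?thesis by (subst prob_Collect_eq_1) auto
  qed
  with rf have "modification M T T'" by (simp add: modification_def)
  with regular show ?thesis by blast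
qed

end

theorem theorem4p6:
  fixes M :: "'a measure"
    and T :: "'a \<Rightarrow> real ^ 3 \<Rightarrow> real"
    and A :: "nat \<Rightarrow> real"
    and \<beta> :: real
  assumes "prob_space M"
    and "centered_isotropic_gaussian_field M T"
    and "angular_power_spectrum M T A"
    and "\<beta> > 0"
    and "summable (\<lambda>l. A l * real l powr (1 + \<beta>))"
  shows "\<exists>T'. modification M T T' \<and>
    (\<forall>\<gamma>. 0 \<le> \<gamma> \<and> \<gamma> < \<beta> / 2 \<longrightarrow> (\<forall>\<omega>\<in>space M. T' \<omega> \<in> C_gamma_S2 \<gamma>)) \<and>
    (\<forall>k. k = nat (\<lceil>\<beta> / 2\<rceil> - 1) \<longrightarrow>
      (\<forall>\<omega>\<in>space M. k_times_cont_diff_S2 k (T' \<omega>) \<and>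
        (\<forall>\<gamma>. real k < \<gamma> \<and> \<gamma> < \<beta> / 2 \<longrightarrow> derivs_hoelder_S2 k (\<gamma> - real k) (T' \<omega>))))"
proof -
  interpret isotropic_gaussian_field M T A \<beta>
    using assms by (simp add: isotropic_gaussian_field_def isotropic_gaussian_field_axioms_def)
  define m where "m = nat \<lceil>\<beta> / 2\<rceil>"
  \<comment> \<open>For powers \<open>k < m\<close> the numerator has degree \<open>2k\<close> and the approximation of \<open>w^k\<close> up to \<open>h^(2m)\<close> has degree \<open>4 m k\<close>.\<close>
  define D where "D = 2 * m + 4 * m * m + 1"
  define k where "k = nat (\<lceil>\<beta> / 2\<rceil> - 1)"
  have m: "\<beta> \<le> 2 * real m" using real_nat_ceiling_ge[of "\<beta> / 2"] by (simp add: m_def)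
  have kb: "real k < \<beta> / 2" unfolding k_def using \<open>\<beta> > 0\<close> by linarith
  obtain \<eta> :: "real \<Rightarrow> real" and W :: nat where \<eta>: "smooth_upto (Suc k) \<eta>" "\<forall>x. \<bar>x\<bar> > real W \<longrightarrow> \<eta> x = 0"
    "\<forall>p x I. degree p < D \<longrightarrow> finite I \<longrightarrow> {i :: int. \<bar>x - of_int i\<bar> \<le> real W} \<subseteq> I \<longrightarrow>
      (\<Sum>i\<in>I. poly p (of_int i) * \<eta> (x - of_int i)) = poly p x"
    using exists_reproducing_kernel[of "Suc k" D] by blast
  interpret reproducing_kernel "Suc k" D W \<eta>
    using \<eta> by unfold_locales (simp_all add: D_def)
  interpret field_approximation M T A \<beta> "Suc k" D W \<eta> ..
  obtain T' where T': "modification M T T'"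
    and reg: "\<And>\<omega> s. \<omega> \<in> space M \<Longrightarrow> s \<in> {1, -1} \<Longrightarrow> regular_upto k (\<beta> / 2) (T' \<omega> \<circ> stereo_inv s)"
    using exists_regular_modification[OF m _ refl kb] by (auto simp: D_def)
  have "(\<forall>\<gamma>. 0 \<le> \<gamma> \<and> \<gamma> < \<beta> / 2 \<longrightarrow> T' \<omega> \<in> C_gamma_S2 \<gamma>) \<and> k_times_cont_diff_S2 k (T' \<omega>) \<and>
    (\<forall>\<gamma>. real k < \<gamma> \<and> \<gamma> < \<beta> / 2 \<longrightarrow> derivs_hoelder_S2 k (\<gamma> - real k) (T' \<omega>))" if "\<omega> \<in> space M" for \<omega>
    using reg[OF that] \<open>\<beta> > 0\<close> by (intro regularity_on_sphere) (auto simp: k_def)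
  with T' show ?thesis unfolding k_def by blast
qed

end
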